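(* Let $n\geq 2$ and let $(\overline{M},\langle\,,\rangle)$ be an $(n+1)$-dimensional Lorentzian manifold which admits a globally defined parallel lightlike vector field. Suppose that $\overline{\mathrm{Ric}}(Z,Z)\geq 0$ for every timelike vector $Z$ tangent to $\overline{M}$, where $\overline{\mathrm{Ric}}$ is the Ricci tensor of $\overline{M}$. Let $x:M\longrightarrow\overline{M}$ be a compact isometrically immersed spacelike hypersurface. If $M$ has constant mean curvature, then $M$ is totally geodesic. Consequently, there is no compact immersed spacelike hypersurface in $\overline{M}$ whose mean curvature is constant and different from zero.
   Context: Manifolds are smooth and without boundary. The signature of a Lorentzian metric is $(-,+,\dots,+)$. A vector field $\xi$ on $\overline{M}$ is lightlike if $\langle\xi,\xi\rangle=0$ and $\xi\neq 0$ at every point; it is parallel if $\overline{\nabla}\xi=0$, where $\overline{\nabla}$ is the Levi-Civita connection of $\overline{M}$. A tangent vector $Z$ is timelike if $\langle Z,Z\rangle<0$. An immersed hypersurface is spacelike if the induced metric is Riemannian. Given a parallel lightlike vector field $\xi$ on $\overline{M}$, a spacelike hypersurface $M$ has a unique globally defined unit timelike normal vector field $N$ with $\langle N,\xi\rangle>0$; the shape operator is $AX=-\overline{\nabla}_X N$ and the mean curvature function is $\mathcal{H}=-\frac{1}{n}\,\mathrm{trace}(A)$. $M$ is totally geodesic if $A\equiv 0$. The Ricci tensor uses the standard sign convention (positive on round spheres). *)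

theory Defs
  imports "HOL-Analysis.Analysis"
begin

text \<open>For open \<open>S\<close> this is class \<open>C\<^sup>k\<close> on \<open>S\<close>. It is used only for open \<open>S\<close>, since derivatives are
  taken \<open>at x\<close> rather than within \<open>S\<close>.\<close>

primrec Ck_on :: "nat \<Rightarrow> 'a::real_normed_vector set \<Rightarrow> ('a \<Rightarrow> 'b::real_normed_vector) \<Rightarrow> bool" where
  "Ck_on 0 S f \<longleftrightarrow> continuous_on S f"
| "Ck_on (Suc k) S f \<longleftrightarrow> (\<forall>x\<in>S. f differentiable (at x)) \<and>
     (\<forall>v. Ck_on k S (\<lambda>x. frechet_derivative f (at x) v))"

definition smooth_on :: "'a::real_normed_vector set \<Rightarrow> ('a \<Rightarrow> 'b::real_normed_vector) \<Rightarrow> bool" where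
  "smooth_on S f \<longleftrightarrow> (\<forall>k. Ck_on k S f)"


section \<open>Smooth manifolds and tangent vectors\<close>

text \<open>
  A manifold is a whole type \<open>'m\<close> (Hausdorff and second countable by its type classes) together
  with a smooth atlas modelled on a Euclidean space \<open>'e\<close>, so its dimension is \<open>DIM('e)\<close>. A chart
  is a pair of its domain and its coordinate map; the values of the coordinate map outside of the
  domain are irrelevant. The atlas need not be maximal.
\<close>

type_synonym ('m, 'e) chart = "'m set \<times> ('m \<Rightarrow> 'e)"

abbreviation cdom :: "('m, 'e) chart \<Rightarrow> 'm set" where "cdom \<equiv> fst"
abbreviation cmap :: "('m, 'e) chart \<Rightarrow> 'm \<Rightarrow> 'e" where "cmap \<equiv> snd"

definition cinv :: "('m, 'e) chart \<Rightarrow> 'e \<Rightarrow> 'm" where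
  "cinv c = inv_into (cdom c) (cmap c)"

definition is_chart :: "('m::topological_space, 'e::euclidean_space) chart \<Rightarrow> bool" where
  "is_chart c \<longleftrightarrow> open (cdom c) \<and> open (cmap c ` cdom c) \<and>
     homeomorphism (cdom c) (cmap c ` cdom c) (cmap c) (cinv c)"

definition smooth_atlas ::
  "('m::{t2_space, second_countable_topology}, 'e::euclidean_space) chart set \<Rightarrow> bool" where
  "smooth_atlas A \<longleftrightarrow> (\<forall>c\<in>A. is_chart c) \<and> (\<Union>c\<in>A. cdom c) = UNIV \<and>
     (\<forall>c\<in>A. \<forall>d\<in>A. smooth_on (cmap c ` (cdom c \<inter> cdom d)) (cmap d \<circ> cinv c))"

definition charts_at :: "('m, 'e) chart set \<Rightarrow> 'm \<Rightarrow> ('m, 'e) chart set" where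
  "charts_at A p = {c \<in> A. p \<in> cdom c}"

text \<open>An arbitrary chart of the atlas around \<open>p\<close>; used below only for chart-independent quantities.\<close>

definition chart_at :: "('m, 'e) chart set \<Rightarrow> 'm \<Rightarrow> ('m, 'e) chart" where
  "chart_at A p = (SOME c. c \<in> charts_at A p)"

text \<open>
  A tangent vector at \<open>p\<close> assigns to every chart around \<open>p\<close> its components in that chart, subject
  to the transformation law of contravariant vectors. It is set to 0 at all other charts to make
  the representation unique. The zero vector is \<open>\<lambda>_. 0\<close>.
\<close>

type_synonym ('m, 'e) tvec = "('m, 'e) chart \<Rightarrow> 'e"

definition tangent_space ::
  "('m, 'e::euclidean_space) chart set \<Rightarrow> 'm \<Rightarrow> ('m, 'e) tvec set" where
  "tangent_space A p = {v.
     (\<forall>c\<in>charts_at A p. \<forall>d\<in>charts_at A p.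
        v d = frechet_derivative (cmap d \<circ> cinv c) (at (cmap c p)) (v c)) \<and>
     (\<forall>c. c \<notin> charts_at A p \<longrightarrow> v c = 0)}"

text \<open>The tangent vector at \<open>p\<close> with components \<open>u\<close> in the chart \<open>c\<close>.\<close>

definition tvec_of ::
  "('m, 'e::euclidean_space) chart set \<Rightarrow> ('m, 'e) chart \<Rightarrow> 'm \<Rightarrow> 'e \<Rightarrow> ('m, 'e) tvec" where
  "tvec_of A c p u = (\<lambda>d. if d \<in> charts_at A p
     then frechet_derivative (cmap d \<circ> cinv c) (at (cmap c p)) u else 0)"

definition tangent_trace ::
  "('m, 'e::euclidean_space) chart set \<Rightarrow> 'm \<Rightarrow> (('m, 'e) tvec \<Rightarrow> ('m, 'e) tvec) \<Rightarrow> real" where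
  "tangent_trace A p T = (let c = chart_at A p in
     \<Sum>b\<in>Basis. T (tvec_of A c p b) c \<bullet> b)"

definition smooth_vector_field ::
  "('m, 'e::euclidean_space) chart set \<Rightarrow> ('m \<Rightarrow> ('m, 'e) tvec) \<Rightarrow> bool" where
  "smooth_vector_field A V \<longleftrightarrow> (\<forall>p. V p \<in> tangent_space A p) \<and>
     (\<forall>c\<in>A. smooth_on (cmap c ` cdom c) (\<lambda>x. V (cinv c x) c))"

definition smooth_map ::
  "('p::topological_space, 'd::euclidean_space) chart set \<Rightarrow>
   ('m::topological_space, 'e::euclidean_space) chart set \<Rightarrow> ('p \<Rightarrow> 'm) \<Rightarrow> bool" where
  "smooth_map B A f \<longleftrightarrow> continuous_on UNIV f \<and>
     (\<forall>c\<in>B. \<forall>d\<in>A. smooth_on (cmap c ` (cdom c \<inter> f -` cdom d)) (cmap d \<circ> f \<circ> cinv c))"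

definition differential ::
  "('p, 'd::euclidean_space) chart set \<Rightarrow> ('m, 'e::euclidean_space) chart set \<Rightarrow> ('p \<Rightarrow> 'm) \<Rightarrow>
   'p \<Rightarrow> ('p, 'd) tvec \<Rightarrow> ('m, 'e) tvec" where
  "differential B A f p v = (let c = chart_at B p in
     (\<lambda>d. if d \<in> charts_at A (f p)
        then frechet_derivative (cmap d \<circ> f \<circ> cinv c) (at (cmap c p)) (v c) else 0))"

definition immersion ::
  "('p::topological_space, 'd::euclidean_space) chart set \<Rightarrow>
   ('m::topological_space, 'e::euclidean_space) chart set \<Rightarrow> ('p \<Rightarrow> 'm) \<Rightarrow> bool" where
  "immersion B A f \<longleftrightarrow> smooth_map B A f \<and>
     (\<forall>p. inj_on (differential B A f p) (tangent_space B p))"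


section \<open>Metrics, Levi-Civita connection and curvature\<close>

type_synonym ('m, 'e) metric = "'m \<Rightarrow> ('m, 'e) tvec \<Rightarrow> ('m, 'e) tvec \<Rightarrow> real"

definition metric_coord ::
  "('m, 'e::euclidean_space) chart set \<Rightarrow> ('m, 'e) metric \<Rightarrow> ('m, 'e) chart \<Rightarrow>
   'e \<Rightarrow> 'e \<Rightarrow> 'e \<Rightarrow> real" where
  "metric_coord A g c x u v =
     (let p = cinv c x in g p (tvec_of A c p u) (tvec_of A c p v))"

definition smooth_symmetric_2_tensor ::
  "('m, 'e::euclidean_space) chart set \<Rightarrow> ('m, 'e) metric \<Rightarrow> bool" where
  "smooth_symmetric_2_tensor A g \<longleftrightarrow>
     (\<forall>c\<in>A. \<forall>x\<in>cmap c ` cdom c. bilinear (metric_coord A g c x)) \<and>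
     (\<forall>p. \<forall>u\<in>tangent_space A p. \<forall>v\<in>tangent_space A p. g p u v = g p v u) \<and>
     (\<forall>c\<in>A. \<forall>u v. smooth_on (cmap c ` cdom c) (\<lambda>x. metric_coord A g c x u v))"

definition riemannian_metric ::
  "('m, 'e::euclidean_space) chart set \<Rightarrow> ('m, 'e) metric \<Rightarrow> bool" where
  "riemannian_metric A g \<longleftrightarrow> smooth_symmetric_2_tensor A g \<and>
     (\<forall>p. \<forall>v\<in>tangent_space A p. v \<noteq> (\<lambda>_. 0) \<longrightarrow> g p v v > 0)"

text \<open>Signature \<open>(-,+,\<dots>,+)\<close>: every tangent space has an orthonormal basis with exactly one
  timelike member.\<close>

definition lorentzian_metric ::
  "('m, 'e::euclidean_space) chart set \<Rightarrow> ('m, 'e) metric \<Rightarrow> bool" where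
  "lorentzian_metric A g \<longleftrightarrow> smooth_symmetric_2_tensor A g \<and>
     (\<forall>p. \<exists>e :: nat \<Rightarrow> ('m, 'e) tvec.
        (\<forall>i<DIM('e). e i \<in> tangent_space A p) \<and>
        (\<forall>i<DIM('e). \<forall>j<DIM('e).
           g p (e i) (e j) = (if i \<noteq> j then 0 else if i = 0 then -1 else 1)))"

text \<open>
  The Levi-Civita connection in a chart: \<open>\<Gamma> u v\<close> is the covariant derivative, in direction \<open>u\<close>, of
  the coordinate vector field with constant components \<open>v\<close>. Symmetry of \<open>\<Gamma>\<close> expresses that the
  connection is torsion-free (coordinate vector fields commute) and the last clause that it is
  compatible with the metric.
\<close>

definition christoffel ::
  "('m, 'e::euclidean_space) chart set \<Rightarrow> ('m, 'e) metric \<Rightarrow> ('m, 'e) chart \<Rightarrow>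
   'e \<Rightarrow> 'e \<Rightarrow> 'e \<Rightarrow> 'e" where
  "christoffel A g c x = (THE \<Gamma>. bilinear \<Gamma> \<and> (\<forall>u v. \<Gamma> u v = \<Gamma> v u) \<and>
     (\<forall>u v w. frechet_derivative (\<lambda>y. metric_coord A g c y v w) (at x) u =
        metric_coord A g c x (\<Gamma> u v) w + metric_coord A g c x v (\<Gamma> u w)))"

definition cov_deriv ::
  "('m, 'e::euclidean_space) chart set \<Rightarrow> ('m, 'e) metric \<Rightarrow> 'm \<Rightarrow> ('m, 'e) tvec \<Rightarrow>
   ('m \<Rightarrow> ('m, 'e) tvec) \<Rightarrow> ('m, 'e) tvec" where
  "cov_deriv A g p u V = (\<lambda>c. if c \<in> charts_at A p
     then frechet_derivative (\<lambda>x. V (cinv c x) c) (at (cmap c p)) (u c)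
        + christoffel A g c (cmap c p) (u c) (V p c)
     else 0)"

text \<open>The covariant derivative of a vector field \<open>W\<close> along a map \<open>f\<close> (induced by the connection
  of the target), in direction of a tangent vector \<open>u\<close> of the source at \<open>p\<close>.\<close>

definition cov_deriv_along ::
  "('p, 'd::euclidean_space) chart set \<Rightarrow> ('m, 'e::euclidean_space) chart set \<Rightarrow> ('m, 'e) metric \<Rightarrow>
   ('p \<Rightarrow> 'm) \<Rightarrow> 'p \<Rightarrow> ('p, 'd) tvec \<Rightarrow> ('p \<Rightarrow> ('m, 'e) tvec) \<Rightarrow> ('m, 'e) tvec" where
  "cov_deriv_along B A g f p u W = (let c = chart_at B p in
     (\<lambda>d. if d \<in> charts_at A (f p)
        then frechet_derivative (\<lambda>y. W (cinv c y) d) (at (cmap c p)) (u c)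
           + christoffel A g d (cmap d (f p)) (differential B A f p u d) (W p d)
        else 0))"

text \<open>\<open>R(X,Y)Z = \<nabla>\<^sub>X \<nabla>\<^sub>Y Z - \<nabla>\<^sub>Y \<nabla>\<^sub>X Z - \<nabla>\<^bsub>[X,Y]\<^esub> Z\<close>, evaluated on vector fields with constant
  components in the chart.\<close>

definition riemann ::
  "('m, 'e::euclidean_space) chart set \<Rightarrow> ('m, 'e) metric \<Rightarrow> 'm \<Rightarrow>
   ('m, 'e) tvec \<Rightarrow> ('m, 'e) tvec \<Rightarrow> ('m, 'e) tvec \<Rightarrow> ('m, 'e) tvec" where
  "riemann A g p X Y Z = (\<lambda>c. if c \<in> charts_at A p
     then let x = cmap c p; \<Gamma> = christoffel A g c in
       frechet_derivative (\<lambda>y. \<Gamma> y (Y c) (Z c)) (at x) (X c)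
       - frechet_derivative (\<lambda>y. \<Gamma> y (X c) (Z c)) (at x) (Y c)
       + \<Gamma> x (X c) (\<Gamma> x (Y c) (Z c)) - \<Gamma> x (Y c) (\<Gamma> x (X c) (Z c))
     else 0)"

definition ricci ::
  "('m, 'e::euclidean_space) chart set \<Rightarrow> ('m, 'e) metric \<Rightarrow> ('m, 'e) metric" where
  "ricci A g p Y Z = tangent_trace A p (\<lambda>X. riemann A g p X Y Z)"

definition lightlike_field ::
  "('m, 'e::euclidean_space) metric \<Rightarrow> ('m \<Rightarrow> ('m, 'e) tvec) \<Rightarrow> bool" where
  "lightlike_field g \<xi> \<longleftrightarrow> (\<forall>p. g p (\<xi> p) (\<xi> p) = 0 \<and> \<xi> p \<noteq> (\<lambda>_. 0))"

definition parallel_field ::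
  "('m, 'e::euclidean_space) chart set \<Rightarrow> ('m, 'e) metric \<Rightarrow> ('m \<Rightarrow> ('m, 'e) tvec) \<Rightarrow> bool" where
  "parallel_field A g \<xi> \<longleftrightarrow>
     (\<forall>p. \<forall>u\<in>tangent_space A p. cov_deriv A g p u \<xi> = (\<lambda>_. 0))"


section \<open>Spacelike hypersurfaces\<close>

definition induced_metric ::
  "('p, 'd::euclidean_space) chart set \<Rightarrow> ('m, 'e::euclidean_space) chart set \<Rightarrow> ('m, 'e) metric \<Rightarrow>
   ('p \<Rightarrow> 'm) \<Rightarrow> ('p, 'd) metric" where
  "induced_metric B A g f p u v = g (f p) (differential B A f p u) (differential B A f p v)"

definition spacelike_hypersurface ::
  "('p::{t2_space, second_countable_topology}, 'd::euclidean_space) chart set \<Rightarrow>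
   ('m::{t2_space, second_countable_topology}, 'e::euclidean_space) chart set \<Rightarrow>
   ('m, 'e) metric \<Rightarrow> ('p \<Rightarrow> 'm) \<Rightarrow> bool" where
  "spacelike_hypersurface B A g f \<longleftrightarrow> smooth_atlas B \<and> DIM('e) = DIM('d) + 1 \<and>
     immersion B A f \<and> riemannian_metric B (induced_metric B A g f)"

text \<open>The unique unit timelike normal vector \<open>N\<close> with \<open>\<langle>N, \<xi>\<rangle> > 0\<close>.\<close>

definition unit_normal ::
  "('p, 'd::euclidean_space) chart set \<Rightarrow> ('m, 'e::euclidean_space) chart set \<Rightarrow> ('m, 'e) metric \<Rightarrow>
   ('m \<Rightarrow> ('m, 'e) tvec) \<Rightarrow> ('p \<Rightarrow> 'm) \<Rightarrow> 'p \<Rightarrow> ('m, 'e) tvec" where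
  "unit_normal B A g \<xi> f p = (THE N. N \<in> tangent_space A (f p) \<and>
     (\<forall>v\<in>tangent_space B p. g (f p) N (differential B A f p v) = 0) \<and>
     g (f p) N N = -1 \<and> g (f p) N (\<xi> (f p)) > 0)"

text \<open>\<open>A X = - \<nabla>\<^sub>X N\<close>, pulled back to the tangent space of the hypersurface along the injective
  differential of the immersion.\<close>

definition shape_operator ::
  "('p, 'd::euclidean_space) chart set \<Rightarrow> ('m, 'e::euclidean_space) chart set \<Rightarrow> ('m, 'e) metric \<Rightarrow>
   ('m \<Rightarrow> ('m, 'e) tvec) \<Rightarrow> ('p \<Rightarrow> 'm) \<Rightarrow> 'p \<Rightarrow> ('p, 'd) tvec \<Rightarrow> ('p, 'd) tvec" where
  "shape_operator B A g \<xi> f p X = (THE Y. Y \<in> tangent_space B p \<and>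
     differential B A f p Y =
       (\<lambda>d. - cov_deriv_along B A g f p X (unit_normal B A g \<xi> f) d))"

definition mean_curvature ::
  "('p, 'd::euclidean_space) chart set \<Rightarrow> ('m, 'e::euclidean_space) chart set \<Rightarrow> ('m, 'e) metric \<Rightarrow>
   ('m \<Rightarrow> ('m, 'e) tvec) \<Rightarrow> ('p \<Rightarrow> 'm) \<Rightarrow> 'p \<Rightarrow> real" where
  "mean_curvature B A g \<xi> f p =
     - (1 / real DIM('d)) * tangent_trace B p (shape_operator B A g \<xi> f p)"

definition totally_geodesic ::
  "('p, 'd::euclidean_space) chart set \<Rightarrow> ('m, 'e::euclidean_space) chart set \<Rightarrow> ('m, 'e) metric \<Rightarrow>
   ('m \<Rightarrow> ('m, 'e) tvec) \<Rightarrow> ('p \<Rightarrow> 'm) \<Rightarrow> bool" where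
  "totally_geodesic B A g \<xi> f \<longleftrightarrow>
     (\<forall>p. \<forall>X\<in>tangent_space B p. shape_operator B A g \<xi> f p X = (\<lambda>_. 0))"

end

theory Submission imports Defs begin

text \<open>
  Let \<open>u = \<langle>N, \<xi>\<rangle> > 0\<close> on the hypersurface. As \<open>\<xi>\<close> is parallel, the Codazzi equation and the constancy of the
  mean curvature give \<open>\<Delta> u = u |A|\<^sup>2 + Ric(\<xi>\<^sup>T, N)\<close>, where \<open>\<xi>\<^sup>T = \<xi> + u N\<close> is the tangential part of \<open>\<xi>\<close>.
  Moreover \<open>Ric(\<xi>, N) = 0\<close>: by the Bianchi identity and \<open>R(\<cdot>,\<cdot>)\<xi> = 0\<close> it is the trace of the skew map
  \<open>X \<mapsto> R(X,\<xi>)N = R(N,\<xi>)X\<close>. Hence \<open>\<Delta> u = u (|A|\<^sup>2 + Ric(N, N)) \<ge> 0\<close>. By Hopf's strong maximum principle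
  \<open>u\<close> is constant on the components of the compact hypersurface, so \<open>\<Delta> u = 0\<close> and \<open>A = 0\<close>. The
  maximum principle replaces the integration of \<open>\<Delta> u\<close>, so that neither a volume form nor the
  divergence theorem is needed.
\<close>


section \<open>Calculus of smooth functions\<close>

text \<open>Two obstacles shape the proof. First, no moving orthonormal frame is available. At each
  point the Laplacian is computed with vectors \<open>e k\<close> of constant chart components that
  are orthonormal at that single point. The sum of the covariant derivatives of \<open>e k\<close>
  along \<open>e k\<close> then survives, and the first-order coefficient \<open>b\<close> of
  \<open>frame_laplacian\<close> cancels exactly its contribution. The maximum principle asks only
  for such a frame at each point, with bounds uniform on compact sets, so nothing has to depend
  smoothly on the point. Second, the Christoffel symbols, the unit normal and the shape operator are
  definite descriptions, whose smoothness is not visible. Each solves a linear system with smooth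
  injective coefficients, up to a scalar factor in the case of the normal, so
  \<open>smooth_on_solution\<close> settles all three. The two summands of the Laplacian of u come
  from splitting \<xi> into tangential and normal part: paired with the second derivative of N, the
  normal part gives u |A|^2 since <N,N> is constant, and the tangential part gives the Ricci term by
  Codazzi.\<close>

abbreviation fd :: "('a::real_normed_vector \<Rightarrow> 'b::real_normed_vector) \<Rightarrow> 'a \<Rightarrow> 'a \<Rightarrow> 'b" where
  "fd f x \<equiv> frechet_derivative f (at x)"

lemma fd_eq: "(f has_derivative f') (at x) \<Longrightarrow> fd f x = f'"
  by (metis frechet_derivative_at)

lemma fd_works: "f differentiable (at x) \<Longrightarrow> (f has_derivative fd f x) (at x)"
  by (simp add: frechet_derivative_works)

lemma linear_fd: "f differentiable (at x) \<Longrightarrow> linear (fd f x)"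
  by (rule linear_frechet_derivative)

lemma fd_cong:
  assumes "open S" "x \<in> S" "f differentiable (at x)" "\<And>y. y \<in> S \<Longrightarrow> f y = g y"
  shows "fd g x = fd f x"
  by (rule fd_eq, rule has_derivative_transform_within_open[OF fd_works[OF assms(3)] assms(1,2)])
     (simp add: assms(4))

lemma differentiable_cong:
  assumes "open S" "x \<in> S" "f differentiable (at x)" "\<And>y. y \<in> S \<Longrightarrow> f y = g y"
  shows "g differentiable (at x)"
  by (rule differentiableI, rule has_derivative_transform_within_open[OF fd_works[OF assms(3)] assms(1,2)])
     (simp add: assms(4))

lemma fd_compose:
  assumes "g differentiable (at (f x))" "f differentiable (at x)"
  shows "fd (\<lambda>y. g (f y)) x v = fd g (f x) (fd f x v)"
  by (subst fd_eq[OF has_derivative_compose[OF fd_works[OF assms(2)] fd_works[OF assms(1)]]]) simp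

lemma Ck_on_cong:
  assumes "open S" "\<And>y. y \<in> S \<Longrightarrow> f y = g y" "Ck_on k S f"
  shows "Ck_on k S g"
  using assms(2,3)
proof (induction k arbitrary: f g)
  case 0 then show ?case using continuous_on_cong[of S S f g] by auto
next
  case (Suc k)
  have "Ck_on k S (\<lambda>x. fd g x v)" for v
    by (rule Suc.IH[of "\<lambda>x. fd f x v"]) (use Suc.prems fd_cong[OF assms(1), of _ f g] in auto)
  then show ?case using Suc.prems differentiable_cong[OF assms(1), of _ f g] by auto
qed

lemma Ck_on_subset: "Ck_on k S f \<Longrightarrow> T \<subseteq> S \<Longrightarrow> Ck_on k T f"
  by (induction k arbitrary: f) (auto intro: continuous_on_subset)

lemma Ck_on_Suc_imp: "Ck_on (Suc k) S f \<Longrightarrow> Ck_on k S f"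
proof (induction k arbitrary: f)
  case 0 then show ?case
    by (auto intro!: differentiable_imp_continuous_on simp: differentiable_on_def differentiable_at_withinI)
next
  case (Suc k) then show ?case by (metis Ck_on.simps(2))
qed

lemma Ck_on_const: "Ck_on k S (\<lambda>x. c)"
  by (induction k arbitrary: c) auto

lemma Ck_on_ident: "Ck_on k S (\<lambda>x. x)"
  by (cases k) (auto intro: Ck_on_const)

lemma Ck_on_add:
  assumes "open S" "Ck_on k S f" "Ck_on k S g"
  shows "Ck_on k S (\<lambda>x. f x + g x)"
  using assms(2,3)
proof (induction k arbitrary: f g)
  case 0 then show ?case by (auto intro: continuous_intros)
next
  case (Suc k)
  have d: "((\<lambda>x. f x + g x) has_derivative (\<lambda>v. fd f x v + fd g x v)) (at x)" if "x \<in> S" for x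
    using Suc.prems that by (auto intro!: has_derivative_add fd_works)
  have "Ck_on k S (\<lambda>x. fd (\<lambda>x. f x + g x) x v)" for v
    by (rule Ck_on_cong[OF assms(1) _ Suc.IH[of "\<lambda>x. fd f x v" "\<lambda>x. fd g x v"]])
       (use Suc.prems fd_eq[OF d] in auto)
  then show ?case using d by (auto simp: differentiable_def)
qed

lemma Ck_on_sum:
  assumes "open S" "\<And>i. i \<in> I \<Longrightarrow> Ck_on k S (f i)"
  shows "Ck_on k S (\<lambda>x. \<Sum>i\<in>I. f i x)"
proof (cases "finite I")
  case True then show ?thesis using assms(2)
    by (induction I rule: finite_induct) (auto intro: Ck_on_const Ck_on_add[OF assms(1)])
qed (simp add: Ck_on_const)

lemma Ck_on_bilinear:
  assumes "bounded_bilinear h" "open S" "Ck_on k S f" "Ck_on k S g"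
  shows "Ck_on k S (\<lambda>x. h (f x) (g x))"
  using assms(3,4)
proof (induction k arbitrary: f g)
  case 0 then show ?case using assms(1) by (auto intro: bounded_bilinear.continuous_on)
next
  case (Suc k)
  have d: "((\<lambda>x. h (f x) (g x)) has_derivative (\<lambda>v. h (f x) (fd g x v) + h (fd f x v) (g x))) (at x)"
    if "x \<in> S" for x
    using Suc.prems that by (auto intro!: bounded_bilinear.FDERIV[OF assms(1)] fd_works)
  have "Ck_on k S (\<lambda>x. fd (\<lambda>x. h (f x) (g x)) x v)" for v
    by (rule Ck_on_cong[OF assms(2) _ Ck_on_add[OF assms(2) Suc.IH[of f "\<lambda>x. fd g x v"]
          Suc.IH[of "\<lambda>x. fd f x v" g]]])
       (use Suc.prems fd_eq[OF d] Ck_on_Suc_imp[OF Suc.prems(1)] Ck_on_Suc_imp[OF Suc.prems(2)] in auto)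
  then show ?case using d by (auto simp: differentiable_def)
qed

lemma Ck_on_bounded_linear:
  assumes "bounded_linear h" "open S" "Ck_on k S f"
  shows "Ck_on k S (\<lambda>x. h (f x))"
  using Ck_on_bilinear[OF bounded_bilinear.comp[OF bounded_bilinear_scaleR bounded_linear_ident assms(1)] assms(2)
      Ck_on_const[of k S 1] assms(3)] by simp

section \<open>Fields of linear maps, differentiated vector by vector\<close>

lemma linear_field_expand:
  fixes L :: "'b::euclidean_space \<Rightarrow> 'c::real_vector"
  assumes "linear L"
  shows "L w = (\<Sum>b\<in>Basis. (w \<bullet> b) *\<^sub>R L b)"
proof -
  have "L w = L (\<Sum>b\<in>Basis. (w \<bullet> b) *\<^sub>R b)" by (simp add: euclidean_representation)
  also have "\<dots> = (\<Sum>b\<in>Basis. (w \<bullet> b) *\<^sub>R L b)" using assms by (simp add: linear_sum linear_scale)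
  finally show ?thesis .
qed

text \<open>Operator fields are not treated as maps into a normed space of operators: their
  regularity is stated for each fixed vector. Expanding \<open>W x\<close> in the finite basis
  recovers regularity when operator and argument vary together.\<close>

lemma Ck_on_linear_field:
  fixes L :: "'a::real_normed_vector \<Rightarrow> 'b::euclidean_space \<Rightarrow> 'c::real_normed_vector"
  assumes "open S" "\<And>x. x \<in> S \<Longrightarrow> linear (L x)" "\<And>v. Ck_on k S (\<lambda>x. L x v)" "Ck_on k S W"
  shows "Ck_on k S (\<lambda>x. L x (W x))"
proof (rule Ck_on_cong[OF assms(1)])
  show "(\<Sum>b\<in>Basis. (W y \<bullet> b) *\<^sub>R L y b) = L y (W y)" if "y \<in> S" for y
    using linear_field_expand[OF assms(2)[OF that], of "W y"] by simp
  show "Ck_on k S (\<lambda>x. \<Sum>b\<in>Basis. (W x \<bullet> b) *\<^sub>R L x b)"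
    by (intro Ck_on_sum Ck_on_bilinear[OF bounded_bilinear_scaleR]
        Ck_on_bounded_linear[OF bounded_linear_inner_left] assms)
qed

lemma has_derivative_linear_field:
  fixes L :: "'a::real_normed_vector \<Rightarrow> 'b::euclidean_space \<Rightarrow> 'c::real_normed_vector"
  assumes "open S" "x \<in> S" "\<And>x. x \<in> S \<Longrightarrow> linear (L x)" "\<And>v. (\<lambda>x. L x v) differentiable (at x)"
    "W differentiable (at x)"
  shows "((\<lambda>y. L y (W y)) has_derivative (\<lambda>h. fd (\<lambda>y. L y (W x)) x h + L x (fd W x h))) (at x)"
proof -
  have gen: "((\<lambda>y. L y (W y)) has_derivative
     (\<lambda>h. (\<Sum>b\<in>Basis. (W x \<bullet> b) *\<^sub>R fd (\<lambda>y. L y b) x h + (fd W x h \<bullet> b) *\<^sub>R L x b))) (at x)"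
    if "W differentiable (at x)" for W
  proof (rule has_derivative_transform_within_open[OF _ assms(1,2)])
    show "(\<Sum>b\<in>Basis. (W y \<bullet> b) *\<^sub>R L y b) = L y (W y)" if "y \<in> S" for y
      using linear_field_expand[OF assms(3)[OF that], of "W y"] by simp
    show "((\<lambda>y. \<Sum>b\<in>Basis. (W y \<bullet> b) *\<^sub>R L y b) has_derivative
     (\<lambda>h. (\<Sum>b\<in>Basis. (W x \<bullet> b) *\<^sub>R fd (\<lambda>y. L y b) x h + (fd W x h \<bullet> b) *\<^sub>R L x b))) (at x)"
      by (intro has_derivative_sum has_derivative_scaleR has_derivative_inner_left fd_works assms(4) that)
  qed
  \<comment> \<open>The general formula for a constant field identifies the first half of the sum as
    the derivative with frozen argument.\<close>
  have 1: "fd (\<lambda>y. L y (W x)) x h = (\<Sum>b\<in>Basis. (W x \<bullet> b) *\<^sub>R fd (\<lambda>y. L y b) x h)" for h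
    using fd_eq[OF gen[of "\<lambda>y. W x"]] by simp
  have 2: "L x (fd W x h) = (\<Sum>b\<in>Basis. (fd W x h \<bullet> b) *\<^sub>R L x b)" for h
    by (rule linear_field_expand[OF assms(3)[OF assms(2)]])
  show ?thesis using gen[OF assms(5)] unfolding 1 2 by (simp add: sum.distrib)
qed

lemma linear_fd_field:
  fixes L :: "'a::real_normed_vector \<Rightarrow> 'b::real_normed_vector \<Rightarrow> 'c::real_normed_vector"
  assumes "open S" "x \<in> S" "\<And>x. x \<in> S \<Longrightarrow> linear (L x)" "\<And>v. (\<lambda>x. L x v) differentiable (at x)"
  shows "linear (\<lambda>w. fd (\<lambda>z. L z w) x v)"
proof (rule linearI)
  show "fd (\<lambda>z. L z (w + w')) x v = fd (\<lambda>z. L z w) x v + fd (\<lambda>z. L z w') x v" for w w'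
    using fd_eq[OF has_derivative_transform_within_open[OF
          has_derivative_add[OF fd_works[OF assms(4)[of w]] fd_works[OF assms(4)[of w']]] assms(1,2)]]
    by (simp add: linear_add[OF assms(3)])
  show "fd (\<lambda>z. L z (c *\<^sub>R w)) x v = c *\<^sub>R fd (\<lambda>z. L z w) x v" for c w
    using fd_eq[OF has_derivative_transform_within_open[OF
          has_derivative_scaleR_right[OF fd_works[OF assms(4)[of w]], of c] assms(1,2)]]
    by (simp add: linear_scale[OF assms(3)])
qed

text \<open>By the chain rule the derivative of the composite is a linear field applied to
  \<open>fd f y v\<close>. Its coefficients are composites of lower order, so the induction runs
  over all outer functions with \<open>f\<close> fixed.\<close>

lemma Ck_on_compose:
  fixes f :: "'a::real_normed_vector \<Rightarrow> 'b::euclidean_space" and g :: "'b \<Rightarrow> 'c::real_normed_vector"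
  assumes "open S" "open T" "f ` S \<subseteq> T" "Ck_on k S f" "Ck_on k T g"
  shows "Ck_on k S (\<lambda>x. g (f x))"
  using assms(4,5)
proof (induction k arbitrary: g)
  case 0 then show ?case using assms(3) by (auto intro: continuous_on_compose2)
next
  case (Suc k)
  have d: "f differentiable at x" "g differentiable at (f x)" if "x \<in> S" for x
    using Suc.prems that assms(3) by auto
  have d2: "(\<lambda>x. g (f x)) differentiable at x" if "x \<in> S" for x
    using differentiable_chain_at[OF d[OF that]] by (simp add: o_def)
  have "Ck_on k S (\<lambda>x. fd (\<lambda>x. g (f x)) x v)" for v
  proof (rule Ck_on_cong[OF assms(1)])
    show "fd g (f y) (fd f y v) = fd (\<lambda>x. g (f x)) y v" if "y \<in> S" for y
      using fd_compose[OF d(2,1)[OF that]] by simp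
    show "Ck_on k S (\<lambda>y. fd g (f y) (fd f y v))"
      by (rule Ck_on_linear_field[OF assms(1)])
         (use d in \<open>auto intro!: linear_fd Suc.IH simp: Ck_on_Suc_imp[OF Suc.prems(1)]\<close>,
          use Suc.prems in auto)
  qed
  then show ?case using d2 by auto
qed

lemma smooth_onI: "(\<And>k. Ck_on k S f) \<Longrightarrow> smooth_on S f" by (simp add: smooth_on_def)
lemma smooth_onD: "smooth_on S f \<Longrightarrow> Ck_on k S f" by (simp add: smooth_on_def)

lemma smooth_on_differentiable: "smooth_on S f \<Longrightarrow> x \<in> S \<Longrightarrow> f differentiable (at x)"
  using smooth_onD[of S f "Suc 0"] by simp

lemma smooth_on_continuous_on: "smooth_on S f \<Longrightarrow> continuous_on S f"
  using smooth_onD[of S f 0] by simp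

lemma smooth_on_fd: "smooth_on S f \<Longrightarrow> smooth_on S (\<lambda>x. fd f x v)"
  by (metis Ck_on.simps(2) smooth_on_def)

lemma smooth_on_subset: "smooth_on S f \<Longrightarrow> T \<subseteq> S \<Longrightarrow> smooth_on T f"
  by (auto simp: smooth_on_def intro: Ck_on_subset)

lemma smooth_on_cong: "open S \<Longrightarrow> (\<And>y. y \<in> S \<Longrightarrow> f y = g y) \<Longrightarrow> smooth_on S f \<Longrightarrow> smooth_on S g"
  by (auto simp: smooth_on_def intro: Ck_on_cong)

lemma smooth_on_const: "smooth_on S (\<lambda>x. c)"
  by (simp add: smooth_on_def Ck_on_const)

lemma smooth_on_ident: "smooth_on S (\<lambda>x. x)"
  by (simp add: smooth_on_def Ck_on_ident)

lemma smooth_on_add: "open S \<Longrightarrow> smooth_on S f \<Longrightarrow> smooth_on S g \<Longrightarrow> smooth_on S (\<lambda>x. f x + g x)"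
  by (simp add: smooth_on_def Ck_on_add)

lemma smooth_on_bounded_linear:
  "bounded_linear h \<Longrightarrow> open S \<Longrightarrow> smooth_on S f \<Longrightarrow> smooth_on S (\<lambda>x. h (f x))"
  by (simp add: smooth_on_def Ck_on_bounded_linear)

lemma smooth_on_minus: "open S \<Longrightarrow> smooth_on S f \<Longrightarrow> smooth_on S (\<lambda>x. - f x)"
  by (rule smooth_on_bounded_linear[OF bounded_linear_minus[OF bounded_linear_ident]])

lemma smooth_on_diff: "open S \<Longrightarrow> smooth_on S f \<Longrightarrow> smooth_on S g \<Longrightarrow> smooth_on S (\<lambda>x. f x - g x)"
  using smooth_on_add[of S f "\<lambda>x. - g x"] smooth_on_minus[of S g] by simp

lemma smooth_on_sum:
  "open S \<Longrightarrow> (\<And>i. i \<in> I \<Longrightarrow> smooth_on S (f i)) \<Longrightarrow> smooth_on S (\<lambda>x. \<Sum>i\<in>I. f i x)"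
  by (simp add: smooth_on_def Ck_on_sum)

lemma smooth_on_scaleR:
  "open S \<Longrightarrow> smooth_on S f \<Longrightarrow> smooth_on S g \<Longrightarrow> smooth_on S (\<lambda>x. f x *\<^sub>R g x)"
  by (simp add: smooth_on_def Ck_on_bilinear[OF bounded_bilinear_scaleR])

lemma smooth_on_mult:
  fixes f g :: "'a::real_normed_vector \<Rightarrow> real"
  shows "open S \<Longrightarrow> smooth_on S f \<Longrightarrow> smooth_on S g \<Longrightarrow> smooth_on S (\<lambda>x. f x * g x)"
  by (simp add: smooth_on_def Ck_on_bilinear[OF bounded_bilinear_mult])

lemma smooth_on_compose:
  fixes f :: "'a::real_normed_vector \<Rightarrow> 'b::euclidean_space" and g :: "'b \<Rightarrow> 'c::real_normed_vector"
  shows "open S \<Longrightarrow> open T \<Longrightarrow> f ` S \<subseteq> T \<Longrightarrow> smooth_on S f \<Longrightarrow> smooth_on T g \<Longrightarrow> smooth_on S (\<lambda>x. g (f x))"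
  unfolding smooth_on_def using Ck_on_compose by blast

lemma smooth_on_linear_field:
  fixes L :: "'a::real_normed_vector \<Rightarrow> 'b::euclidean_space \<Rightarrow> 'c::real_normed_vector"
  shows "open S \<Longrightarrow> (\<And>x. x \<in> S \<Longrightarrow> linear (L x)) \<Longrightarrow> (\<And>v. smooth_on S (\<lambda>x. L x v)) \<Longrightarrow> smooth_on S W
    \<Longrightarrow> smooth_on S (\<lambda>x. L x (W x))"
  unfolding smooth_on_def using Ck_on_linear_field by blast

lemma fd_linear_field:
  fixes L :: "'a::real_normed_vector \<Rightarrow> 'b::euclidean_space \<Rightarrow> 'c::real_normed_vector"
  assumes "open S" "x \<in> S" "\<And>x. x \<in> S \<Longrightarrow> linear (L x)" "\<And>v. smooth_on S (\<lambda>x. L x v)" "smooth_on S W"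
  shows "fd (\<lambda>y. L y (W y)) x h = fd (\<lambda>y. L y (W x)) x h + L x (fd W x h)"
  by (subst fd_eq[OF has_derivative_linear_field[of S]]) (use assms smooth_on_differentiable[OF _ assms(2)] in auto)

subsection \<open>Solutions of linear systems\<close>

text \<open>A left inverse \<open>Q\<close> of \<open>L x\<close> is kept fixed while the point
  moves: \<open>Q\<close> composed with \<open>L y\<close> stays close to the identity, and
  \<open>m y\<close> measures the deviation. Once \<open>m y\<close> is below one half the deviation
  can be absorbed into the left side of an estimate.\<close>

lemma solution_estimate:
  fixes L :: "'a::real_normed_vector \<Rightarrow> 'b::euclidean_space \<Rightarrow> 'c::euclidean_space"
  assumes S: "open S" "x \<in> S" and lin: "\<And>y. y \<in> S \<Longrightarrow> linear (L y)" and inj: "inj (L x)"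
    and cL: "\<And>v. isCont (\<lambda>y. L y v) x"
  obtains Q m where "linear Q" "\<And>v. Q (L x v) = v" "(m \<longlongrightarrow> (0::real)) (at x)"
    "\<And>y. m y \<ge> 0" "\<And>y v. y \<in> S \<Longrightarrow> norm (Q (L y v) - v) \<le> m y * norm v"
    "\<forall>\<^sub>F y in at x. y \<in> S \<and> m y < 1/2"
proof -
  obtain Q where Q: "linear Q" "Q \<circ> L x = id"
    using linear_injective_left_inverse[OF lin[OF S(2)] inj] by blast
  have bQ: "bounded_linear Q" using Q(1) by (simp add: linear_conv_bounded_linear)
  have QL: "Q (L x v) = v" for v using Q(2) by (metis comp_apply id_apply)
  \<comment> \<open>The sum of the deviations on basis vectors dominates the operator norm of the
    deviation and is visibly continuous in \<open>y\<close>.\<close>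
  define m where "m y = (\<Sum>b\<in>Basis. norm (Q (L y b) - b))" for y
  have m_bound: "norm (Q (L y v) - v) \<le> m y * norm v" if "y \<in> S" for y v
  proof -
    have lQ: "linear (\<lambda>v. Q (L y v) - v)"
      using linear_compose[OF lin[OF that] Q(1)] by (auto simp: linear_iff o_def algebra_simps)
    have "norm (Q (L y v) - v) = norm (\<Sum>b\<in>Basis. (v \<bullet> b) *\<^sub>R (Q (L y b) - b))"
      using linear_field_expand[OF lQ, of v] by simp
    also have "\<dots> \<le> (\<Sum>b\<in>Basis. norm v * norm (Q (L y b) - b))"
      by (rule order_trans[OF norm_sum], rule sum_mono)
         (auto intro!: mult_right_mono simp: Basis_le_norm)
    also have "\<dots> = m y * norm v" by (simp add: m_def sum_distrib_left mult.commute)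
    finally show ?thesis .
  qed
  have m_lim: "(m \<longlongrightarrow> 0) (at x)"
  proof -
    have "isCont m x" unfolding m_def
      by (intro continuous_intros bounded_linear.isCont[OF bQ] cL)
    then show ?thesis by (simp add: isCont_def m_def QL)
  qed
  have ev: "\<forall>\<^sub>F y in at x. y \<in> S \<and> m y < 1/2"
    using order_tendstoD(2)[OF m_lim, of "1/2"] eventually_at_in_open'[OF S] by (auto elim: eventually_elim2)
  show ?thesis
    by (rule that[OF Q(1) QL m_lim _ m_bound ev]) (auto simp: m_def sum_nonneg)
qed

text \<open>Applying \<open>Q\<close> to \<open>L y (s y - s x) = r y - L y (s x)\<close> gives
  \<rho>, which no longer contains \<open>s y\<close>. The increment of \<open>s\<close> differs
  from \<rho> by at most half of itself, hence the factor 2.\<close>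

lemma solution_difference:
  fixes L :: "'a::real_normed_vector \<Rightarrow> 'b::euclidean_space \<Rightarrow> 'c::euclidean_space"
  assumes "linear Q" "linear (L y)" "L y (s y) = r y" "L x (s x) = r x"
    "norm (Q (L y (s y - s x)) - (s y - s x)) \<le> m * norm (s y - s x)" "m < 1/2"
  defines "\<rho> \<equiv> Q (r y - r x) - Q (L y (s x) - L x (s x))"
  shows "s y - s x = \<rho> - (Q (L y (s y - s x)) - (s y - s x))"
    and "norm (s y - s x) \<le> 2 * norm \<rho>"
proof -
  have "Q (L y (s y - s x)) = Q (r y) - Q (L y (s x))"
    using assms(3) by (simp add: linear_diff[OF assms(2)] linear_diff[OF assms(1)])
  moreover have "Q (r x) = Q (L x (s x))" using assms(4) by simp
  ultimately show main: "s y - s x = \<rho> - (Q (L y (s y - s x)) - (s y - s x))"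
    unfolding \<rho>_def by (simp add: linear_diff[OF assms(1)])
  have "norm (s y - s x) \<le> norm \<rho> + m * norm (s y - s x)"
    using norm_triangle_ineq4[of "\<rho>" "Q (L y (s y - s x)) - (s y - s x)"] main assms(5) by simp
  moreover have "m * norm (s y - s x) \<le> 1/2 * norm (s y - s x)"
    using assms(6) by (intro mult_right_mono) auto
  ultimately show "norm (s y - s x) \<le> 2 * norm \<rho>" by simp
qed

lemma isCont_solution:
  fixes L :: "'a::real_normed_vector \<Rightarrow> 'b::euclidean_space \<Rightarrow> 'c::euclidean_space"
  assumes S: "open S" "x \<in> S" and lin: "\<And>y. y \<in> S \<Longrightarrow> linear (L y)" and inj: "inj (L x)"
    and cL: "\<And>v. isCont (\<lambda>y. L y v) x" and cr: "isCont r x"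
    and sol: "\<And>y. y \<in> S \<Longrightarrow> L y (s y) = r y"
  shows "isCont s x"
proof -
  obtain Q m where Q: "linear Q" "\<And>v. Q (L x v) = v" "(m \<longlongrightarrow> (0::real)) (at x)"
    "\<And>y. m y \<ge> 0" "\<And>y v. y \<in> S \<Longrightarrow> norm (Q (L y v) - v) \<le> m y * norm v"
    "\<forall>\<^sub>F y in at x. y \<in> S \<and> m y < 1/2"
    using solution_estimate[OF S lin inj cL] by blast
  have bQ: "bounded_linear Q" using Q(1) by (simp add: linear_conv_bounded_linear)
  define \<rho> where "\<rho> y = Q (r y - r x) - Q (L y (s x) - L x (s x))" for y
  have "isCont \<rho> x" unfolding \<rho>_def
    by (intro continuous_intros bounded_linear.isCont[OF bQ] cL cr)
  then have lim: "(\<rho> \<longlongrightarrow> 0) (at x)" by (simp add: isCont_def \<rho>_def linear_0[OF Q(1)])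
  have "((\<lambda>y. s y - s x) \<longlongrightarrow> 0) (at x)"
  proof (rule tendsto_0_le[OF lim, where K=2])
    show "\<forall>\<^sub>F y in at x. norm (s y - s x) \<le> norm (\<rho> y) * 2"
      using Q(6)
    proof eventually_elim
      case (elim y)
      then show ?case
        using solution_difference(2)[where L=L and s=s and r=r, OF Q(1) lin sol sol[OF S(2)] Q(5), of y] by (simp add: \<rho>_def)
    qed
  qed
  then show ?thesis unfolding isCont_def by (simp add: LIM_zero_iff)
qed

text \<open>The candidate derivative is that of \<rho>, the outcome of formally differentiating the
  system at \<open>x\<close>. The increment of \<open>s\<close> is at most linear in the distance,
  and \<open>m y\<close> tends to 0, so the difference between the increment and \<rho> is of
  smaller order.\<close>

lemma differentiable_solution:
  fixes L :: "'a::real_normed_vector \<Rightarrow> 'b::euclidean_space \<Rightarrow> 'c::euclidean_space"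
  assumes S: "open S" "x \<in> S" and lin: "\<And>y. y \<in> S \<Longrightarrow> linear (L y)" and inj: "inj (L x)"
    and dL: "\<And>v. (\<lambda>y. L y v) differentiable (at x)" and dr: "r differentiable (at x)"
    and sol: "\<And>y. y \<in> S \<Longrightarrow> L y (s y) = r y"
  shows "s differentiable (at x)"
proof -
  have cL: "isCont (\<lambda>y. L y v) x" for v using dL differentiable_imp_continuous_within by blast
  obtain Q m where Q: "linear Q" "\<And>v. Q (L x v) = v" "(m \<longlongrightarrow> (0::real)) (at x)"
    "\<And>y. m y \<ge> 0" "\<And>y v. y \<in> S \<Longrightarrow> norm (Q (L y v) - v) \<le> m y * norm v"
    "\<forall>\<^sub>F y in at x. y \<in> S \<and> m y < 1/2"
    using solution_estimate[OF S lin inj cL] by blast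
  have bQ: "bounded_linear Q" using Q(1) by (simp add: linear_conv_bounded_linear)
  define \<rho> where "\<rho> y = Q (r y - r x) - Q (L y (s x) - L x (s x))" for y
  define \<rho>' where "\<rho>' h = Q (fd r x h) - Q (fd (\<lambda>y. L y (s x)) x h)" for h
  have d\<rho>: "(\<rho> has_derivative \<rho>') (at x)"
    unfolding \<rho>_def \<rho>'_def
    by (rule derivative_eq_intros bounded_linear.has_derivative[OF bQ] fd_works dr dL refl | simp)+
  have \<rho>x: "\<rho> x = 0" by (simp add: \<rho>_def linear_0[OF Q(1)])
  have b\<rho>': "bounded_linear \<rho>'" using d\<rho> has_derivative_bounded_linear by blast
  obtain K where K: "\<And>h. norm (\<rho>' h) \<le> K * norm h"
    using bounded_linear.bounded[OF b\<rho>'] by (metis mult.commute)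
  have lim\<rho>: "((\<lambda>y. norm (\<rho> y - \<rho>' (y - x)) / norm (y - x)) \<longlongrightarrow> 0) (at x)"
    using d\<rho> \<rho>x unfolding has_derivative_iff_norm by simp
  have "((\<lambda>y. norm (s y - s x - \<rho>' (y - x)) / norm (y - x)) \<longlongrightarrow> 0) (at x)"
  proof (rule tendsto_0_le[where K=1])
    \<comment> \<open>The majorant adds the differentiability error of \<rho> to \<open>m y\<close>
      times a bound for the difference quotient of \<open>s\<close>, with \<open>K\<close> bounding
      the derivative of \<rho>.\<close>
    show "((\<lambda>y. norm (\<rho> y - \<rho>' (y - x)) / norm (y - x) +
       m y * (2 * (norm (\<rho> y - \<rho>' (y - x)) / norm (y - x) + K))) \<longlongrightarrow> 0) (at x)"
      by (rule tendsto_eq_intros lim\<rho> Q(3) refl)+ simp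
    show "\<forall>\<^sub>F y in at x. norm (norm (s y - s x - \<rho>' (y - x)) / norm (y - x)) \<le>
       norm (norm (\<rho> y - \<rho>' (y - x)) / norm (y - x) +
       m y * (2 * (norm (\<rho> y - \<rho>' (y - x)) / norm (y - x) + K))) * 1"
      using Q(6) eventually_neq_at_within[of x x UNIV]
    proof eventually_elim
      case (elim y)
      let ?d = "norm (y - x)"
      let ?e = "norm (\<rho> y - \<rho>' (y - x))"
      let ?t = "Q (L y (s y - s x)) - (s y - s x)"
      have d: "?d > 0" using elim by simp
      have yS: "y \<in> S" "m y < 1/2" using elim by auto
      note sd = solution_difference[where L=L and s=s and r=r, OF Q(1) lin[OF yS(1)] sol[OF yS(1)] sol[OF S(2)] Q(5)[OF yS(1)] yS(2),
          folded \<rho>_def]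
      have "norm (\<rho> y) \<le> ?e + K * ?d"
        using norm_triangle_sub[of "\<rho> y" "\<rho>' (y - x)"] K[of "y - x"] by linarith
      then have "norm (s y - s x) \<le> 2 * (?e + K * ?d)" by (intro order_trans[OF sd(2)] mult_left_mono) simp_all
      then have 1: "norm ?t \<le> m y * (2 * (?e + K * ?d))"
        using Q(5)[OF yS(1), of "s y - s x"] Q(4)[of y] by (meson mult_left_mono order_trans)
      have "s y - s x - \<rho>' (y - x) = (\<rho> y - \<rho>' (y - x)) - ?t"
        using sd(1) by (simp add: diff_right_commute)
      then have "norm (s y - s x - \<rho>' (y - x)) \<le> ?e + norm ?t"
        by (simp only: norm_triangle_ineq4)
      then have "norm (s y - s x - \<rho>' (y - x)) \<le> ?e + m y * (2 * (?e + K * ?d))" using 1 by linarith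
      then have "norm (s y - s x - \<rho>' (y - x)) / ?d \<le> (?e + m y * (2 * (?e + K * ?d))) / ?d"
        using d by (simp add: divide_right_mono)
      also have "\<dots> = ?e / ?d + m y * (2 * (?e / ?d + K))" using d by (simp add: field_simps)
      finally show ?case by simp
    qed
  qed
  then have "(s has_derivative \<rho>') (at x)" unfolding has_derivative_iff_norm using b\<rho>' by simp
  then show ?thesis by (rule differentiableI)
qed

text \<open>Bootstrapping: a derivative of \<open>s\<close> solves the system with the same
  coefficients and a new right side, built from a derivative of \<open>r\<close> and from
  \<open>s\<close> itself. That right side has one order less than \<open>r\<close>, so the
  induction must leave both \<open>r\<close> and \<open>s\<close> arbitrary.\<close>

lemma Ck_on_solution:
  fixes L :: "'a::real_normed_vector \<Rightarrow> 'b::euclidean_space \<Rightarrow> 'c::euclidean_space"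
  assumes S: "open S" and lin: "\<And>y. y \<in> S \<Longrightarrow> linear (L y)" and inj: "\<And>y. y \<in> S \<Longrightarrow> inj (L y)"
    and sL: "\<And>v. smooth_on S (\<lambda>y. L y v)" and sr: "Ck_on k S r"
    and sol: "\<And>y. y \<in> S \<Longrightarrow> L y (s y) = r y"
  shows "Ck_on k S s"
  using sr sol
proof (induction k arbitrary: r s)
  case 0
  have "isCont s y" if "y \<in> S" for y
  proof (rule isCont_solution[where L=L and s=s and r=r, OF S that lin inj[OF that] _ _ 0(2)])
    show "isCont (\<lambda>y. L y v) y" for v
      using smooth_on_continuous_on[OF sL[of v]] S that by (simp add: continuous_on_eq_continuous_at)
    show "isCont r y" using 0(1) S that by (simp add: continuous_on_eq_continuous_at)
  qed
  then show ?case by (simp add: continuous_at_imp_continuous_on)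
next
  case (Suc k)
  have d: "s differentiable (at y)" if "y \<in> S" for y
    by (rule differentiable_solution[where L=L and s=s and r=r, OF S that lin inj[OF that] smooth_on_differentiable[OF sL that]
         _ Suc.prems(2)]) (use Suc.prems(1) that in auto)
  have sk: "Ck_on k S s" by (rule Suc.IH[OF Ck_on_Suc_imp[OF Suc.prems(1)] Suc.prems(2)])
  have "Ck_on k S (\<lambda>x. fd s x v)" for v
  proof (rule Suc.IH)
    note dlin = linear_fd_field[OF S _ lin smooth_on_differentiable[OF sL]]
    have "Ck_on k S (\<lambda>y. fd (\<lambda>z. L z (s y)) y v)"
      by (rule Ck_on_linear_field[OF S dlin _ sk]) (auto intro!: smooth_onD smooth_on_fd sL)
    then show "Ck_on k S (\<lambda>y. fd r y v + (- fd (\<lambda>z. L z (s y)) y v))"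
      using Suc.prems(1)
      by (intro Ck_on_add Ck_on_bounded_linear[OF bounded_linear_minus[OF bounded_linear_ident]] S) auto
    show "L y (fd s y v) = fd r y v + (- fd (\<lambda>z. L z (s y)) y v)" if y: "y \<in> S" for y
    proof -
      have "((\<lambda>y. L y (s y)) has_derivative (\<lambda>h. fd (\<lambda>z. L z (s y)) y h + L y (fd s y h))) (at y)"
        by (rule has_derivative_linear_field[OF S y lin]) (auto intro: smooth_on_differentiable[OF sL y] d[OF y])
      then have "(r has_derivative (\<lambda>h. fd (\<lambda>z. L z (s y)) y h + L y (fd s y h))) (at y)"
        by (rule has_derivative_transform_within_open[OF _ S y]) (rule Suc.prems(2))
      then show ?thesis using fd_eq by fastforce
    qed
  qed
  then show ?case using d by auto
qed

lemma smooth_on_solution: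
  fixes L :: "'a::real_normed_vector \<Rightarrow> 'b::euclidean_space \<Rightarrow> 'c::euclidean_space"
  assumes "open S" "\<And>y. y \<in> S \<Longrightarrow> linear (L y)" "\<And>y. y \<in> S \<Longrightarrow> inj (L y)"
    "\<And>v. smooth_on S (\<lambda>y. L y v)" "smooth_on S r" "\<And>y. y \<in> S \<Longrightarrow> L y (s y) = r y"
  shows "smooth_on S s"
  by (rule smooth_onI, rule Ck_on_solution[of S L _ r]) (use assms smooth_onD in auto)

lemma smooth_on_inverse_real:
  fixes f :: "'a::real_normed_vector \<Rightarrow> real"
  assumes "open S" "smooth_on S f" "\<And>x. x \<in> S \<Longrightarrow> f x \<noteq> 0"
  shows "smooth_on S (\<lambda>x. inverse (f x))"
  by (rule smooth_on_solution[of S "\<lambda>x z. f x * z" "\<lambda>_. 1::real"])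
     (use assms in \<open>auto intro!: smooth_on_mult smooth_on_const linearI injI simp: algebra_simps\<close>)

text \<open>The induction closes because the derivative of the root is written as a smooth function
  times the root itself, with \<open>f x\<close> and not its root in the denominator.\<close>

lemma Ck_on_sqrt:
  fixes f :: "'a::real_normed_vector \<Rightarrow> real"
  assumes "open S" "smooth_on S f" "\<And>x. x \<in> S \<Longrightarrow> f x > 0"
  shows "Ck_on k S (\<lambda>x. sqrt (f x))"
proof (induction k)
  case 0 show ?case using smooth_on_continuous_on[OF assms(2)] by (auto intro: continuous_intros)
next
  case (Suc k)
  have d: "((\<lambda>x. sqrt (f x)) has_derivative (\<lambda>v. (fd f x v * inverse (2 * f x)) * sqrt (f x))) (at x)"
    if x: "x \<in> S" for x
  proof -
    have "inverse (sqrt (f x)) / 2 = inverse (2 * f x) * sqrt (f x)"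
    proof -
      obtain r where r: "r > 0" "f x = r\<^sup>2" using assms(3)[OF x] by (metis real_sqrt_gt_zero real_sqrt_pow2 less_imp_le)
      then show ?thesis by (simp add: power2_eq_square)
    qed
    then show ?thesis
      using has_derivative_real_sqrt[OF assms(3)[OF x] fd_works[OF smooth_on_differentiable[OF assms(2) x]]]
      by (simp add: mult.assoc)
  qed
  have "Ck_on k S (\<lambda>x. fd (\<lambda>x. sqrt (f x)) x v)" for v
  proof (rule Ck_on_cong[OF assms(1)])
    show "(fd f x v * inverse (2 * f x)) * sqrt (f x) = fd (\<lambda>x. sqrt (f x)) x v" if "x \<in> S" for x
      using fd_eq[OF d[OF that]] by simp
    have "smooth_on S (\<lambda>x. fd f x v * inverse (2 * f x))"
      by (intro smooth_on_mult smooth_on_inverse_real smooth_on_fd smooth_on_const assms(1,2))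
         (use assms(3) in \<open>metis mult_pos_pos zero_less_numeral less_irrefl\<close>)
    then show "Ck_on k S (\<lambda>x. (fd f x v * inverse (2 * f x)) * sqrt (f x))"
      using Ck_on_bilinear[OF bounded_bilinear_mult assms(1) smooth_onD Suc.IH] by blast
  qed
  then show ?case using d by (auto simp: differentiable_def)
qed

lemma smooth_on_sqrt:
  fixes f :: "'a::real_normed_vector \<Rightarrow> real"
  shows "open S \<Longrightarrow> smooth_on S f \<Longrightarrow> (\<And>x. x \<in> S \<Longrightarrow> f x > 0) \<Longrightarrow> smooth_on S (\<lambda>x. sqrt (f x))"
  by (rule smooth_onI, rule Ck_on_sqrt)


subsection \<open>Second derivatives\<close>

lemma has_derivative_line:
  "((\<lambda>s. x + s *\<^sub>R v) has_derivative (\<lambda>h. h *\<^sub>R v)) (at (t::real))"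
  by (auto intro!: derivative_eq_intros)

lemma DERIV_along_line:
  fixes f :: "'a::real_normed_vector \<Rightarrow> real"
  assumes "f differentiable (at (x + t *\<^sub>R v))"
  shows "DERIV (\<lambda>t. f (x + t *\<^sub>R v)) t :> fd f (x + t *\<^sub>R v) v"
proof -
  have "((\<lambda>s. f (x + s *\<^sub>R v)) has_derivative (\<lambda>h. fd f (x + t *\<^sub>R v) (h *\<^sub>R v))) (at t)"
    by (rule has_derivative_compose[OF has_derivative_line fd_works[OF assms]])
  then show ?thesis
    by (simp add: has_field_derivative_def linear_scale[OF linear_fd[OF assms]] mult_commute_abs)
qed

text \<open>The mean value theorem is used twice, first along \<open>u\<close> on the difference
  \<phi> of two parallel segments, then along \<open>v\<close> on the derivative in direction
  \<open>u\<close>. The left side is symmetric in \<open>u\<close> and \<open>v\<close>, the right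
  side is not; this yields the symmetry of second derivatives.\<close>

lemma second_difference_mvt:
  fixes f :: "'a::real_normed_vector \<Rightarrow> real"
  assumes S: "\<And>s t. 0 \<le> s \<Longrightarrow> s \<le> h \<Longrightarrow> 0 \<le> t \<Longrightarrow> t \<le> h \<Longrightarrow> x + s *\<^sub>R u + t *\<^sub>R v \<in> S"
    and f: "\<And>y. y \<in> S \<Longrightarrow> f differentiable (at y)"
    and f2: "\<And>y. y \<in> S \<Longrightarrow> (\<lambda>y. fd f y u) differentiable (at y)" and h: "h > 0"
  obtains s t where "0 \<le> s" "s \<le> h" "0 \<le> t" "t \<le> h"
    "f (x + h *\<^sub>R u + h *\<^sub>R v) - f (x + h *\<^sub>R u) - f (x + h *\<^sub>R v) + f x
       = h * (h * fd (\<lambda>y. fd f y u) (x + s *\<^sub>R u + t *\<^sub>R v) v)"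
proof -
  define \<phi> where "\<phi> s = f ((x + h *\<^sub>R v) + s *\<^sub>R u) - f (x + s *\<^sub>R u)" for s
  have in1: "x + h *\<^sub>R v + s *\<^sub>R u \<in> S" if "0 \<le> s" "s \<le> h" for s
    using S[of s h] that h by (simp add: algebra_simps)
  have in2: "x + s *\<^sub>R u \<in> S" if "0 \<le> s" "s \<le> h" for s
    using S[of s 0] that h by simp
  have "\<exists>s. 0 < s \<and> s < h \<and> \<phi> h - \<phi> 0 =
      (h - 0) * (fd f (x + h *\<^sub>R v + s *\<^sub>R u) u - fd f (x + s *\<^sub>R u) u)"
    unfolding \<phi>_def by (rule MVT2[OF h]) (intro DERIV_diff DERIV_along_line f in1 in2; simp)
  then obtain s where s: "0 < s" "s < h"
    "\<phi> h - \<phi> 0 = h * (fd f (x + h *\<^sub>R v + s *\<^sub>R u) u - fd f (x + s *\<^sub>R u) u)" by auto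
  have "\<exists>t. 0 < t \<and> t < h \<and> fd f ((x + s *\<^sub>R u) + h *\<^sub>R v) u - fd f ((x + s *\<^sub>R u) + 0 *\<^sub>R v) u =
      (h - 0) * fd (\<lambda>y. fd f y u) (x + s *\<^sub>R u + t *\<^sub>R v) v"
    by (rule MVT2[OF h]) (intro DERIV_along_line f2 S; use s in simp)
  then obtain t where t: "0 < t" "t < h" "fd f (x + s *\<^sub>R u + h *\<^sub>R v) u - fd f (x + s *\<^sub>R u) u =
      h * fd (\<lambda>y. fd f y u) (x + s *\<^sub>R u + t *\<^sub>R v) v" by auto
  show ?thesis
  proof (rule that[of s t])
    have c: "x + h *\<^sub>R v + s *\<^sub>R u = x + s *\<^sub>R u + h *\<^sub>R v"
      "x + h *\<^sub>R v + h *\<^sub>R u = x + h *\<^sub>R u + h *\<^sub>R v" by (simp_all add: algebra_simps)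
    show "f (x + h *\<^sub>R u + h *\<^sub>R v) - f (x + h *\<^sub>R u) - f (x + h *\<^sub>R v) + f x
       = h * (h * fd (\<lambda>y. fd f y u) (x + s *\<^sub>R u + t *\<^sub>R v) v)"
      using s(3) unfolding \<phi>_def c t(3)[symmetric] by simp
  qed (use s t in auto)
qed

text \<open>If the two mixed derivatives differed, a number \<open>c\<close> would separate them in
  a whole neighbourhood, while values of both at suitable points equal the same second difference
  quotient. One inequality suffices, as \<open>u\<close> and \<open>v\<close> may be
  exchanged.\<close>

lemma fd_commute_real_le:
  fixes f :: "'a::real_normed_vector \<Rightarrow> real"
  assumes S: "open S" "x \<in> S" and f: "smooth_on S f"
  shows "fd (\<lambda>y. fd f y u) x v \<le> fd (\<lambda>y. fd f y v) x u"
proof (rule ccontr)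
  define P where "P y = fd (\<lambda>y. fd f y u) y v" for y
  define Q where "Q y = fd (\<lambda>y. fd f y v) y u" for y
  assume "\<not> ?thesis"
  then have lt: "Q x < P x" by (simp add: P_def Q_def)
  define c where "c = (P x + Q x) / 2"
  have cont: "isCont P x" "isCont Q x"
    using smooth_on_continuous_on[OF smooth_on_fd[OF smooth_on_fd[OF f]]] S
    unfolding P_def Q_def by (simp_all add: continuous_on_eq_continuous_at)
  have "\<forall>\<^sub>F y in nhds x. y \<in> S \<and> c < P y \<and> Q y < c"
    using order_tendstoD(1)[of P "P x" "nhds x" c] order_tendstoD(2)[of Q "Q x" "nhds x" c] lt cont
      eventually_nhds_in_open[OF S]
    by (auto simp: c_def continuous_at field_simps tendsto_at_iff_tendsto_nhds eventually_conj_iff)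
  then obtain e where e: "e > 0" "\<And>y. dist y x < e \<Longrightarrow> y \<in> S \<and> c < P y \<and> Q y < c"
    unfolding eventually_nhds_metric by blast
  \<comment> \<open>The side length keeps the whole parallelogram within distance
    \<open>e / 2\<close> of \<open>x\<close>; the added 1 prevents division by zero.\<close>
  define h where "h = e / (2 * (norm u + norm v + 1))"
  have h: "h > 0" using e(1) by (simp add: h_def add_nonneg_pos)
  have near: "dist (x + s *\<^sub>R u + t *\<^sub>R v) x < e" if "0 \<le> s" "s \<le> h" "0 \<le> t" "t \<le> h" for s t
  proof -
    have "dist (x + s *\<^sub>R u + t *\<^sub>R v) x \<le> s * norm u + t * norm v"
      using norm_triangle_ineq[of "s *\<^sub>R u" "t *\<^sub>R v"] that by (simp add: dist_norm add.assoc)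
    also have "\<dots> \<le> h * norm u + h * norm v" using that by (intro add_mono mult_right_mono) auto
    also have "\<dots> \<le> h * (norm u + norm v + 1)" using h by (simp add: algebra_simps)
    also have "\<dots> = e / 2"
      using add_nonneg_pos[of "norm u + norm v" 1] by (simp add: h_def field_simps)
    finally show ?thesis using e(1) by simp
  qed
  have d1: "f differentiable (at y)" if "y \<in> S" for y by (rule smooth_on_differentiable[OF f that])
  have d2: "(\<lambda>y. fd f y w) differentiable (at y)" if "y \<in> S" for y w
    by (rule smooth_on_differentiable[OF smooth_on_fd[OF f] that])
  obtain s t where 1: "0 \<le> s" "s \<le> h" "0 \<le> t" "t \<le> h"
    "f (x + h *\<^sub>R u + h *\<^sub>R v) - f (x + h *\<^sub>R u) - f (x + h *\<^sub>R v) + f x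
       = h * (h * P (x + s *\<^sub>R u + t *\<^sub>R v))"
    using second_difference_mvt[of h x u v S f, OF _ d1 d2 h] near e(2) unfolding P_def by blast
  have near': "dist (x + s *\<^sub>R v + t *\<^sub>R u) x < e" if "0 \<le> s" "s \<le> h" "0 \<le> t" "t \<le> h" for s t
    using near[of t s] that by (simp add: add.commute add.left_commute)
  obtain s' t' where 2: "0 \<le> s'" "s' \<le> h" "0 \<le> t'" "t' \<le> h"
    "f (x + h *\<^sub>R v + h *\<^sub>R u) - f (x + h *\<^sub>R v) - f (x + h *\<^sub>R u) + f x
       = h * (h * Q (x + s' *\<^sub>R v + t' *\<^sub>R u))"
    using second_difference_mvt[of h x v u S f, OF _ d1 d2 h] near' e(2) unfolding Q_def by blast
  have c: "x + h *\<^sub>R v + h *\<^sub>R u = x + h *\<^sub>R u + h *\<^sub>R v" by (simp add: algebra_simps)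
  have "h * (h * P (x + s *\<^sub>R u + t *\<^sub>R v)) = h * (h * Q (x + s' *\<^sub>R v + t' *\<^sub>R u))"
    using 1(5) 2(5) unfolding c by linarith
  then have "P (x + s *\<^sub>R u + t *\<^sub>R v) = Q (x + s' *\<^sub>R v + t' *\<^sub>R u)" using h by simp
  moreover have "c < P (x + s *\<^sub>R u + t *\<^sub>R v)" "Q (x + s' *\<^sub>R v + t' *\<^sub>R u) < c"
    using e(2) near near' 1 2 by blast+
  ultimately show False by simp
qed

lemma fd_commute:
  fixes f :: "'a::real_normed_vector \<Rightarrow> 'b::euclidean_space"
  assumes S: "open S" "x \<in> S" and f: "smooth_on S f"
  shows "fd (\<lambda>y. fd f y u) x v = fd (\<lambda>y. fd f y v) x u"
proof (rule euclidean_eqI)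
  fix b :: 'b
  have sf: "smooth_on S (\<lambda>y. f y \<bullet> b)" by (rule smooth_on_bounded_linear[OF bounded_linear_inner_left S(1) f])
  have 1: "fd (\<lambda>y. g y \<bullet> b) y w = fd g y w \<bullet> b" if "y \<in> S" "smooth_on S g" for g :: "'a \<Rightarrow> 'b" and y w
    by (subst fd_eq[OF bounded_linear.has_derivative[OF bounded_linear_inner_left
          fd_works[OF smooth_on_differentiable[OF that(2,1)]]]]) simp
  have 2: "fd (\<lambda>y. fd (\<lambda>y. f y \<bullet> b) y u) x v = fd (\<lambda>y. fd f y u) x v \<bullet> b" for u v
  proof -
    have "fd (\<lambda>y. fd (\<lambda>y. f y \<bullet> b) y u) x v = fd (\<lambda>y. fd f y u \<bullet> b) x v"
      by (subst fd_cong[OF S, of "\<lambda>y. fd f y u \<bullet> b"])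
         (auto simp: 1 f intro: smooth_on_differentiable[OF smooth_on_bounded_linear[OF bounded_linear_inner_left S(1) smooth_on_fd[OF f]] S(2)])
    then show ?thesis using 1[OF S(2) smooth_on_fd[OF f]] by simp
  qed
  show "fd (\<lambda>y. fd f y u) x v \<bullet> b = fd (\<lambda>y. fd f y v) x u \<bullet> b"
    using fd_commute_real_le[OF S sf, of u v] fd_commute_real_le[OF S sf, of v u] by (simp add: 2)
qed

text \<open>Were the second derivative along \<open>v\<close> positive, the first derivative, zero
  at \<open>x\<close>, would be positive just beyond \<open>x\<close> on the line, and
  \<open>f\<close> would exceed its maximum there.\<close>

lemma local_max_derivatives:
  fixes f :: "'a::real_normed_vector \<Rightarrow> real"
  assumes S: "open S" "x \<in> S" and f: "\<And>y. y \<in> S \<Longrightarrow> f differentiable (at y)"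
    and f2: "(\<lambda>y. fd f y v) differentiable (at x)" and max: "\<And>y. y \<in> S \<Longrightarrow> f y \<le> f x"
  shows "fd f x v = 0" and "fd (\<lambda>y. fd f y v) x v \<le> 0"
proof -
  have 0: "fd f x w = 0" for w
    using differential_zero_maxmin[OF S(2,1) fd_works[OF f[OF S(2)]]] max by auto
  show "fd f x v = 0" by (rule 0)
  show "fd (\<lambda>y. fd f y v) x v \<le> 0"
  proof (rule ccontr)
    assume "\<not> ?thesis"
    then have pos: "fd (\<lambda>y. fd f y v) (x + 0 *\<^sub>R v) v > 0" by simp
    have "DERIV (\<lambda>t. fd f (x + t *\<^sub>R v) v) 0 :> fd (\<lambda>y. fd f y v) (x + 0 *\<^sub>R v) v"
      by (rule DERIV_along_line) (use f2 in simp)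
    from DERIV_pos_inc_right[OF this pos] obtain d where d: "d > 0"
      "\<And>h. h > 0 \<Longrightarrow> h < d \<Longrightarrow> fd f (x + h *\<^sub>R v) v > 0" by (auto simp: 0)
    have "\<forall>\<^sub>F t in nhds (0::real). x + t *\<^sub>R v \<in> S"
    proof -
      have "((\<lambda>t. x + t *\<^sub>R v) \<longlongrightarrow> x + 0 *\<^sub>R v) (nhds 0)"
        by (intro tendsto_intros) (simp add: filterlim_ident)
      then show ?thesis using S by (simp add: topological_tendstoD)
    qed
    then obtain e where e: "e > 0" "\<And>t. \<bar>t\<bar> < e \<Longrightarrow> x + t *\<^sub>R v \<in> S"
      unfolding eventually_nhds_metric dist_real_def diff_0_right by blast
    define h where "h = min d e / 2"
    have h: "h > 0" "h < d" "h < e" using d(1) e(1) by (auto simp: h_def)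
    have "\<exists>z. 0 < z \<and> z < h \<and> f (x + h *\<^sub>R v) - f (x + 0 *\<^sub>R v) = (h - 0) * fd f (x + z *\<^sub>R v) v"
      by (rule MVT2[OF h(1)]) (intro DERIV_along_line f e(2); use h in auto)
    then obtain z where z: "0 < z" "z < h" "f (x + h *\<^sub>R v) - f x = h * fd f (x + z *\<^sub>R v) v" by auto
    then have "f (x + h *\<^sub>R v) > f x" using d(2)[of z] h mult_pos_pos[of h "fd f (x + z *\<^sub>R v) v"] by linarith
    moreover have "f (x + h *\<^sub>R v) \<le> f x" using max e(2) h by auto
    ultimately show False by simp
  qed
qed


section \<open>Linear algebra and bilinear forms\<close>

text \<open>A family with as many members as the dimension and with dual functionals is a basis:
  \<open>P\<close> has the left inverse \<open>Q\<close>, hence is onto by dimension. The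
  functionals are arbitrary so that Lorentzian frames, whose timelike member needs a sign, are
  covered together with orthonormal ones.\<close>

lemma dual_family_expand:
  fixes e :: "'i \<Rightarrow> 'a::euclidean_space" and \<phi> :: "'i \<Rightarrow> 'a \<Rightarrow> real"
  assumes "finite I" "card I = DIM('a)" "\<And>i. i \<in> I \<Longrightarrow> linear (\<phi> i)"
    and dual: "\<And>i j. i \<in> I \<Longrightarrow> j \<in> I \<Longrightarrow> \<phi> i (e j) = (if i = j then 1 else 0)"
  shows "(\<Sum>i\<in>I. \<phi> i z *\<^sub>R e i) = z"
proof -
  obtain \<beta> where \<beta>: "bij_betw \<beta> I (Basis :: 'a set)"
    using assms(1,2) finite_same_card_bij[OF assms(1) finite_Basis] by auto
  have \<beta>B: "\<beta> i \<in> Basis" if "i \<in> I" for i using \<beta> that bij_betwE by blast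
  have \<beta>i: "\<beta> i \<bullet> \<beta> j = (if i = j then 1 else 0)" if "i \<in> I" "j \<in> I" for i j
    using inner_Basis[OF \<beta>B \<beta>B, OF that] bij_betw_imp_inj_on[OF \<beta>] that by (auto simp: inj_on_eq_iff)
  define P where "P z = (\<Sum>i\<in>I. (z \<bullet> \<beta> i) *\<^sub>R e i)" for z
  define Q where "Q z = (\<Sum>i\<in>I. \<phi> i z *\<^sub>R \<beta> i)" for z
  have lP: "linear P" unfolding P_def
    by (rule linearI) (simp_all add: inner_add_left scaleR_add_left sum.distrib scaleR_sum_right)
  have lQ: "linear Q" unfolding Q_def
    by (rule linearI) (simp_all add: linear_add[OF assms(3)] linear_scale[OF assms(3)] scaleR_add_left
        sum.distrib scaleR_sum_right)
  have "Q (e j) = \<beta> j" if "j \<in> I" for j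
    using that assms(1) by (simp add: Q_def dual if_distrib[of "\<lambda>c. c *\<^sub>R _"] cong: if_cong)
  then have "Q (P z) = (\<Sum>i\<in>I. (z \<bullet> \<beta> i) *\<^sub>R \<beta> i)" for z
    by (simp add: P_def linear_sum[OF lQ] linear_scale[OF lQ])
  also have "(\<Sum>i\<in>I. (z \<bullet> \<beta> i) *\<^sub>R \<beta> i) = (\<Sum>b\<in>Basis. (z \<bullet> b) *\<^sub>R b)" for z
    by (rule sum.reindex_bij_betw[OF \<beta>])
  finally have QP: "Q (P z) = z" for z by (simp add: euclidean_representation)
  then have "inj P" by (metis injI)
  then obtain w where "z = P w" using linear_injective_imp_surjective[OF lP] by (metis surjD)
  then have "P (Q z) = z" using QP by simp
  moreover have "Q z \<bullet> \<beta> i = \<phi> i z" if "i \<in> I" for i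
    using that assms(1) by (simp add: Q_def inner_sum_left \<beta>i if_distrib cong: if_cong)
  ultimately show ?thesis by (simp add: P_def)
qed

text \<open>Basis independence of the trace. It serves the invariance under a change of chart as
  well as the passage to frames adapted to the hypersurface.\<close>

lemma trace_dual_family:
  fixes e :: "'i \<Rightarrow> 'a::euclidean_space" and \<phi> :: "'i \<Rightarrow> 'a \<Rightarrow> real"
  assumes "linear T" "finite I" "card I = DIM('a)" "\<And>i. i \<in> I \<Longrightarrow> linear (\<phi> i)"
    "\<And>i j. i \<in> I \<Longrightarrow> j \<in> I \<Longrightarrow> \<phi> i (e j) = (if i = j then 1 else 0)"
  shows "(\<Sum>b\<in>Basis. T b \<bullet> b) = (\<Sum>i\<in>I. \<phi> i (T (e i)))"
proof -
  note ex = dual_family_expand[of I \<phi> e, OF assms(2-)]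
  have "(\<Sum>b\<in>Basis. T b \<bullet> b) = (\<Sum>b\<in>Basis. (\<Sum>i\<in>I. \<phi> i (T b) *\<^sub>R e i) \<bullet> b)"
    by (simp only: ex)
  also have "\<dots> = (\<Sum>i\<in>I. \<Sum>b\<in>Basis. \<phi> i (T b) * (e i \<bullet> b))"
    by (subst sum.swap) (simp add: inner_sum_left)
  also have "\<dots> = (\<Sum>i\<in>I. \<phi> i (T (e i)))"
  proof (rule sum.cong[OF refl])
    fix i assume i: "i \<in> I"
    have "linear (\<lambda>z. \<phi> i (T z))" using linear_compose[OF assms(1) assms(4)[OF i]] by (simp add: o_def)
    from linear_field_expand[OF this, of "e i"]
    show "(\<Sum>b\<in>Basis. \<phi> i (T b) * (e i \<bullet> b)) = \<phi> i (T (e i))" by (simp add: mult.commute)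
  qed
  finally show ?thesis .
qed

lemma trace_similar:
  fixes T M M' :: "'a::euclidean_space \<Rightarrow> 'a"
  assumes "linear T" "linear M'" "\<And>z. M' (M z) = z"
  shows "(\<Sum>b\<in>Basis. M' (T (M b)) \<bullet> b) = (\<Sum>b\<in>Basis. T b \<bullet> b)"
proof -
  have "linear (\<lambda>z. M' z \<bullet> i)" for i
    using assms(2) by (auto simp: linear_iff inner_add_left)
  then show ?thesis
    using trace_dual_family[OF assms(1), of Basis "\<lambda>b z. M' z \<bullet> b" M] by (simp add: assms(3) inner_Basis)
qed

text \<open>Gram-Schmidt, by induction over subsets of \<open>Basis\<close>. Indexing by
  \<open>Basis\<close> lets frame sums and coordinate sums range over the same set.\<close>

lemma orthonormal_family_exists:
  fixes g :: "'a::euclidean_space \<Rightarrow> 'a \<Rightarrow> real"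
  assumes bil: "bilinear g" and sym: "\<And>u v. g u v = g v u" and pos: "\<And>v. v \<noteq> 0 \<Longrightarrow> g v v > 0"
  shows "\<exists>e :: 'a \<Rightarrow> 'a. \<forall>b\<in>Basis. \<forall>b'\<in>Basis. g (e b) (e b') = (if b = b' then 1 else 0)"
proof -
  interpret bl: linear "\<lambda>x. g x y" for y using bil by (simp add: bilinear_def)
  have "finite B \<Longrightarrow> B \<subseteq> (Basis::'a set) \<Longrightarrow> \<exists>e. \<forall>b\<in>B. \<forall>b'\<in>B. g (e b) (e b') = (if b = b' then 1 else 0)" for B
  proof (induction B rule: finite_induct)
    case (insert b0 B)
    then obtain e where e: "\<And>b b'. b \<in> B \<Longrightarrow> b' \<in> B \<Longrightarrow> g (e b) (e b') = (if b = b' then 1 else 0)" by auto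
    \<comment> \<open>Fewer vectors than the dimension cannot span, which supplies a new vector to
      orthogonalise.\<close>
    have "card B < DIM('a)"
      using insert.hyps insert.prems by (intro psubset_card_mono) auto
    then have "dim (e ` B) < DIM('a)"
      using dim_le_card'[of "e ` B"] card_image_le[of B e] insert.hyps by simp
    then have "span (e ` B) \<noteq> UNIV" by (metis dim_UNIV dim_span less_irrefl)
    then obtain v where v: "v \<notin> span (e ` B)" by auto
    define w where "w = v - (\<Sum>b\<in>B. g v (e b) *\<^sub>R e b)"
    have "(\<Sum>b\<in>B. g v (e b) *\<^sub>R e b) \<in> span (e ` B)" by (intro span_sum span_scale span_base imageI)
    then have "w \<noteq> 0" using v by (auto simp: w_def)
    then have ww: "g w w > 0" by (rule pos)
    have we: "g w (e b) = 0" if "b \<in> B" for b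
    proof -
      have "g (\<Sum>b\<in>B. g v (e b) *\<^sub>R e b) (e b) = (\<Sum>b'\<in>B. g v (e b') * g (e b') (e b))"
        by (simp add: bl.sum bilinear_lmul[OF bil])
      also have "\<dots> = g v (e b)"
        using that insert.hyps(1) by (simp add: e if_distrib cong: if_cong)
      finally show ?thesis by (simp add: w_def bilinear_lsub[OF bil])
    qed
    have ew: "g (e b) w = 0" if "b \<in> B" for b using we[OF that] sym[of "e b" w] by simp
    define e' where "e' = e(b0 := (1 / sqrt (g w w)) *\<^sub>R w)"
    have "g (e' b) (e' b') = (if b = b' then 1 else 0)" if "b \<in> insert b0 B" "b' \<in> insert b0 B" for b b'
      using that insert.hyps ww
      by (auto simp: e'_def e we ew bilinear_lmul[OF bil] bilinear_rmul[OF bil])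
    then show ?case by blast
  qed auto
  from this[OF finite_Basis subset_refl] show ?thesis .
qed

lemma orthonormal_family_expand:
  fixes g :: "'a::euclidean_space \<Rightarrow> 'a \<Rightarrow> real" and e :: "'a \<Rightarrow> 'a"
  assumes bil: "bilinear g" and e: "\<And>b b'. b \<in> Basis \<Longrightarrow> b' \<in> Basis \<Longrightarrow> g (e b) (e b') = (if b = b' then 1 else 0)"
  shows "(\<Sum>b\<in>Basis. g (e b) z *\<^sub>R e b) = z"
    and "linear T \<Longrightarrow> (\<Sum>b\<in>Basis. T b \<bullet> b) = (\<Sum>b\<in>Basis. g (e b) (T (e b)))"
proof -
  have l: "linear (g (e b))" for b using bil by (simp add: bilinear_def)
  show "(\<Sum>b\<in>Basis. g (e b) z *\<^sub>R e b) = z"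
    by (rule dual_family_expand) (auto simp: l e)
  show "linear T \<Longrightarrow> (\<Sum>b\<in>Basis. T b \<bullet> b) = (\<Sum>b\<in>Basis. g (e b) (T (e b)))"
    by (rule trace_dual_family) (auto simp: l e)
qed

lemma orthonormal_parseval:
  fixes g :: "'a::euclidean_space \<Rightarrow> 'a \<Rightarrow> real" and e :: "'a \<Rightarrow> 'a"
  assumes bil: "bilinear g" and e: "\<And>b b'. b \<in> Basis \<Longrightarrow> b' \<in> Basis \<Longrightarrow> g (e b) (e b') = (if b = b' then 1 else 0)"
  shows "(\<Sum>b\<in>Basis. g (e b) z * g (e b) z') = g z z'"
proof -
  interpret bl: linear "\<lambda>x. g x y" for y using bil by (simp add: bilinear_def)
  have sym: "g z' (e b) = g (e b) z'" if "b \<in> Basis" for b z'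
  proof -
    have "g z' (e b) = g (\<Sum>b\<in>Basis. g (e b) z' *\<^sub>R e b) (e b)"
      by (simp add: orthonormal_family_expand(1)[OF assms])
    also have "\<dots> = (\<Sum>b'\<in>Basis. g (e b') z' * g (e b') (e b))"
      by (simp add: bl.sum bilinear_lmul[OF bil])
    also have "\<dots> = g (e b) z'" using that by (simp add: e if_distrib cong: if_cong)
    finally show ?thesis .
  qed
  have "g z z' = g (\<Sum>b\<in>Basis. g (e b) z *\<^sub>R e b) z'"
    by (simp add: orthonormal_family_expand(1)[OF assms])
  also have "\<dots> = (\<Sum>b\<in>Basis. g (e b) z * g (e b) z')"
    by (simp add: bl.sum bilinear_lmul[OF bil])
  finally show ?thesis by simp
qed

lemma bilinear_field_bounded:
  fixes B :: "'x::topological_space \<Rightarrow> 'a::euclidean_space \<Rightarrow> 'b::euclidean_space \<Rightarrow> real"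
  assumes K: "compact K" and bil: "\<And>y. y \<in> K \<Longrightarrow> bilinear (B y)" and cont: "\<And>u v. continuous_on K (\<lambda>y. B y u v)"
  shows "\<exists>C\<ge>0. \<forall>y\<in>K. \<forall>u v. \<bar>B y u v\<bar> \<le> C * (norm u * norm v)"
proof -
  have "\<exists>c. \<forall>y\<in>K. \<bar>B y i j\<bar> \<le> c" for i j
    using compact_imp_bounded[OF compact_continuous_image[OF cont K, of i j]]
    by (auto simp: bounded_iff)
  then obtain c where c: "\<And>y i j. y \<in> K \<Longrightarrow> \<bar>B y i j\<bar> \<le> c i j" by metis
  define C where "C = (\<Sum>i\<in>Basis. \<Sum>j\<in>Basis. \<bar>c i j\<bar>)"
  have "\<bar>B y u v\<bar> \<le> C * (norm u * norm v)" if y: "y \<in> K" for y u v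
  proof -
    have l: "linear (\<lambda>u. B y u v)" "linear (B y u)" for u v using bil[OF y] by (auto simp: bilinear_def)
    have "B y u v = (\<Sum>i\<in>Basis. (u \<bullet> i) * (\<Sum>j\<in>Basis. (v \<bullet> j) * B y i j))"
      using linear_field_expand[OF l(1), of u v] linear_field_expand[OF l(2), of _ v] by simp
    also have "\<bar>\<dots>\<bar> \<le> (\<Sum>i\<in>Basis. norm u * (\<Sum>j\<in>Basis. norm v * \<bar>c i j\<bar>))"
    proof (rule order_trans[OF sum_abs], rule sum_mono)
      fix i :: 'a assume i: "i \<in> Basis"
      have "\<bar>\<Sum>j\<in>Basis. (v \<bullet> j) * B y i j\<bar> \<le> (\<Sum>j\<in>Basis. norm v * \<bar>c i j\<bar>)"
        by (rule order_trans[OF sum_abs], rule sum_mono)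
           (auto simp: abs_mult intro!: mult_mono Basis_le_norm order_trans[OF c[OF y] abs_ge_self])
      then show "\<bar>(u \<bullet> i) * (\<Sum>j\<in>Basis. (v \<bullet> j) * B y i j)\<bar> \<le> norm u * (\<Sum>j\<in>Basis. norm v * \<bar>c i j\<bar>)"
        using i by (auto simp: abs_mult intro!: mult_mono Basis_le_norm)
    qed
    also have "\<dots> = C * (norm u * norm v)"
      by (simp add: C_def sum_distrib_left sum_distrib_right mult_ac)
    finally show ?thesis .
  qed
  moreover have "C \<ge> 0" by (simp add: C_def sum_nonneg)
  ultimately show ?thesis by blast
qed

lemma bilinear_field_pos_lower_bound:
  fixes B :: "'x::metric_space \<Rightarrow> 'a::euclidean_space \<Rightarrow> 'a \<Rightarrow> real"
  assumes K: "compact K" and bil: "\<And>y. y \<in> K \<Longrightarrow> bilinear (B y)" and cont: "\<And>u v. continuous_on K (\<lambda>y. B y u v)"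
    and pos: "\<And>y v. y \<in> K \<Longrightarrow> v \<noteq> 0 \<Longrightarrow> B y v v > 0"
  shows "\<exists>c>0. \<forall>y\<in>K. \<forall>v. B y v v \<ge> c * (norm v)\<^sup>2"
proof (cases "K = {}")
  case False
  \<comment> \<open>The quadratic form is written out in the basis because continuity is known only
    for fixed arguments, while minimising over \<open>K\<close> times the unit sphere needs it
    jointly.\<close>
  define f where "f = (\<lambda>(y, v). \<Sum>i\<in>Basis. (v \<bullet> i) * (\<Sum>j\<in>Basis. (v \<bullet> j) * B y i j))"
  have f: "f (y, v) = B y v v" if "y \<in> K" for y v
  proof -
    have l: "linear (\<lambda>u. B y u v)" "linear (B y u)" for u v using bil[OF that] by (auto simp: bilinear_def)
    show ?thesis
      using linear_field_expand[OF l(1), of v v] linear_field_expand[OF l(2), of _ v] by (simp add: f_def)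
  qed
  let ?C = "K \<times> sphere (0::'a) 1"
  have "continuous_on ?C f"
    unfolding f_def case_prod_beta
    by (intro continuous_intros continuous_on_compose2[OF cont]) auto
  moreover have "compact ?C" "?C \<noteq> {}" using K False by (auto intro!: compact_Times)
  ultimately obtain z where z: "z \<in> ?C" "\<And>w. w \<in> ?C \<Longrightarrow> f z \<le> f w"
    using continuous_attains_inf[of ?C f] by blast
  obtain y0 v0 where z0: "z = (y0, v0)" "y0 \<in> K" "norm v0 = 1" using z(1) by auto
  have c: "f z > 0" using z0 f[of y0 v0] pos[of y0 v0] by force
  have "B y v v \<ge> f z * (norm v)\<^sup>2" if "y \<in> K" for y v
  proof (cases "v = 0")
    case True then show ?thesis using bilinear_lzero[OF bil[OF that]] by simp
  next
    case False
    let ?w = "(1 / norm v) *\<^sub>R v"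
    have "f z \<le> B y ?w ?w" using z(2)[of "(y, ?w)"] f[OF that] that False by simp
    also have "\<dots> = B y v v / (norm v)\<^sup>2"
      by (simp add: bilinear_lmul[OF bil[OF that]] bilinear_rmul[OF bil[OF that]] power2_eq_square)
    finally show ?thesis using False by (simp add: field_simps)
  qed
  then show ?thesis using c by blast
qed (auto intro: exI[of _ 1])


section \<open>The strong maximum principle\<close>

text \<open>The sum of squares is the principal symbol of \<open>frame_laplacian\<close> at the
  covector \<open>z\<close>, so \<kappa> is the ellipticity constant; \<Lambda> controls the trace
  of the second-order part and the drift.\<close>

definition elliptic_bounds :: "real \<Rightarrow> real \<Rightarrow> ('a::euclidean_space \<Rightarrow> 'a) \<Rightarrow> 'a \<Rightarrow> bool" where
  "elliptic_bounds \<kappa> \<Lambda> e b \<longleftrightarrow> (\<forall>z. (\<Sum>k\<in>Basis. (z \<bullet> e k)\<^sup>2) \<ge> \<kappa> * (norm z)\<^sup>2) \<and>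
     (\<Sum>k\<in>Basis. e k \<bullet> e k) \<le> \<Lambda> \<and> norm b \<le> \<Lambda>"

definition frame_laplacian :: "('a::euclidean_space \<Rightarrow> 'a) \<Rightarrow> 'a \<Rightarrow> ('a \<Rightarrow> real) \<Rightarrow> 'a \<Rightarrow> real" where
  "frame_laplacian e b u x = (\<Sum>k\<in>Basis. fd (\<lambda>y. fd u y (e k)) x (e k)) - fd u x b"

text \<open>This is \<open>g (\<Sum>\<^sub>k \<nabla>\<^bsub>e\<^sub>k\<^esub> e\<^sub>k) v\<close> for the Levi-Civita connection of \<open>g\<close> and constant vectors
  \<open>e\<^sub>k\<close>. A vector \<open>b\<close> that represents it makes \<open>frame_laplacian e b\<close> the Laplacian of \<open>g\<close> at \<open>x\<close>.\<close>

definition christoffel_trace :: "('a::euclidean_space \<Rightarrow> 'a \<Rightarrow> 'a \<Rightarrow> real) \<Rightarrow> 'a \<Rightarrow> ('a \<Rightarrow> 'a) \<Rightarrow> 'a \<Rightarrow> real" where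
  "christoffel_trace g x e v =
     (\<Sum>k\<in>Basis. fd (\<lambda>y. g y (e k) v) x (e k) - 1/2 * fd (\<lambda>y. g y (e k) (e k)) x v)"

lemma gaussian_derivatives:
  fixes y :: "'a::euclidean_space" and \<alpha> :: real
  assumes E_def: "E = (\<lambda>x. exp (- \<alpha> * ((x - y) \<bullet> (x - y))))"
  shows "E differentiable (at x)" "(\<lambda>x. fd E x v) differentiable (at x)"
    "fd E x v = - 2 * \<alpha> * ((x - y) \<bullet> v) * E x"
    "fd (\<lambda>x. fd E x v) x v = (4 * \<alpha>\<^sup>2 * ((x - y) \<bullet> v)\<^sup>2 - 2 * \<alpha> * (v \<bullet> v)) * E x"
proof -
  have 1: "(E has_derivative (\<lambda>v. - 2 * \<alpha> * ((x - y) \<bullet> v) * E x)) (at x)" for x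
    unfolding E_def by (auto intro!: derivative_eq_intros simp: inner_commute algebra_simps)
  then show "E differentiable (at x)" by (rule differentiableI)
  have fE: "fd E x v = - 2 * \<alpha> * ((x - y) \<bullet> v) * E x" for x v using fd_eq[OF 1] by simp
  then show "fd E x v = - 2 * \<alpha> * ((x - y) \<bullet> v) * E x" .
  have 2: "((\<lambda>x. fd E x v) has_derivative
      (\<lambda>w. - 2 * \<alpha> * ((x - y) \<bullet> v) * (- 2 * \<alpha> * ((x - y) \<bullet> w) * E x) + (- 2 * \<alpha> * (w \<bullet> v)) * E x)) (at x)"
    unfolding fE by (rule derivative_eq_intros 1 refl | simp)+
  then show "(\<lambda>x. fd E x v) differentiable (at x)" by (rule differentiableI)
  show "fd (\<lambda>x. fd E x v) x v = (4 * \<alpha>\<^sup>2 * ((x - y) \<bullet> v)\<^sup>2 - 2 * \<alpha> * (v \<bullet> v)) * E x"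
    using fd_eq[OF 2] by (simp add: power2_eq_square algebra_simps)
qed

text \<open>Hopf's barrier argument: the contact point \<open>q\<close> of an interior ball with the set where the
  maximum is attained would be an interior maximum of \<open>u\<close> plus a multiple of a Gaussian barrier,
  on which the elliptic operator is strictly positive.\<close>

lemma strong_maximum_principle:
  fixes u :: "'a::euclidean_space \<Rightarrow> real"
  assumes S: "open S" and u: "smooth_on S u" and le: "\<And>x. x \<in> S \<Longrightarrow> u x \<le> m"
    and ell: "\<And>K. compact K \<Longrightarrow> K \<subseteq> S \<Longrightarrow> \<exists>\<kappa>>0. \<exists>\<Lambda>. \<forall>y\<in>K. \<exists>e b.
       elliptic_bounds \<kappa> \<Lambda> e b \<and> 0 \<le> frame_laplacian e b u y"
  shows "open {x \<in> S. u x = m}"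
proof (rule ccontr)
  let ?C = "{x \<in> S. u x = m}"
  assume "\<not> open ?C"
  then obtain p where p: "p \<in> S" "u p = m" and np: "\<And>r. r > 0 \<Longrightarrow> \<not> ball p r \<subseteq> ?C"
    unfolding open_contains_ball by auto
  obtain r0 where r0: "r0 > 0" "cball p r0 \<subseteq> S" using S p(1) open_contains_cball by blast
  define r where "r = r0 / 2"
  have r: "r > 0" "cball p (2 * r) \<subseteq> S" using r0 by (auto simp: r_def)
  \<comment> \<open>As \<open>y\<close> lies within \<open>r\<close> of the contact point
    \<open>p\<close>, its nearest contact point \<open>q\<close> lies within \<open>r\<close> of
    \<open>y\<close>, hence in the interior of the ball of radius \<open>2 * r\<close> about
    \<open>p\<close>.\<close>
  obtain y where y: "y \<in> ball p r" "y \<notin> ?C" using np[OF r(1)] by blast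
  let ?C' = "cball p (2 * r) \<inter> u -` {m}"
  have contu: "continuous_on S u" by (rule smooth_on_continuous_on[OF u])
  have "closed ?C'"
    by (rule continuous_closed_preimage) (use contu r(2) in \<open>auto intro: continuous_on_subset\<close>)
  moreover have "p \<in> ?C'" using p r(1) by auto
  ultimately obtain q where q: "q \<in> ?C'" "\<And>z. z \<in> ?C' \<Longrightarrow> dist y q \<le> dist y z"
    using distance_attains_inf[of ?C' y] by blast
  have ymem: "y \<in> cball p (2 * r)" using y(1) r(1) by auto
  have R0: "dist y q > 0" using q(1) y(2) ymem r(2) by auto
  have "dist y q \<le> dist y p" by (rule q(2)) (use p r in auto)
  then have qin: "q \<in> ball p (2 * r)"
    using y(1) dist_triangle[of p q y] by (auto simp: dist_commute)
  \<comment> \<open>The ball about \<open>y\<close> may touch the contact set in several points. The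
    ball of half the radius about the midpoint \<open>y'\<close> touches it in \<open>q\<close>
    only.\<close>
  define y' where "y' = (1/2) *\<^sub>R (y + q)"
  define R where "R = dist y q / 2"
  have R: "R > 0" using R0 by (simp add: R_def)
  have qy': "norm (q - y') = R"
  proof -
    have "q - y' = (1/2) *\<^sub>R (q - y)" by (simp add: y'_def algebra_simps flip: scaleR_add_left)
    then show ?thesis by (simp add: R_def dist_norm norm_minus_commute)
  qed
  have yy': "norm (y' - y) = R"
  proof -
    have "y' - y = (1/2) *\<^sub>R (q - y)" by (simp add: y'_def algebra_simps flip: scaleR_add_left)
    then show ?thesis by (simp add: R_def dist_norm norm_minus_commute)
  qed
  have touch: "z = q" if z: "z \<in> ?C'" "norm (z - y') \<le> R" for z
  proof -
    have "2 * R \<le> norm ((z - y') + (y' - y))"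
      using q(2)[OF z(1)] by (simp add: R_def dist_norm norm_minus_commute)
    then have a: "(2 * R)\<^sup>2 \<le> (norm ((z - y') + (y' - y)))\<^sup>2" using R by (intro power_mono) auto
    have b: "(norm (z - y'))\<^sup>2 \<le> R\<^sup>2" using z(2) by (intro power_mono) auto
    \<comment> \<open>The parallelogram law: two vectors of length at most \<open>R\<close> whose
      sum has length at least \<open>2 * R\<close> coincide.\<close>
    have "(norm ((z - y') - (y' - y)))\<^sup>2 =
       2 * (norm (z - y'))\<^sup>2 + 2 * (norm (y' - y))\<^sup>2 - (norm ((z - y') + (y' - y)))\<^sup>2"
      unfolding power2_norm_eq_inner
      by (simp add: inner_add_left inner_add_right inner_diff_left inner_diff_right)
    then have "(norm ((z - y') - (y' - y)))\<^sup>2 \<le> 0"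
      using a b yy' by (simp add: power2_eq_square)
    then have "z - y' = y' - y" by simp
    then have "z = 2 *\<^sub>R y' - y" by (simp add: scaleR_2 algebra_simps)
    then show "z = q" by (simp add: y'_def)
  qed
  obtain \<rho>0 where \<rho>0: "\<rho>0 > 0" "cball q \<rho>0 \<subseteq> ball p (2 * r)"
    by (metis qin open_ball open_contains_cball)
  \<comment> \<open>The bound \<open>R / 2\<close> keeps the small ball about \<open>q\<close> away
    from \<open>y'\<close>, where the gradient of the Gaussian vanishes and the barrier
    fails.\<close>
  define \<rho> where "\<rho> = min \<rho>0 (R / 2)"
  have \<rho>: "\<rho> > 0" "\<rho> \<le> R / 2" using \<rho>0 R by (auto simp: \<rho>_def)
  have sub: "cball q \<rho> \<subseteq> cball p (2 * r)" using \<rho>0(2) by (force simp: \<rho>_def)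
  then have subS: "cball q \<rho> \<subseteq> S" using r(2) by blast
  obtain \<kappa> \<Lambda> where \<kappa>: "\<kappa> > 0" and
    op: "\<forall>y\<in>cball q \<rho>. \<exists>e b. elliptic_bounds \<kappa> \<Lambda> e b \<and> 0 \<le> frame_laplacian e b u y"
    using ell[OF compact_cball subS] by blast
  have \<Lambda>0: "\<Lambda> \<ge> 0"
    using op \<rho>(1) by (metis elliptic_bounds_def centre_in_cball less_imp_le norm_ge_zero order_trans)
  \<comment> \<open>On the small ball the distance to \<open>y'\<close> lies between
    \<open>R / 2\<close> and \<open>2 * R\<close>. With this \<alpha> the quadratic term, of order
    \<alpha> squared, outweighs the trace and drift terms, of order \<alpha>.\<close>
  define \<alpha> where "\<alpha> = 1 + (\<Lambda> + 2 * R * \<Lambda>) / (\<kappa> * (R\<^sup>2 / 4))"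
  have \<alpha>: "\<alpha> > 0" using \<kappa> R \<Lambda>0 by (auto simp: \<alpha>_def intro!: add_pos_nonneg divide_nonneg_pos add_nonneg_nonneg mult_nonneg_nonneg)
  have key: "\<alpha> * (\<kappa> * (R\<^sup>2 / 4)) > \<Lambda> + 2 * R * \<Lambda>"
  proof -
    have "\<kappa> * (R\<^sup>2 / 4) > 0" using \<kappa> R by simp
    moreover have "(1 + X / c) * c = c + X" if "c > 0" for X c :: real using that by (simp add: distrib_right)
    ultimately have "\<alpha> * (\<kappa> * (R\<^sup>2 / 4)) = \<kappa> * (R\<^sup>2 / 4) + (\<Lambda> + 2 * R * \<Lambda>)" unfolding \<alpha>_def by blast
    then show ?thesis using \<open>\<kappa> * (R\<^sup>2 / 4) > 0\<close> by linarith
  qed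
  define E where "E = (\<lambda>x. exp (- \<alpha> * ((x - y') \<bullet> (x - y'))))"
  define h where "h x = E x - exp (- \<alpha> * R\<^sup>2)" for x
  note Ed = gaussian_derivatives[OF E_def]
  have hq: "h q = 0" using qy' by (simp add: h_def E_def flip: power2_norm_eq_inner)
  have h1: "h x \<le> 1" for x
  proof -
    have "E x \<le> 1" using \<alpha> by (simp add: E_def)
    then show ?thesis using exp_gt_zero[of "- \<alpha> * R\<^sup>2"] by (simp add: h_def del: exp_gt_zero)
  qed
  have hneg: "h x \<le> 0" if "norm (x - y') \<ge> R" for x
  proof -
    have "R\<^sup>2 \<le> (x - y') \<bullet> (x - y')"
      using power_mono[OF that, of 2] R by (simp add: power2_norm_eq_inner)
    then show ?thesis using \<alpha> by (simp add: h_def E_def)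
  qed
  \<comment> \<open>Only on this part of the boundary sphere can the barrier \<open>h\<close> be
    positive. It contains no contact point, so by compactness \<open>u\<close> stays below
    \<open>m\<close> by a margin \<epsilon>, which then serves as the weight of the barrier.\<close>
  let ?T = "sphere q \<rho> \<inter> cball y' R"
  have lt: "u z < m" if "z \<in> ?T" for z
  proof -
    have "z \<noteq> q" using that \<rho>(1) by auto
    moreover have "z \<in> cball p (2 * r)" using that sub by (auto simp: subset_iff)
    ultimately have "u z \<noteq> m"
      using touch[of z] that by (auto simp: dist_norm norm_minus_commute)
    then show ?thesis using le[of z] \<open>z \<in> cball p (2 * r)\<close> r(2) by fastforce
  qed
  obtain \<epsilon> where \<epsilon>: "\<epsilon> > 0" "\<And>z. z \<in> ?T \<Longrightarrow> u z + \<epsilon> \<le> m"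
  proof (cases "?T = {}")
    case True then show ?thesis using that[of 1] by auto
  next
    case False
    have "compact ?T" by (simp add: compact_Int)
    moreover have "continuous_on ?T u"
      by (rule continuous_on_subset[OF contu]) (use subS in auto)
    ultimately obtain z0 where z0: "z0 \<in> ?T" "\<And>z. z \<in> ?T \<Longrightarrow> u z \<le> u z0"
      using continuous_attains_sup[of ?T u] False by blast
    show ?thesis by (rule that[of "m - u z0"]) (use lt[OF z0(1)] z0(2) in force)+
  qed
  define f where "f x = u x + \<epsilon> * h x" for x
  have f_sphere: "f x \<le> m" if "x \<in> sphere q \<rho>" for x
  proof (cases "norm (x - y') \<le> R")
    case True
    then have "u x + \<epsilon> \<le> m" using \<epsilon>(2)[of x] that by (simp add: dist_norm norm_minus_commute)
    moreover have "\<epsilon> * h x \<le> \<epsilon>" using h1[of x] \<epsilon>(1) by simp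
    ultimately show ?thesis by (simp add: f_def)
  next
    case False
    then have "\<epsilon> * h x \<le> 0" using hneg[of x] \<epsilon>(1) by (simp add: mult_nonneg_nonpos)
    moreover have "u x \<le> m" using le[of x] subS that by auto
    ultimately show ?thesis by (simp add: f_def)
  qed
  have fq: "f q = m" using q(1) hq by (simp add: f_def)
  have "continuous_on (cball q \<rho>) f"
    unfolding f_def h_def E_def
    by (intro continuous_intros continuous_on_subset[OF contu] subS)
  then obtain x0 where x0: "x0 \<in> cball q \<rho>" "\<And>x. x \<in> cball q \<rho> \<Longrightarrow> f x \<le> f x0"
    using continuous_attains_sup[of "cball q \<rho>" f] \<rho>(1) by fastforce
  \<comment> \<open>On the boundary sphere \<open>f\<close> is at most \<open>m\<close>, and
    \<open>f q = m\<close>. So if the maximum over the closed ball sits on the sphere, the centre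
    \<open>q\<close> attains it as well.\<close>
  obtain x1 where x1: "x1 \<in> ball q \<rho>" "\<And>x. x \<in> ball q \<rho> \<Longrightarrow> f x \<le> f x1"
  proof (cases "x0 \<in> ball q \<rho>")
    case True then show ?thesis using that[of x0] x0(2) by auto
  next
    case False
    then have "f x0 \<le> m" using x0(1) by (intro f_sphere) auto
    then have "f x \<le> f q" if "x \<in> ball q \<rho>" for x
      unfolding fq using x0(2)[of x] that by simp
    then show ?thesis using that[of q] \<rho>(1) by auto
  qed
  have inS: "x \<in> S" if "x \<in> ball q \<rho>" for x using that subS by auto
  have ud: "u differentiable (at x)" if "x \<in> S" for x by (rule smooth_on_differentiable[OF u that])
  have ud2: "(\<lambda>x. fd u x v) differentiable (at x)" if "x \<in> S" for x v
    by (rule smooth_on_differentiable[OF smooth_on_fd[OF u] that])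
  have fder: "(f has_derivative (\<lambda>v. fd u x v + \<epsilon> * fd E x v)) (at x)" if "x \<in> S" for x
    unfolding f_def h_def
    by (rule derivative_eq_intros fd_works ud[OF that] Ed(1) refl | simp)+
  have fd1: "fd f x v = fd u x v + \<epsilon> * fd E x v" if "x \<in> S" for x v
    using fd_eq[OF fder[OF that]] by simp
  have fder2: "((\<lambda>x. fd f x v) has_derivative
      (\<lambda>w. fd (\<lambda>x. fd u x v) x w + \<epsilon> * fd (\<lambda>x. fd E x v) x w)) (at x)" if x: "x \<in> S" for x v
  proof (rule has_derivative_transform_within_open[OF _ S x])
    show "((\<lambda>x. fd u x v + \<epsilon> * fd E x v) has_derivative
      (\<lambda>w. fd (\<lambda>x. fd u x v) x w + \<epsilon> * fd (\<lambda>x. fd E x v) x w)) (at x)"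
      by (rule derivative_eq_intros fd_works ud2[OF x] Ed(2) refl | simp)+
  qed (simp add: fd1)
  have x1S: "x1 \<in> S" by (rule inS[OF x1(1)])
  have max: "fd f x1 v = 0" "fd (\<lambda>x. fd f x v) x1 v \<le> 0" for v
    by (rule local_max_derivatives[OF open_ball x1(1) differentiableI[OF fder[OF inS]]
          differentiableI[OF fder2[OF x1S]] x1(2)]; assumption)+
  obtain e :: "'a \<Rightarrow> 'a" and b where e: "\<And>z. (\<Sum>k\<in>Basis. (z \<bullet> e k)\<^sup>2) \<ge> \<kappa> * (norm z)\<^sup>2"
    "(\<Sum>k\<in>Basis. e k \<bullet> e k) \<le> \<Lambda>" "norm b \<le> \<Lambda>"
    "0 \<le> (\<Sum>k\<in>Basis. fd (\<lambda>x. fd u x (e k)) x1 (e k)) - fd u x1 b"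
    using bspec[OF op, of x1] x1(1) by (auto simp: elliptic_bounds_def frame_laplacian_def)
  define z where "z = x1 - y'"
  have zR: "norm z \<ge> R / 2" "norm z \<le> 2 * R"
  proof -
    have d: "norm (x1 - q) \<le> R / 2" using x1(1) \<rho>(2) by (simp add: dist_norm norm_minus_commute)
    have "norm (q - y') \<le> norm z + norm (x1 - q)" "norm z \<le> norm (q - y') + norm (x1 - q)"
      using norm_triangle_ineq4[of z "x1 - q"] norm_triangle_ineq[of "q - y'" "x1 - q"] by (simp_all add: z_def)
    then show "norm z \<ge> R / 2" "norm z \<le> 2 * R" using d qy' R by auto
  qed
  \<comment> \<open>This is the operator applied to the Gaussian, divided by its value
    \<open>E x1\<close>. Its positivity contradicts the maximum of \<open>f\<close> at
    \<open>x1\<close>, where the operator is nonpositive on \<open>f\<close> but nonnegative on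
    \<open>u\<close>.\<close>
  let ?P = "4 * \<alpha>\<^sup>2 * (\<Sum>k\<in>Basis. (z \<bullet> e k)\<^sup>2) - 2 * \<alpha> * (\<Sum>k\<in>Basis. e k \<bullet> e k) + 2 * \<alpha> * (z \<bullet> b)"
  have "?P > 0"
  proof -
    have "\<kappa> * (R\<^sup>2 / 4) \<le> \<kappa> * (norm z)\<^sup>2"
      using power_mono[OF zR(1), of 2] \<kappa> R by (simp add: power_divide)
    then have "\<kappa> * (R\<^sup>2 / 4) \<le> (\<Sum>k\<in>Basis. (z \<bullet> e k)\<^sup>2)" using e(1)[of z] by linarith
    then have "4 * \<alpha>\<^sup>2 * (\<kappa> * (R\<^sup>2 / 4)) \<le> 4 * \<alpha>\<^sup>2 * (\<Sum>k\<in>Basis. (z \<bullet> e k)\<^sup>2)"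
      by (intro mult_left_mono) auto
    moreover have "4 * \<alpha> * (\<alpha> * (\<kappa> * (R\<^sup>2 / 4))) > 4 * \<alpha> * (\<Lambda> + 2 * R * \<Lambda>)"
      using key \<alpha> by (intro mult_strict_left_mono) auto
    moreover have "2 * \<alpha> * (\<Sum>k\<in>Basis. e k \<bullet> e k) \<le> 2 * \<alpha> * \<Lambda>"
      using e(2) \<alpha> by (intro mult_left_mono) auto
    moreover have "\<bar>z \<bullet> b\<bar> \<le> (2 * R) * \<Lambda>"
      using Cauchy_Schwarz_ineq2[of z b] mult_mono[OF zR(2) e(3)] R by auto
    then have "2 * \<alpha> * (z \<bullet> b) \<ge> 2 * \<alpha> * (- (2 * R) * \<Lambda>)"
      using \<alpha> by (intro mult_left_mono) auto
    moreover have "2 * \<alpha> * \<Lambda> \<ge> 0" "\<alpha> * R * \<Lambda> \<ge> 0" using \<alpha> \<Lambda>0 R by auto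
    ultimately show ?thesis by (simp add: algebra_simps power2_eq_square)
  qed
  then have "\<epsilon> * E x1 * ?P > 0" using \<epsilon>(1) by (simp add: E_def)
  moreover have "(\<Sum>k\<in>Basis. fd (\<lambda>x. fd u x (e k)) x1 (e k)) \<le>
      - (\<epsilon> * E x1 * (4 * \<alpha>\<^sup>2 * (\<Sum>k\<in>Basis. (z \<bullet> e k)\<^sup>2) - 2 * \<alpha> * (\<Sum>k\<in>Basis. e k \<bullet> e k)))"
  proof -
    have "(\<Sum>k\<in>Basis. fd (\<lambda>x. fd u x (e k)) x1 (e k)) \<le>
      (\<Sum>k\<in>Basis. - (\<epsilon> * ((4 * \<alpha>\<^sup>2 * (z \<bullet> e k)\<^sup>2 - 2 * \<alpha> * (e k \<bullet> e k)) * E x1)))"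
    proof (rule sum_mono)
      show "fd (\<lambda>x. fd u x (e k)) x1 (e k) \<le> - (\<epsilon> * ((4 * \<alpha>\<^sup>2 * (z \<bullet> e k)\<^sup>2 - 2 * \<alpha> * (e k \<bullet> e k)) * E x1))" for k
        using max(2)[of "e k"] fd_eq[OF fder2[OF x1S, of "e k"]] Ed(4)[of "e k" x1] by (simp add: z_def)
    qed
    also have "\<dots> = - (\<epsilon> * E x1 * (4 * \<alpha>\<^sup>2 * (\<Sum>k\<in>Basis. (z \<bullet> e k)\<^sup>2) - 2 * \<alpha> * (\<Sum>k\<in>Basis. e k \<bullet> e k)))"
      by (simp add: sum_negf sum_distrib_left sum_distrib_right sum_subtractf algebra_simps)
    finally show ?thesis .
  qed
  moreover have "fd u x1 b = \<epsilon> * E x1 * (2 * \<alpha> * (z \<bullet> b))"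
    using max(1)[of b] fd1[OF x1S, of b] Ed(3)[of x1 b] by (simp add: z_def algebra_simps)
  ultimately show False using e(4) by (simp add: algebra_simps)
qed

text \<open>On a compact set the metric lies between positive multiples \<open>c\<close> and
  \<open>C + 1\<close> of the Euclidean one and its first derivatives are bounded by
  \<open>D\<close>. Expanding \<open>z\<close> in the frame and applying Cauchy-Schwarz gives
  \<open>(norm z)^4 <= g y z z * (sum of squares)\<close>, hence the ellipticity constant.\<close>

lemma metric_laplacian_elliptic:
  fixes g :: "'a::euclidean_space \<Rightarrow> 'a \<Rightarrow> 'a \<Rightarrow> real"
  assumes S: "open S" and bil: "\<And>y. y \<in> S \<Longrightarrow> bilinear (g y)"
    and pos: "\<And>y v. y \<in> S \<Longrightarrow> v \<noteq> 0 \<Longrightarrow> g y v v > 0" and smooth: "\<And>u v. smooth_on S (\<lambda>y. g y u v)"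
    and K: "compact K" "K \<subseteq> S"
  shows "\<exists>\<kappa>>0. \<exists>\<Lambda>. \<forall>y\<in>K. \<forall>(e :: 'a \<Rightarrow> 'a) b.
     (\<forall>i\<in>Basis. \<forall>j\<in>Basis. g y (e i) (e j) = (if i = j then 1 else 0)) \<longrightarrow>
     (\<forall>v. g y b v = christoffel_trace g y e v) \<longrightarrow> elliptic_bounds \<kappa> \<Lambda> e b"
proof -
  have bilK: "bilinear (g y)" if "y \<in> K" for y using bil K(2) that by blast
  have contK: "continuous_on K (\<lambda>y. g y u v)" for u v
    by (rule continuous_on_subset[OF smooth_on_continuous_on[OF smooth] K(2)])
  obtain c where c: "c > 0" "\<And>y v. y \<in> K \<Longrightarrow> g y v v \<ge> c * (norm v)\<^sup>2"
    using bilinear_field_pos_lower_bound[OF K(1) bilK contK] pos K(2) by blast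
  obtain C where C: "C \<ge> 0" "\<And>y u v. y \<in> K \<Longrightarrow> \<bar>g y u v\<bar> \<le> C * (norm u * norm v)"
    using bilinear_field_bounded[OF K(1) bilK contK] by blast
  have l: "linear (\<lambda>u. g y u v)" "linear (g y u)" if "y \<in> S" for y u v
    using bil[OF that] by (auto simp: bilinear_def)
  have "\<exists>D\<ge>0. \<forall>y\<in>K. \<forall>u v. \<bar>fd (\<lambda>y. g y u v) y w\<bar> \<le> D * (norm u * norm v)" for w
  proof (rule bilinear_field_bounded[OF K(1)])
    show "bilinear (\<lambda>u v. fd (\<lambda>y. g y u v) y w)" if "y \<in> K" for y
      using linear_fd_field[OF S _ l(1) smooth_on_differentiable[OF smooth], of y]
        linear_fd_field[OF S _ l(2) smooth_on_differentiable[OF smooth], of y] that K(2)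
      unfolding bilinear_def by blast
    show "continuous_on K (\<lambda>y. fd (\<lambda>y. g y u v) y w)" for u v
      by (rule continuous_on_subset[OF smooth_on_continuous_on[OF smooth_on_fd[OF smooth]] K(2)])
  qed
  then obtain D0 where D0: "\<And>w. D0 w \<ge> 0" "\<And>w y u v. y \<in> K \<Longrightarrow> \<bar>fd (\<lambda>y. g y u v) y w\<bar> \<le> D0 w * (norm u * norm v)"
    by metis
  define D where "D = (\<Sum>w\<in>Basis. D0 w)"
  have D: "D \<ge> 0" by (simp add: D_def D0(1) sum_nonneg)
  have Db: "\<bar>fd (\<lambda>y. g y u v) y w\<bar> \<le> D * (norm u * norm v * norm w)" if y: "y \<in> K" for y u v w
  proof -
    have "linear (fd (\<lambda>y. g y u v) y)"
      by (rule linear_fd, rule smooth_on_differentiable[OF smooth]) (use y K(2) in blast)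
    from linear_field_expand[OF this, of w]
    have "\<bar>fd (\<lambda>y. g y u v) y w\<bar> = \<bar>\<Sum>b\<in>Basis. (w \<bullet> b) * fd (\<lambda>y. g y u v) y b\<bar>" by simp
    also have "\<dots> \<le> (\<Sum>b\<in>Basis. norm w * (D0 b * (norm u * norm v)))"
      by (rule order_trans[OF sum_abs], rule sum_mono)
         (auto simp: abs_mult intro!: mult_mono Basis_le_norm D0 y)
    also have "\<dots> = D * (norm u * norm v * norm w)"
      by (simp add: D_def sum_distrib_left sum_distrib_right mult_ac)
    finally show ?thesis .
  qed
  \<comment> \<open>A unit vector of the metric has squared Euclidean norm at most
    \<open>1 / c\<close>, so \<open>N\<close> bounds the sum over the frame.\<close>
  define N where "N = real DIM('a) / c"
  have N: "N \<ge> 0" using c(1) by (simp add: N_def)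
  define \<Lambda> where "\<Lambda> = max N (2 * D * N / c)"
  \<comment> \<open>The upper bound \<open>C\<close> may be 0, hence the shift by 1.\<close>
  have "elliptic_bounds (1 / (C + 1)) \<Lambda> e b"
    if y: "y \<in> K" and e: "\<forall>i\<in>Basis. \<forall>j\<in>Basis. g y (e i) (e j) = (if i = j then 1 else 0)"
      and b: "\<And>v. g y b v = christoffel_trace g y e v"
    for y b and e :: "'a \<Rightarrow> 'a"
    unfolding elliptic_bounds_def
  proof (intro conjI allI)
    note by' = bilK[OF y]
    have e': "\<And>i j. i \<in> Basis \<Longrightarrow> j \<in> Basis \<Longrightarrow> g y (e i) (e j) = (if i = j then 1 else 0)" using e by blast
    have ek: "(norm (e k))\<^sup>2 \<le> 1 / c" if "k \<in> Basis" for k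
      using c(2)[OF y, of "e k"] e'[OF that that] c(1) by (simp add: field_simps)
    have sumek: "(\<Sum>k\<in>Basis. e k \<bullet> e k) \<le> N"
      using sum_mono[of "Basis::'a set" "\<lambda>k. e k \<bullet> e k" "\<lambda>_. 1 / c"] ek
      by (simp add: N_def power2_norm_eq_inner)
    then show "(\<Sum>k\<in>Basis. e k \<bullet> e k) \<le> \<Lambda>" by (simp add: \<Lambda>_def)
    show "(1 / (C + 1)) * (norm z)\<^sup>2 \<le> (\<Sum>k\<in>Basis. (z \<bullet> e k)\<^sup>2)" for z
    proof (cases "z = 0")
      case False
      let ?s = "\<Sum>k\<in>Basis. (z \<bullet> e k)\<^sup>2"
      have "(norm z)\<^sup>2 = z \<bullet> (\<Sum>k\<in>Basis. g y (e k) z *\<^sub>R e k)"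
        by (simp add: orthonormal_family_expand(1)[OF by' e'] power2_norm_eq_inner)
      also have "\<dots> = (\<Sum>k\<in>Basis. g y (e k) z * (z \<bullet> e k))" by (simp add: inner_sum_right)
      finally have 1: "(norm z)\<^sup>2 = (\<Sum>k\<in>Basis. g y (e k) z * (z \<bullet> e k))" .
      have "((norm z)\<^sup>2)\<^sup>2 \<le> (\<Sum>k\<in>Basis. (g y (e k) z)\<^sup>2) * ?s"
        unfolding 1 by (rule Cauchy_Schwarz_ineq_sum)
      also have "(\<Sum>k\<in>Basis. (g y (e k) z)\<^sup>2) = g y z z"
        using orthonormal_parseval[OF by' e', of z z] by (simp add: power2_eq_square)
      also have "g y z z * ?s \<le> ((C + 1) * (norm z)\<^sup>2) * ?s"
      proof (intro mult_right_mono sum_nonneg)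
        have "g y z z \<le> C * (norm z)\<^sup>2" using C(2)[OF y, of z z] by (simp add: power2_eq_square abs_le_iff)
        then show "g y z z \<le> (C + 1) * (norm z)\<^sup>2" by (simp add: distrib_right add_increasing2)
      qed auto
      finally have "(norm z)\<^sup>2 * (norm z)\<^sup>2 \<le> (norm z)\<^sup>2 * ((C + 1) * ?s)"
        by (simp add: power2_eq_square mult_ac)
      then have "(norm z)\<^sup>2 \<le> (C + 1) * ?s"
        by (rule mult_left_le_imp_le) (use False in simp)
      then show ?thesis using C(1) by (simp add: field_simps)
    qed (simp add: sum_nonneg)
    \<comment> \<open>Testing the equation that characterises \<open>b\<close> with \<open>b\<close>
      itself leaves one factor \<open>norm b\<close> to cancel.\<close>
    have "c * (norm b)\<^sup>2 \<le> g y b b" by (rule c(2)[OF y])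
    also have "\<dots> \<le> (\<Sum>k\<in>Basis. 2 * D * ((e k \<bullet> e k) * norm b))"
      unfolding b christoffel_trace_def
    proof (rule sum_mono)
      fix k :: 'a
      have "\<bar>fd (\<lambda>y. g y (e k) b) y (e k)\<bar> \<le> D * ((e k \<bullet> e k) * norm b)"
        "\<bar>fd (\<lambda>y. g y (e k) (e k)) y b\<bar> \<le> D * ((e k \<bullet> e k) * norm b)"
        using Db[OF y, of "e k" b "e k"] Db[OF y, of "e k" "e k" b]
        by (simp_all add: power2_norm_eq_inner[symmetric] power2_eq_square mult_ac)
      then show "fd (\<lambda>y. g y (e k) b) y (e k) - 1/2 * fd (\<lambda>y. g y (e k) (e k)) y b \<le> 2 * D * ((e k \<bullet> e k) * norm b)"
        by linarith
    qed
    also have "\<dots> = 2 * D * norm b * (\<Sum>k\<in>Basis. e k \<bullet> e k)" by (simp add: sum_distrib_left mult_ac)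
    also have "\<dots> \<le> 2 * D * norm b * N" using sumek D by (intro mult_left_mono) auto
    finally have "norm b * (c * norm b) \<le> norm b * (2 * D * N)" by (simp add: power2_eq_square mult_ac)
    then have "norm b \<le> 2 * D * N / c"
    proof (cases "b = 0")
      case False then show ?thesis using \<open>norm b * _ \<le> _\<close> c(1) by (simp add: field_simps)
    qed (use D N c(1) in simp)
    then show "norm b \<le> \<Lambda>" by (simp add: \<Lambda>_def)
  qed
  moreover have "1 / (C + 1) > 0" using C(1) by simp
  ultimately show ?thesis by blast
qed


section \<open>Metric connections in coordinates\<close>

lemma smooth_on_bilinear_field:
  fixes B :: "'e::euclidean_space \<Rightarrow> 'a::euclidean_space \<Rightarrow> 'b::euclidean_space \<Rightarrow> 'c::real_normed_vector"
    and F :: "'d::real_normed_vector \<Rightarrow> 'e"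
  assumes "open U" "open V" "smooth_on U F" "F ` U \<subseteq> V" "\<And>y. y \<in> V \<Longrightarrow> bilinear (B y)"
    "\<And>u v. smooth_on V (\<lambda>y. B y u v)" "smooth_on U a" "smooth_on U b"
  shows "smooth_on U (\<lambda>x. B (F x) (a x) (b x))"
proof -
  have l: "linear (\<lambda>u. B (F x) u v)" "linear (B (F x) u)" if "x \<in> U" for x u v
    using assms(4,5) that by (auto simp: bilinear_def image_subset_iff)
  have "smooth_on U (\<lambda>x. B (F x) u (b x))" for u
    by (rule smooth_on_linear_field[OF assms(1) l(2) _ assms(8)])
       (auto intro!: smooth_on_compose[OF assms(1,2,4,3,6)])
  then show ?thesis
    using smooth_on_linear_field[where L="\<lambda>x u. B (F x) u (b x)", OF assms(1) l(1) _ assms(7)] by blast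
qed

lemma fd_bilinear_field:
  fixes B :: "'e::euclidean_space \<Rightarrow> 'a::euclidean_space \<Rightarrow> 'b::euclidean_space \<Rightarrow> 'c::real_normed_vector"
    and F :: "'d::real_normed_vector \<Rightarrow> 'e"
  assumes "open U" "open V" "smooth_on U F" "F ` U \<subseteq> V" "\<And>y. y \<in> V \<Longrightarrow> bilinear (B y)"
    "\<And>u v. smooth_on V (\<lambda>y. B y u v)" "smooth_on U a" "smooth_on U b" "x \<in> U"
  shows "fd (\<lambda>x. B (F x) (a x) (b x)) x v =
     fd (\<lambda>y. B y (a x) (b x)) (F x) (fd F x v) + B (F x) (fd a x v) (b x) + B (F x) (a x) (fd b x v)"
proof -
  have l: "linear (\<lambda>u. B (F x) u v)" "linear (B (F x) u)" if "x \<in> U" for x u v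
    using assms(4,5) that by (auto simp: bilinear_def image_subset_iff)
  have s: "smooth_on U (\<lambda>x. B (F x) u w)" for u w
    by (rule smooth_on_compose[OF assms(1,2,4,3,6)])
  have sb: "smooth_on U (\<lambda>x. B (F x) u (b x))" for u
    by (rule smooth_on_bilinear_field[OF assms(1-6) smooth_on_const assms(8)])
  have "fd (\<lambda>x. B (F x) (a x) (b x)) x v = fd (\<lambda>y. B (F y) (a x) (b y)) x v + B (F x) (fd a x v) (b x)"
    by (rule fd_linear_field[where L="\<lambda>x u. B (F x) u (b x)", OF assms(1,9) l(1) sb assms(7)])
  moreover have "fd (\<lambda>y. B (F y) (a x) (b y)) x v = fd (\<lambda>y. B (F y) (a x) (b x)) x v + B (F x) (a x) (fd b x v)"
    by (rule fd_linear_field[OF assms(1,9) l(2) s assms(8)])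
  moreover have "fd (\<lambda>y. B (F y) (a x) (b x)) x v = fd (\<lambda>y. B y (a x) (b x)) (F x) (fd F x v)"
    using assms(4,9) by (intro fd_compose smooth_on_differentiable[OF assms(6)] smooth_on_differentiable[OF assms(3)]) auto
  ultimately show ?thesis by (simp add: algebra_simps)
qed

locale metric_connection =
  fixes V :: "'e::euclidean_space set" and G :: "'e \<Rightarrow> 'e \<Rightarrow> 'e \<Rightarrow> real" and \<Gamma> :: "'e \<Rightarrow> 'e \<Rightarrow> 'e \<Rightarrow> 'e"
  assumes open_V: "open V"
    and G_bilinear: "y \<in> V \<Longrightarrow> bilinear (G y)"
    and G_sym: "y \<in> V \<Longrightarrow> G y u v = G y v u"
    and G_smooth: "smooth_on V (\<lambda>y. G y u v)"
    and \<Gamma>_bilinear: "y \<in> V \<Longrightarrow> bilinear (\<Gamma> y)"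
    and \<Gamma>_sym: "y \<in> V \<Longrightarrow> \<Gamma> y u v = \<Gamma> y v u"
    and \<Gamma>_smooth: "smooth_on V (\<lambda>y. \<Gamma> y u v)"
    and compat: "y \<in> V \<Longrightarrow> fd (\<lambda>y. G y v w) y u = G y (\<Gamma> y u v) w + G y v (\<Gamma> y u w)"
begin

text \<open>The chart expression in \<open>riemann\<close>, that is, R(X,Y)Z for fields with
  constant components.\<close>

definition curv :: "'e \<Rightarrow> 'e \<Rightarrow> 'e \<Rightarrow> 'e \<Rightarrow> 'e" where
  "curv y X Y Z = fd (\<lambda>y. \<Gamma> y Y Z) y X - fd (\<lambda>y. \<Gamma> y X Z) y Y + \<Gamma> y X (\<Gamma> y Y Z) - \<Gamma> y Y (\<Gamma> y X Z)"

lemma linear_\<Gamma>: "y \<in> V \<Longrightarrow> linear (\<Gamma> y u)" "y \<in> V \<Longrightarrow> linear (\<lambda>u. \<Gamma> y u v)"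
  using \<Gamma>_bilinear by (auto simp: bilinear_def)

lemma linear_fd_\<Gamma>:
  assumes "y \<in> V"
  shows "linear (fd (\<lambda>y. \<Gamma> y u v) y)" "linear (\<lambda>u. fd (\<lambda>y. \<Gamma> y u v) y w)" "linear (\<lambda>v. fd (\<lambda>y. \<Gamma> y u v) y w)"
  using linear_fd[OF smooth_on_differentiable[OF \<Gamma>_smooth assms]]
    linear_fd_field[OF open_V assms linear_\<Gamma>(2) smooth_on_differentiable[OF \<Gamma>_smooth assms]]
    linear_fd_field[OF open_V assms linear_\<Gamma>(1) smooth_on_differentiable[OF \<Gamma>_smooth assms]]
  by auto

lemma linear_curv:
  assumes "y \<in> V"
  shows "linear (\<lambda>X. curv y X Y Z)" "linear (\<lambda>Y. curv y X Y Z)" "linear (\<lambda>Z. curv y X Y Z)"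
  unfolding curv_def
  by (auto intro!: linearI simp: linear_add[OF linear_fd_\<Gamma>(1)] linear_add[OF linear_fd_\<Gamma>(2)] linear_add[OF linear_fd_\<Gamma>(3)]
       linear_scale[OF linear_fd_\<Gamma>(1)] linear_scale[OF linear_fd_\<Gamma>(2)] linear_scale[OF linear_fd_\<Gamma>(3)]
       linear_add[OF linear_\<Gamma>(1)] linear_add[OF linear_\<Gamma>(2)] linear_scale[OF linear_\<Gamma>(1)] linear_scale[OF linear_\<Gamma>(2)]
       assms algebra_simps)

lemma bianchi:
  assumes "y \<in> V"
  shows "curv y X Y Z + curv y Y Z X + curv y Z X Y = 0"
proof -
  have s: "fd (\<lambda>y. \<Gamma> y u v) y w = fd (\<lambda>y. \<Gamma> y v u) y w" for u v w
    using fd_cong[OF open_V assms smooth_on_differentiable[OF \<Gamma>_smooth[of u v] assms], of "\<lambda>y. \<Gamma> y v u"] \<Gamma>_sym by simp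
  show ?thesis
    unfolding curv_def using s[of Y Z X] s[of X Z Y] s[of X Y Z] \<Gamma>_sym[OF assms, of Y Z] \<Gamma>_sym[OF assms, of X Z]
      \<Gamma>_sym[OF assms, of X Y] by simp
qed

end

text \<open>The pullback connection along \<open>F\<close>. One development serves three maps: the
  immersion read in charts, the identity of \<open>V\<close>, which gives the ordinary connection,
  and the transition maps between charts.\<close>

locale connection_along = metric_connection V G \<Gamma>
  for V :: "'e::euclidean_space set" and G :: "'e \<Rightarrow> 'e \<Rightarrow> 'e \<Rightarrow> real" and \<Gamma> :: "'e \<Rightarrow> 'e \<Rightarrow> 'e \<Rightarrow> 'e" +
  fixes U :: "'d::euclidean_space set" and F :: "'d \<Rightarrow> 'e"
  assumes open_U: "open U" and F_smooth: "smooth_on U F" and F_maps: "F ` U \<subseteq> V"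
begin

definition cov :: "'d \<Rightarrow> ('d \<Rightarrow> 'e) \<Rightarrow> 'd \<Rightarrow> 'e" where
  "cov v W x = fd W x v + \<Gamma> (F x) (fd F x v) (W x)"

lemma F_in: "x \<in> U \<Longrightarrow> F x \<in> V" using F_maps by auto

lemma smooth_G: "smooth_on U a \<Longrightarrow> smooth_on U b \<Longrightarrow> smooth_on U (\<lambda>x. G (F x) (a x) (b x))"
  by (rule smooth_on_bilinear_field[OF open_U open_V F_smooth F_maps G_bilinear G_smooth])

lemma smooth_dF: "smooth_on U (\<lambda>x. fd F x v)"
  by (rule smooth_on_fd[OF F_smooth])

lemma smooth_cov: "smooth_on U W \<Longrightarrow> smooth_on U (cov v W)"
  unfolding cov_def[abs_def]
  by (intro smooth_on_add open_U smooth_on_fd smooth_dF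
      smooth_on_bilinear_field[OF open_U open_V F_smooth F_maps \<Gamma>_bilinear \<Gamma>_smooth])

lemma fd_G:
  assumes "smooth_on U a" "smooth_on U b" "x \<in> U"
  shows "fd (\<lambda>x. G (F x) (a x) (b x)) x v = G (F x) (cov v a x) (b x) + G (F x) (a x) (cov v b x)"
  by (simp add: fd_bilinear_field[OF open_U open_V F_smooth F_maps G_bilinear G_smooth assms]
      compat[OF F_in[OF assms(3)]] cov_def bilinear_ladd[OF G_bilinear[OF F_in[OF assms(3)]]]
      bilinear_radd[OF G_bilinear[OF F_in[OF assms(3)]]])

lemma torsion_free: "x \<in> U \<Longrightarrow> cov u (\<lambda>x. fd F x v) x = cov v (\<lambda>x. fd F x u) x"
  using fd_commute[OF open_U _ F_smooth, of x u v] \<Gamma>_sym[OF F_in, of x "fd F x u" "fd F x v"] by (simp add: cov_def)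

text \<open>Curvature as the commutator of pulled back derivatives. The directions \<open>u\<close>
  and \<open>v\<close> are constant, so there is no bracket term, and the second derivatives of
  \<open>W\<close> and of \<open>F\<close> cancel by symmetry.\<close>

lemma cov_commute:
  assumes W: "smooth_on U W" and x: "x \<in> U"
  shows "cov u (cov v W) x = cov v (cov u W) x + curv (F x) (fd F x u) (fd F x v) (W x)"
proof -
  have e: "cov u (cov v W) x = fd (\<lambda>x. fd W x v) x u + fd (\<lambda>y. \<Gamma> y (fd F x v) (W x)) (F x) (fd F x u)
      + \<Gamma> (F x) (fd (\<lambda>x. fd F x v) x u) (W x) + \<Gamma> (F x) (fd F x v) (fd W x u)
      + \<Gamma> (F x) (fd F x u) (fd W x v) + \<Gamma> (F x) (fd F x u) (\<Gamma> (F x) (fd F x v) (W x))" for u v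
  proof -
    have s: "smooth_on U (\<lambda>x. \<Gamma> (F x) (fd F x v) (W x))"
      by (rule smooth_on_bilinear_field[OF open_U open_V F_smooth F_maps \<Gamma>_bilinear \<Gamma>_smooth smooth_dF W])
    have "fd (cov v W) x u = fd (\<lambda>x. fd W x v) x u + fd (\<lambda>x. \<Gamma> (F x) (fd F x v) (W x)) x u"
      unfolding cov_def[abs_def]
      by (subst fd_eq[OF has_derivative_add[OF fd_works[OF smooth_on_differentiable[OF smooth_on_fd[OF W] x]]
            fd_works[OF smooth_on_differentiable[OF s x]]]]) simp
    then show ?thesis
      by (simp add: cov_def[of u "cov v W"] cov_def[of v W]
          fd_bilinear_field[OF open_U open_V F_smooth F_maps \<Gamma>_bilinear \<Gamma>_smooth smooth_dF W x]
          linear_add[OF linear_\<Gamma>(1)[OF F_in[OF x]]])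
  qed
  show ?thesis
    unfolding e curv_def using fd_commute[OF open_U x W, of u v] fd_commute[OF open_U x F_smooth, of u v] by simp
qed

end

context metric_connection begin

interpretation id: connection_along V G \<Gamma> V "\<lambda>x. x"
  by unfold_locales (auto simp: open_V smooth_on_ident)

text \<open>Second derivatives of the function \<open>G y Z Z\<close> commute by
  \<open>fd_commute\<close>. The products of first covariant derivatives are symmetric in the two
  directions, so only the curvature term is left, and it must vanish.\<close>

lemma curv_skew:
  assumes y: "y \<in> V"
  shows "G y (curv y X Y Z) Z = 0"
proof -
  have Z: "smooth_on V (\<lambda>_. Z)" by (rule smooth_on_const)
  have 1: "fd (\<lambda>y. G y Z Z) y v = 2 * G y (id.cov v (\<lambda>_. Z) y) Z" if "y \<in> V" for y v
    using id.fd_G[OF Z Z that] G_sym[OF that, of Z] by simp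
  have 2: "fd (\<lambda>y. fd (\<lambda>y. G y Z Z) y v) y u = 2 * (G y (id.cov u (id.cov v (\<lambda>_. Z)) y) Z
      + G y (id.cov v (\<lambda>_. Z) y) (id.cov u (\<lambda>_. Z) y))" for u v
  proof -
    have s: "smooth_on V (\<lambda>y. G y (id.cov v (\<lambda>_. Z) y) Z)" by (intro id.smooth_G id.smooth_cov Z)
    have "((\<lambda>y. fd (\<lambda>y. G y Z Z) y v) has_derivative (\<lambda>u. 2 * fd (\<lambda>y. G y (id.cov v (\<lambda>_. Z) y) Z) y u)) (at y)"
      by (rule has_derivative_transform_within_open[OF _ open_V y, of "\<lambda>y. 2 * G y (id.cov v (\<lambda>_. Z) y) Z"])
         (auto simp: 1 intro!: has_derivative_mult_right fd_works smooth_on_differentiable[OF s y])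
    then show ?thesis using fd_eq id.fd_G[OF id.smooth_cov[OF Z] Z y] by fastforce
  qed
  have "G y (id.cov X (id.cov Y (\<lambda>_. Z)) y) Z = G y (id.cov Y (id.cov X (\<lambda>_. Z)) y) Z"
    using fd_commute[OF open_V y G_smooth[of Z Z], of Y X] G_sym[OF y, of "id.cov X (\<lambda>_. Z) y"]
    by (simp add: 2)
  then show ?thesis using id.cov_commute[OF Z y, of X Y] by (simp add: bilinear_ladd[OF G_bilinear[OF y]])
qed

lemma curv_parallel:
  assumes \<xi>: "smooth_on V \<xi>" and par: "\<And>y v. y \<in> V \<Longrightarrow> fd \<xi> y v + \<Gamma> y v (\<xi> y) = 0" and y: "y \<in> V"
  shows "curv y X Y (\<xi> y) = 0"
proof -
  have 0: "id.cov v \<xi> y = 0" if "y \<in> V" for y v using par[OF that] by (simp add: id.cov_def)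
  have "id.cov u (id.cov v \<xi>) y = 0" for u v
  proof -
    have "fd (id.cov v \<xi>) y = fd (\<lambda>_. 0) y"
      by (rule fd_cong[OF open_V y, symmetric, THEN sym]) (auto simp: 0)
    then show ?thesis by (simp add: id.cov_def[of u "id.cov v \<xi>"] 0[OF y] linear_0[OF linear_\<Gamma>(1)[OF y]])
  qed
  then show ?thesis using id.cov_commute[OF \<xi> y, of X Y] by simp
qed

text \<open>Bianchi turns \<open>X \<mapsto> R(X,\<xi>)Z\<close> into the skew map \<open>X \<mapsto> R(Z,\<xi>)X\<close>.\<close>

lemma curv_parallel_skew:
  assumes \<xi>: "smooth_on V \<xi>" and par: "\<And>y v. y \<in> V \<Longrightarrow> fd \<xi> y v + \<Gamma> y v (\<xi> y) = 0" and y: "y \<in> V"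
  shows "G y (curv y X (\<xi> y) Z) X = 0"
proof -
  have anti: "curv y X Y Z = - curv y Y X Z" for X Y Z by (simp add: curv_def)
  have "curv y X (\<xi> y) Z = curv y Z (\<xi> y) X"
    using bianchi[OF y, of X "\<xi> y" Z] curv_parallel[OF assms, of Z X] anti[of "\<xi> y" Z X] by simp
  then show ?thesis using curv_skew[OF y] by simp
qed

end

section \<open>The Laplacian of the normal component of a parallel field\<close>

text \<open>All that the Laplacian computation needs from one pair of charts. \<open>S\<close> is
  the shape operator in coordinates, with the sign of A X = -(derivative of N along X), and \<kappa>
  its constant trace.\<close>

locale spacelike_patch = connection_along V G \<Gamma> U F
  for V :: "'e::euclidean_space set" and G :: "'e \<Rightarrow> 'e \<Rightarrow> 'e \<Rightarrow> real" and \<Gamma> :: "'e \<Rightarrow> 'e \<Rightarrow> 'e \<Rightarrow> 'e"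
    and U :: "'d::euclidean_space set" and F :: "'d \<Rightarrow> 'e" +
  fixes \<xi> :: "'e \<Rightarrow> 'e" and N :: "'d \<Rightarrow> 'e" and S :: "'d \<Rightarrow> 'd \<Rightarrow> 'd" and \<kappa> :: real
  assumes codim: "DIM('e) = DIM('d) + 1"
    and \<xi>_smooth: "smooth_on V \<xi>" and \<xi>_parallel: "y \<in> V \<Longrightarrow> fd \<xi> y v + \<Gamma> y v (\<xi> y) = 0"
    and N_smooth: "smooth_on U N"
    and N_normal: "x \<in> U \<Longrightarrow> G (F x) (N x) (fd F x u) = 0"
    and N_unit: "x \<in> U \<Longrightarrow> G (F x) (N x) (N x) = -1"
    and spacelike: "x \<in> U \<Longrightarrow> u \<noteq> 0 \<Longrightarrow> G (F x) (fd F x u) (fd F x u) > 0"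
    and S_linear: "x \<in> U \<Longrightarrow> linear (S x)" and S_smooth: "smooth_on U (\<lambda>x. S x u)"
    and S_eq: "x \<in> U \<Longrightarrow> cov u N x = - fd F x (S x u)"
    and S_trace: "x \<in> U \<Longrightarrow> (\<Sum>b\<in>Basis. S x b \<bullet> b) = \<kappa>"
begin

definition metr :: "'d \<Rightarrow> 'd \<Rightarrow> 'd \<Rightarrow> real" where
  "metr x u v = G (F x) (fd F x u) (fd F x v)"

definition height :: "'d \<Rightarrow> real" where
  "height x = G (F x) (N x) (\<xi> (F x))"

text \<open>The full ambient derivative of a coordinate field: its normal part carries the second
  fundamental form, its tangential part the induced connection. The latter does not vanish at the
  point considered and has to cancel in the sums below.\<close>

abbreviation sff :: "'d \<Rightarrow> 'd \<Rightarrow> 'd \<Rightarrow> 'e" where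
  "sff x u v \<equiv> cov u (\<lambda>x. fd F x v) x"

lemma linear_dF: "x \<in> U \<Longrightarrow> linear (fd F x)"
  by (rule linear_fd[OF smooth_on_differentiable[OF F_smooth]])

lemma metr_bilinear: "x \<in> U \<Longrightarrow> bilinear (metr x)"
  unfolding bilinear_def metr_def
  by (auto intro!: linearI simp: linear_add[OF linear_dF] linear_scale[OF linear_dF]
      bilinear_ladd[OF G_bilinear[OF F_in]] bilinear_radd[OF G_bilinear[OF F_in]]
      bilinear_lmul[OF G_bilinear[OF F_in]] bilinear_rmul[OF G_bilinear[OF F_in]])

lemma metr_sym: "x \<in> U \<Longrightarrow> metr x u v = metr x v u"
  unfolding metr_def by (rule G_sym[OF F_in])

lemma metr_smooth: "smooth_on U (\<lambda>x. metr x u v)"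
  unfolding metr_def by (intro smooth_G smooth_dF)

lemma fd_metr: "x \<in> U \<Longrightarrow> fd (\<lambda>x. metr x u v) x t = G (F x) (sff x t u) (fd F x v) + G (F x) (fd F x u) (sff x t v)"
  unfolding metr_def by (rule fd_G[OF smooth_dF smooth_dF])

lemma smooth_\<xi>F: "smooth_on U (\<lambda>x. \<xi> (F x))"
  by (rule smooth_on_compose[OF open_U open_V F_maps F_smooth \<xi>_smooth])

lemma cov_\<xi>F: "x \<in> U \<Longrightarrow> cov v (\<lambda>x. \<xi> (F x)) x = 0"
  using fd_compose[OF smooth_on_differentiable[OF \<xi>_smooth F_in] smooth_on_differentiable[OF F_smooth], of x v]
    \<xi>_parallel[OF F_in, of x "fd F x v"] by (simp add: cov_def)

lemma fd_height: "x \<in> U \<Longrightarrow> fd height x v = G (F x) (cov v N x) (\<xi> (F x))"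
  unfolding height_def[abs_def]
  by (simp add: fd_G[OF N_smooth smooth_\<xi>F] cov_\<xi>F bilinear_rzero[OF G_bilinear[OF F_in]])

lemma height_smooth: "smooth_on U height"
  unfolding height_def[abs_def] by (intro smooth_G N_smooth smooth_\<xi>F)

lemma fd2_height:
  assumes "x \<in> U" shows "fd (\<lambda>x. fd height x v) x u = G (F x) (cov u (cov v N) x) (\<xi> (F x))"
proof -
  have "fd (\<lambda>x. fd height x v) x = fd (\<lambda>x. G (F x) (cov v N x) (\<xi> (F x))) x"
    by (rule fd_cong[OF open_U assms])
       (auto simp: fd_height intro!: smooth_on_differentiable[OF smooth_G assms] smooth_cov N_smooth smooth_\<xi>F)
  then show ?thesis
    by (simp add: fd_G[OF smooth_cov[OF N_smooth] smooth_\<xi>F assms] cov_\<xi>F assms bilinear_rzero[OF G_bilinear[OF F_in]])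
qed

lemma cov_N_normal: "x \<in> U \<Longrightarrow> G (F x) (cov u N x) (N x) = 0"
  using N_normal[of x "S x u"] G_sym[OF F_in, of x "N x"] by (simp add: S_eq bilinear_lneg[OF G_bilinear[OF F_in]])

text \<open>The source of the |A|^2 term: the derivative of N is tangential, and differentiating
  this orthogonality moves one derivative onto the second factor.\<close>

lemma cov_cov_N_normal:
  assumes "x \<in> U" shows "G (F x) (cov u (cov v N) x) (N x) = - G (F x) (cov v N x) (cov u N x)"
proof -
  have "fd (\<lambda>x. G (F x) (cov v N x) (N x)) x = fd (\<lambda>_. 0) x"
    by (rule fd_cong[OF open_U assms]) (auto simp: cov_N_normal)
  then show ?thesis using fd_G[OF smooth_cov[OF N_smooth, of v] N_smooth assms, of u] by simp
qed

lemma cov_N_dF: "x \<in> U \<Longrightarrow> G (F x) (cov u N x) (fd F x v) = - G (F x) (N x) (sff x u v)"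
proof -
  assume x: "x \<in> U"
  have "fd (\<lambda>x. G (F x) (N x) (fd F x v)) x = fd (\<lambda>_. 0) x"
    by (rule fd_cong[OF open_U x]) (auto simp: N_normal)
  then show ?thesis using fd_G[OF N_smooth smooth_dF x, of v u] by simp
qed

lemma cov_N_dF_sym: "x \<in> U \<Longrightarrow> G (F x) (cov u N x) (fd F x v) = G (F x) (cov v N x) (fd F x u)"
  by (simp add: cov_N_dF torsion_free[of x u v])

lemma cov_N_metr: "x \<in> U \<Longrightarrow> G (F x) (cov u N x) (fd F x v) = - metr x (S x u) v"
  by (simp add: S_eq metr_def bilinear_lneg[OF G_bilinear[OF F_in]])

lemma S_self_adjoint: "x \<in> U \<Longrightarrow> metr x (S x u) v = metr x (S x v) u"
  using cov_N_dF_sym[of x u v] by (simp add: cov_N_metr)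

text \<open>The Codazzi equation before taking the trace. It arises from differentiating the
  symmetry of the second fundamental form, \<open>cov_N_dF_sym\<close>, along \<open>e\<close> and
  commuting the two derivatives of \<open>N\<close>.\<close>

lemma cov_cov_N_dF:
  assumes x: "x \<in> U"
  shows "G (F x) (cov e (cov e N) x) (fd F x t) + G (F x) (cov e N x) (sff x e t)
     = G (F x) (cov t (cov e N) x) (fd F x e) + G (F x) (curv (F x) (fd F x e) (fd F x t) (N x)) (fd F x e)
       + G (F x) (cov t N x) (sff x e e)"
proof -
  have "fd (\<lambda>x. G (F x) (cov e N x) (fd F x t)) x = fd (\<lambda>x. G (F x) (cov t N x) (fd F x e)) x"
    by (rule fd_cong[OF open_U x])
       (auto simp: cov_N_dF_sym[of _ e t] intro!: smooth_on_differentiable[OF smooth_G x] smooth_cov N_smooth smooth_dF)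
  from fun_cong[OF this, of e] show ?thesis
    by (simp add: fd_G[OF smooth_cov[OF N_smooth] smooth_dF x] cov_commute[OF N_smooth x, of e t]
        bilinear_ladd[OF G_bilinear[OF F_in[OF x]]])
qed

section \<open>Traced identities in a frame that is orthonormal at one point\<close>

context
  fixes x :: 'd and e :: "'d \<Rightarrow> 'd"
  assumes x: "x \<in> U"
    and e: "\<And>i j. i \<in> Basis \<Longrightarrow> j \<in> Basis \<Longrightarrow> metr x (e i) (e j) = (if i = j then 1 else 0)"
begin

private lemmas bilG = G_bilinear[OF F_in[OF x]]

text \<open>The tangent vectors \<open>e\<^sub>k\<close> and the unit normal form a pseudo-orthonormal frame; the index \<open>None\<close>
  stands for the normal.\<close>

lemma frame:
  fixes h :: "'d option \<Rightarrow> 'z::comm_monoid_add"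
  defines "I \<equiv> insert None (Some ` (Basis :: 'd set))"
    and "E \<equiv> \<lambda>i. case i of None \<Rightarrow> N x | Some k \<Rightarrow> fd F x (e k)"
    and "\<phi> \<equiv> \<lambda>i z. case i of None \<Rightarrow> - G (F x) (N x) z | Some k \<Rightarrow> G (F x) (fd F x (e k)) z"
  shows "finite I" "card I = DIM('e)" "i \<in> I \<Longrightarrow> linear (\<phi> i)"
    "i \<in> I \<Longrightarrow> j \<in> I \<Longrightarrow> \<phi> i (E j) = (if i = j then 1 else 0)"
    "(\<Sum>i\<in>I. h i) = h None + (\<Sum>k\<in>Basis. h (Some k))"
proof -
  show "finite I" by (simp add: I_def)
  show "card I = DIM('e)" by (simp add: I_def card_image codim)
  have l: "linear (G (F x) z)" for z using bilG by (simp add: bilinear_def)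
  show "linear (\<phi> i)" if "i \<in> I"
    by (cases i) (auto simp: \<phi>_def l intro!: linear_compose_neg)
  show "\<phi> i (E j) = (if i = j then 1 else 0)" if "i \<in> I" "j \<in> I"
    using that e G_sym[OF F_in[OF x], of "fd F x (e _)" "N x"]
    by (auto simp: I_def \<phi>_def E_def N_normal[OF x] N_unit[OF x] simp flip: metr_def split: option.splits)
  show "(\<Sum>i\<in>I. h i) = h None + (\<Sum>k\<in>Basis. h (Some k))"
    by (simp add: I_def sum.reindex)
qed

lemma frame_expand: "z = (\<Sum>k\<in>Basis. G (F x) (fd F x (e k)) z *\<^sub>R fd F x (e k)) - G (F x) (N x) z *\<^sub>R N x"
  using dual_family_expand[OF frame(1-4), of z] unfolding frame(5) by simp

lemma frame_trace:
  "linear T \<Longrightarrow> (\<Sum>b\<in>Basis. T b \<bullet> b) = (\<Sum>k\<in>Basis. G (F x) (fd F x (e k)) (T (fd F x (e k)))) - G (F x) (N x) (T (N x))"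
  using trace_dual_family[OF _ frame(1-4), of T] unfolding frame(5) by simp

text \<open>This is the traced Codazzi equation, and the only place where the constant mean curvature is used.\<close>

lemma codazzi_trace:
  "(\<Sum>k\<in>Basis. G (F x) (cov t (cov (e k) N) x) (fd F x (e k))) = (\<Sum>k\<in>Basis. G (F x) (cov (e k) N x) (sff x t (e k)))"
proof -
  define S' where "S' v = fd (\<lambda>x. S x v) x t" for v
  have lS': "linear S'" unfolding S'_def
    by (rule linear_fd_field[OF open_U x S_linear smooth_on_differentiable[OF S_smooth x]])
  \<comment> \<open>The coordinate trace of \<open>S\<close> is the constant \<kappa>, so its
    derivative \<open>S'\<close> has coordinate trace 0. The trace being basis independent, the
    frame at \<open>x\<close> may replace the coordinate basis.\<close>
  have trS': "(\<Sum>k\<in>Basis. metr x (e k) (S' (e k))) = 0"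
  proof -
    have "((\<lambda>x. \<Sum>b\<in>Basis. S x b \<bullet> b) has_derivative (\<lambda>t. \<Sum>b\<in>Basis. fd (\<lambda>x. S x b) x t \<bullet> b)) (at x)"
      by (intro has_derivative_sum has_derivative_inner_left fd_works smooth_on_differentiable[OF S_smooth x])
    moreover have "((\<lambda>x. \<Sum>b\<in>Basis. S x b \<bullet> b) has_derivative (\<lambda>t. 0)) (at x)"
      by (rule has_derivative_transform_within_open[OF _ open_U x, of "\<lambda>_. \<kappa>"]) (auto simp: S_trace)
    ultimately have "(\<lambda>t. \<Sum>b\<in>Basis. fd (\<lambda>x. S x b) x t \<bullet> b) = (\<lambda>t. 0)"
      by (rule has_derivative_unique)
    then have "(\<Sum>b\<in>Basis. S' b \<bullet> b) = 0" unfolding S'_def by (rule fun_cong)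
    then show ?thesis using orthonormal_family_expand(2)[OF metr_bilinear[OF x] e lS'] by simp
  qed
  have d: "G (F x) (cov t (cov v N) x) (fd F x v) + G (F x) (cov v N x) (sff x t v) =
     - (G (F x) (sff x t (S x v)) (fd F x v) + G (F x) (fd F x (S x v)) (sff x t v) + metr x v (S' v))" for v
  proof -
    have "fd (\<lambda>x. G (F x) (cov v N x) (fd F x v)) x t = fd (\<lambda>x. - metr x (S x v) v) x t"
      by (rule fd_cong[OF open_U x, THEN fun_cong, symmetric])
         (auto simp: cov_N_metr intro!: smooth_on_differentiable[OF smooth_G x] smooth_cov N_smooth smooth_dF)
    also have "\<dots> = - fd (\<lambda>x. metr x (S x v) v) x t"
    proof -
      have "smooth_on U (\<lambda>x. metr x (S x v) v)"
        by (rule smooth_on_linear_field[OF open_U _ metr_smooth S_smooth]) (use metr_bilinear in \<open>simp add: bilinear_def\<close>)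
      from fd_eq[OF has_derivative_minus[OF fd_works[OF smooth_on_differentiable[OF this x]]]]
      show ?thesis by simp
    qed
    also have "fd (\<lambda>x. metr x (S x v) v) x t = fd (\<lambda>y. metr y (S x v) v) x t + metr x (S' v) v"
      unfolding S'_def
      by (rule fd_linear_field[OF open_U x _ metr_smooth S_smooth]) (use metr_bilinear in \<open>simp add: bilinear_def\<close>)
    finally show ?thesis
      by (simp add: fd_G[OF smooth_cov[OF N_smooth] smooth_dF x] fd_metr[OF x] metr_sym[OF x, of "S' v"])
  qed
  have l1: "linear (\<lambda>v. G (F x) (sff x t v) z)" for z
  proof -
    have "linear (\<lambda>v. sff x t v)"
    proof -
      \<comment> \<open>Linearity is evident in the direction of differentiation; torsion-freeness
        transfers it to the other slot.\<close>
      have "linear (\<lambda>v. cov v (\<lambda>x. fd F x t) x)"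
        unfolding cov_def
        by (rule linearI)
           (simp_all add: linear_add[OF linear_fd[OF smooth_on_differentiable[OF smooth_dF x]]]
            linear_scale[OF linear_fd[OF smooth_on_differentiable[OF smooth_dF x]]]
            linear_add[OF linear_dF[OF x]] linear_scale[OF linear_dF[OF x]]
            linear_add[OF linear_\<Gamma>(2)[OF F_in[OF x]]] linear_scale[OF linear_\<Gamma>(2)[OF F_in[OF x]]] scaleR_add_right)
      then show ?thesis by (simp add: torsion_free[OF x, of t])
    qed
    from linear_compose[OF this, of "\<lambda>y. G (F x) y z"] bilG show ?thesis by (simp add: bilinear_def o_def)
  qed
  \<comment> \<open>Both sides become double sums over the frame once \<open>S x (e k)\<close> is
    expanded. Self-adjointness makes the matrix of \<open>S\<close> symmetric, so exchanging the
    summation indices identifies them.\<close>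
  have swap: "(\<Sum>k\<in>Basis. G (F x) (sff x t (S x (e k))) (fd F x (e k))) =
     (\<Sum>k\<in>Basis. G (F x) (fd F x (S x (e k))) (sff x t (e k)))"
  proof -
    note ex = orthonormal_family_expand(1)[OF metr_bilinear[OF x] e]
    have A: "G (F x) (sff x t (S x (e k))) (fd F x (e k)) =
       (\<Sum>l\<in>Basis. metr x (e l) (S x (e k)) * G (F x) (sff x t (e l)) (fd F x (e k)))" for k
      using linear_sum[OF l1[of "fd F x (e k)"], of "\<lambda>l. metr x (e l) (S x (e k)) *\<^sub>R e l" Basis] ex[of "S x (e k)"]
      by (simp add: linear_scale[OF l1])
    have B: "G (F x) (fd F x (S x (e k))) (sff x t (e k)) =
       (\<Sum>l\<in>Basis. metr x (e l) (S x (e k)) * G (F x) (sff x t (e k)) (fd F x (e l)))" for k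
    proof -
      have l: "linear (\<lambda>u. G (F x) (sff x t (e k)) (fd F x u))"
        using linear_compose[OF linear_dF[OF x], of "G (F x) (sff x t (e k))"] bilG by (simp add: bilinear_def o_def)
      show ?thesis
        using linear_sum[OF l, of "\<lambda>l. metr x (e l) (S x (e k)) *\<^sub>R e l" Basis] ex[of "S x (e k)"]
        by (simp add: linear_scale[OF l] G_sym[OF F_in[OF x], of "fd F x (S x (e k))"])
    qed
    have C: "metr x (e l) (S x (e k)) = metr x (e k) (S x (e l))" for k l
      using S_self_adjoint[OF x, of "e k" "e l"] metr_sym[OF x] by simp
    show ?thesis
      unfolding A B by (subst sum.swap) (simp add: C)
  qed
  have neg: "G (F x) (cov v N x) z = - G (F x) (fd F x (S x v)) z" for v z
    by (simp add: S_eq[OF x] bilinear_lneg[OF bilG])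
  \<comment> \<open>Both terms in which the derivative falls on \<open>dF\<close> are equal by
    \<open>swap\<close>, and each is the negative of the second sum on the left by
    \<open>neg\<close>. So the right side is twice that second sum.\<close>
  have "(\<Sum>k\<in>Basis. G (F x) (cov t (cov (e k) N) x) (fd F x (e k)) + G (F x) (cov (e k) N x) (sff x t (e k))) =
     - ((\<Sum>k\<in>Basis. G (F x) (fd F x (S x (e k))) (sff x t (e k))) + (\<Sum>k\<in>Basis. G (F x) (fd F x (S x (e k))) (sff x t (e k))) + 0)"
    unfolding d sum_negf sum.distrib swap trS' ..
  then show ?thesis by (simp add: sum.distrib sum_subtractf neg sum_negf)
qed

text \<open>The full trace has one more term, for the normal direction. It vanishes because R(N,Y)
  is skew, so the sum over tangent vectors is already the Ricci trace.\<close>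

lemma trace_curv_tangent:
  "(\<Sum>k\<in>Basis. G (F x) (curv (F x) (fd F x (e k)) Y (N x)) (fd F x (e k))) = (\<Sum>b\<in>Basis. curv (F x) b Y (N x) \<bullet> b)"
  using frame_trace[OF linear_curv(1)[OF F_in[OF x], of Y "N x"]] curv_skew[OF F_in[OF x], of "N x" Y "N x"]
  by (simp add: G_sym[OF F_in[OF x]])

text \<open>As \<xi> is parallel, derivatives of the height fall on \<open>N\<close> only. Splitting
  \<xi> gives |A|^2 from the normal part, curvature from the tangential part by the untraced and
  traced Codazzi identities, and a first-order remainder that cancels against the drift.\<close>

lemma laplacian_height:
  assumes b: "\<And>v. metr x b v = christoffel_trace metr x e v"
  shows "frame_laplacian e b height x =
     height x * ((\<Sum>k\<in>Basis. G (F x) (cov (e k) N x) (cov (e k) N x)) + (\<Sum>b\<in>Basis. curv (F x) b (N x) (N x) \<bullet> b))"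
proof -
  note Fx = F_in[OF x]
  define \<tau> where "\<tau> = (\<Sum>k\<in>Basis. G (F x) (fd F x (e k)) (\<xi> (F x)) *\<^sub>R e k)"
  have \<xi>: "\<xi> (F x) = fd F x \<tau> - height x *\<^sub>R N x"
    using frame_expand[of "\<xi> (F x)"]
    by (simp add: \<tau>_def height_def linear_sum[OF linear_dF[OF x]] linear_scale[OF linear_dF[OF x]])
  have ric: "(\<Sum>b\<in>Basis. curv (F x) b (fd F x \<tau>) (N x) \<bullet> b) = height x * (\<Sum>b\<in>Basis. curv (F x) b (N x) (N x) \<bullet> b)"
  proof -
    have "(\<Sum>b\<in>Basis. curv (F x) b (\<xi> (F x)) (N x) \<bullet> b) = 0"
      using trace_curv_tangent[of "\<xi> (F x)"] curv_parallel_skew[OF \<xi>_smooth \<xi>_parallel Fx] by simp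
    then show ?thesis
      unfolding \<xi> by (simp add: linear_diff[OF linear_curv(2)[OF Fx]] linear_scale[OF linear_curv(2)[OF Fx]]
          inner_diff_left sum_subtractf sum_distrib_left)
  qed
  \<comment> \<open>The vector \<open>b\<close> represents the tangential part of the sum of
    \<open>sff x (e k) (e k)\<close>. Self-adjointness of \<open>S\<close> exchanges \<tau> and
    \<open>b\<close>, which turns the pairing into the derivative of the height along
    \<open>b\<close>.\<close>
  have first_order: "(\<Sum>k\<in>Basis. G (F x) (cov \<tau> N x) (sff x (e k) (e k))) = fd height x b"
  proof -
    have "metr x b v = (\<Sum>k\<in>Basis. G (F x) (sff x (e k) (e k)) (fd F x v))" for v
    proof -
      have "fd (\<lambda>y. metr y (e k) v) x (e k) - 1/2 * fd (\<lambda>y. metr y (e k) (e k)) x v = G (F x) (sff x (e k) (e k)) (fd F x v)" for k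
        using G_sym[OF Fx, of "sff x v (e k)" "fd F x (e k)"] torsion_free[OF x, of v "e k"]
        by (simp add: fd_metr[OF x])
      then show ?thesis unfolding b christoffel_trace_def by simp
    qed
    then have "(\<Sum>k\<in>Basis. G (F x) (cov \<tau> N x) (sff x (e k) (e k))) = - metr x b (S x \<tau>)"
      by (simp add: S_eq[OF x] bilinear_lneg[OF bilG] sum_negf G_sym[OF Fx, of "fd F x (S x \<tau>)"])
    also have "\<dots> = - metr x (S x b) \<tau>"
      using S_self_adjoint[OF x, of b \<tau>] metr_sym[OF x, of b] by simp
    also have "\<dots> = G (F x) (cov b N x) (\<xi> (F x))"
      by (simp add: \<xi> bilinear_rsub[OF bilG] bilinear_rmul[OF bilG] cov_N_normal[OF x] cov_N_metr[OF x])
    finally show ?thesis by (simp add: fd_height[OF x])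
  qed
  have "(\<Sum>k\<in>Basis. fd (\<lambda>y. fd height y (e k)) x (e k)) =
     (\<Sum>k\<in>Basis. G (F x) (cov (e k) (cov (e k) N) x) (fd F x \<tau>)) + height x * (\<Sum>k\<in>Basis. G (F x) (cov (e k) N x) (cov (e k) N x))"
    by (simp add: fd2_height[OF x] \<xi> bilinear_rsub[OF bilG] bilinear_rmul[OF bilG] cov_cov_N_normal[OF x]
        sum.distrib sum_distrib_left)
  also have "(\<Sum>k\<in>Basis. G (F x) (cov (e k) (cov (e k) N) x) (fd F x \<tau>)) =
     (\<Sum>k\<in>Basis. G (F x) (curv (F x) (fd F x (e k)) (fd F x \<tau>) (N x)) (fd F x (e k))) +
     (\<Sum>k\<in>Basis. G (F x) (cov \<tau> N x) (sff x (e k) (e k)))"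
  proof -
    \<comment> \<open>By torsion-freeness the mixed term is the sum in \<open>codazzi_trace\<close>;
      that lemma cancels it against the third derivative pairing along \<tau>.\<close>
    have "(\<Sum>k\<in>Basis. G (F x) (cov (e k) (cov (e k) N) x) (fd F x \<tau>)) + (\<Sum>k\<in>Basis. G (F x) (cov (e k) N x) (sff x \<tau> (e k))) =
       (\<Sum>k\<in>Basis. G (F x) (cov \<tau> (cov (e k) N) x) (fd F x (e k))) +
       (\<Sum>k\<in>Basis. G (F x) (curv (F x) (fd F x (e k)) (fd F x \<tau>) (N x)) (fd F x (e k))) +
       (\<Sum>k\<in>Basis. G (F x) (cov \<tau> N x) (sff x (e k) (e k)))"
      using cov_cov_N_dF[OF x, of "e _" \<tau>] by (simp add: torsion_free[OF x, of \<tau>] flip: sum.distrib)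
    then show ?thesis using codazzi_trace[of \<tau>] by simp
  qed
  finally show ?thesis
    by (simp add: frame_laplacian_def first_order trace_curv_tangent ric algebra_simps)
qed

end

end


section \<open>Charts and tangent vectors\<close>

definition crange :: "('m, 'e) chart \<Rightarrow> 'e set" where
  "crange c = cmap c ` cdom c"

locale atlas =
  fixes A :: "('m::{t2_space, second_countable_topology}, 'e::euclidean_space) chart set"
  assumes smooth_atlas: "smooth_atlas A"
begin

lemma chart_homeo: "c \<in> A \<Longrightarrow> homeomorphism (cdom c) (crange c) (cmap c) (cinv c)"
  using smooth_atlas by (auto simp: smooth_atlas_def is_chart_def crange_def)

lemma open_cdom: "c \<in> A \<Longrightarrow> open (cdom c)"
  using smooth_atlas by (auto simp: smooth_atlas_def is_chart_def)

lemma open_crange: "c \<in> A \<Longrightarrow> open (crange c)"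
  using smooth_atlas by (auto simp: smooth_atlas_def is_chart_def crange_def)

lemma cinv_cmap: "c \<in> A \<Longrightarrow> p \<in> cdom c \<Longrightarrow> cinv c (cmap c p) = p"
  using chart_homeo by (auto simp: homeomorphism_def)

lemma cmap_cinv: "c \<in> A \<Longrightarrow> x \<in> crange c \<Longrightarrow> cmap c (cinv c x) = x"
  using chart_homeo by (auto simp: homeomorphism_def)

lemma cinv_in: "c \<in> A \<Longrightarrow> x \<in> crange c \<Longrightarrow> cinv c x \<in> cdom c"
  using chart_homeo[of c] unfolding homeomorphism_def by blast

lemma cmap_in: "p \<in> cdom c \<Longrightarrow> cmap c p \<in> crange c"
  by (auto simp: crange_def)

lemma chart_image_eq: "c \<in> A \<Longrightarrow> cmap c ` (cdom c \<inter> W) = crange c \<inter> cinv c -` W"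
proof (intro equalityI subsetI)
  assume c: "c \<in> A"
  show "x \<in> crange c \<inter> cinv c -` W" if "x \<in> cmap c ` (cdom c \<inter> W)" for x
    using that cinv_cmap[OF c] by (auto simp: cmap_in)
  show "x \<in> cmap c ` (cdom c \<inter> W)" if "x \<in> crange c \<inter> cinv c -` W" for x
    using that cinv_in[OF c, of x] cmap_cinv[OF c, of x] by (intro image_eqI[of _ _ "cinv c x"]) simp_all
qed

lemma chart_preimage_eq: "c \<in> A \<Longrightarrow> W \<subseteq> crange c \<Longrightarrow> cinv c ` W = cdom c \<inter> cmap c -` W"
proof -
  assume c: "c \<in> A" "W \<subseteq> crange c"
  have "p \<in> cinv c ` W" if "p \<in> cdom c" "cmap c p \<in> W" for p
    using that cinv_cmap[OF c(1) that(1)] by (metis imageI)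
  then show ?thesis using c cinv_in[OF c(1)] cmap_cinv[OF c(1)] by auto
qed

lemma open_chart_image: "c \<in> A \<Longrightarrow> open W \<Longrightarrow> open (cmap c ` (cdom c \<inter> W))"
  using continuous_open_preimage[of "crange c" "cinv c" W] chart_homeo[of c] open_crange
  by (simp add: chart_image_eq homeomorphism_def)

lemma open_chart_preimage: "c \<in> A \<Longrightarrow> open W \<Longrightarrow> W \<subseteq> crange c \<Longrightarrow> open (cinv c ` W)"
  using continuous_open_preimage[of "cdom c" "cmap c" W] chart_homeo[of c] open_cdom
  by (simp add: chart_preimage_eq homeomorphism_def)

definition trans :: "('m, 'e) chart \<Rightarrow> ('m, 'e) chart \<Rightarrow> 'e \<Rightarrow> 'e" where
  "trans c d x = cmap d (cinv c x)"

definition overlap :: "('m, 'e) chart \<Rightarrow> ('m, 'e) chart \<Rightarrow> 'e set" where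
  "overlap c d = cmap c ` (cdom c \<inter> cdom d)"

lemma trans_eq: "cmap d \<circ> cinv c = trans c d"
  by (auto simp: trans_def)

lemma open_overlap: "c \<in> A \<Longrightarrow> d \<in> A \<Longrightarrow> open (overlap c d)"
  unfolding overlap_def by (rule open_chart_image[OF _ open_cdom])

lemma overlap_in: "p \<in> cdom c \<Longrightarrow> p \<in> cdom d \<Longrightarrow> cmap c p \<in> overlap c d"
  by (auto simp: overlap_def)

lemma trans_smooth: "c \<in> A \<Longrightarrow> d \<in> A \<Longrightarrow> smooth_on (overlap c d) (trans c d)"
  using smooth_atlas unfolding smooth_atlas_def overlap_def trans_eq[symmetric] by blast

lemma trans_differentiable: "c \<in> A \<Longrightarrow> d \<in> A \<Longrightarrow> p \<in> cdom c \<Longrightarrow> p \<in> cdom d \<Longrightarrow> trans c d differentiable (at (cmap c p))"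
  by (rule smooth_on_differentiable[OF trans_smooth overlap_in])

lemma trans_cmap: "c \<in> A \<Longrightarrow> p \<in> cdom c \<Longrightarrow> trans c d (cmap c p) = cmap d p"
  by (simp add: trans_def cinv_cmap)

lemma linear_fd_trans: "c \<in> A \<Longrightarrow> d \<in> A \<Longrightarrow> p \<in> cdom c \<Longrightarrow> p \<in> cdom d \<Longrightarrow> linear (fd (trans c d) (cmap c p))"
  by (rule linear_fd[OF trans_differentiable])

text \<open>The chain rule for one function on the manifold read in two charts. Differentiability is
  transferred too, since \<open>fd\<close> has no meaning without it.\<close>

lemma fd_change_chart:
  assumes c: "c \<in> A" "d \<in> A" "p \<in> cdom c" "p \<in> cdom d"
    and h: "(\<lambda>x. h (cinv d x)) differentiable (at (cmap d p))"
  shows "fd (\<lambda>x. h (cinv c x)) (cmap c p) u = fd (\<lambda>x. h (cinv d x)) (cmap d p) (fd (trans c d) (cmap c p) u)"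
    and "(\<lambda>x. h (cinv c x)) differentiable (at (cmap c p))"
proof -
  have dif: "(\<lambda>x. h (cinv d (trans c d x))) differentiable (at (cmap c p))"
    using differentiable_chain_at[OF trans_differentiable[OF c], of "\<lambda>x. h (cinv d x)"] h
    by (simp add: o_def trans_cmap c)
  have eq: "h (cinv d (trans c d x)) = h (cinv c x)" if "x \<in> overlap c d" for x
    using that c by (auto simp: overlap_def trans_cmap cinv_cmap)
  note op = open_overlap[OF c(1,2)] overlap_in[OF c(3,4)]
  show "(\<lambda>x. h (cinv c x)) differentiable (at (cmap c p))"
    by (rule differentiable_cong[OF op dif eq])
  have "fd (\<lambda>x. h (cinv c x)) (cmap c p) = fd (\<lambda>x. h (cinv d (trans c d x))) (cmap c p)"
    by (rule fd_cong[OF op dif eq])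
  then show "fd (\<lambda>x. h (cinv c x)) (cmap c p) u = fd (\<lambda>x. h (cinv d x)) (cmap d p) (fd (trans c d) (cmap c p) u)"
    using fd_compose[of "\<lambda>x. h (cinv d x)" "trans c d" "cmap c p" u] h trans_differentiable[OF c]
    by (simp add: trans_cmap c)
qed

lemma fd_trans_trans:
  assumes "c \<in> A" "d \<in> A" "e \<in> A" "p \<in> cdom c" "p \<in> cdom d" "p \<in> cdom e"
  shows "fd (trans c e) (cmap c p) u = fd (trans d e) (cmap d p) (fd (trans c d) (cmap c p) u)"
  using fd_change_chart(1)[of c d p "cmap e" u] trans_differentiable[of d e p] assms
  by (simp add: trans_def[abs_def])

lemma fd_trans_refl:
  assumes "c \<in> A" "p \<in> cdom c"
  shows "fd (trans c c) (cmap c p) u = u"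
  using fd_cong[OF open_crange[OF assms(1)] cmap_in[OF assms(2)], of "\<lambda>x. x" "trans c c"]
  by (simp add: trans_def cmap_cinv assms)

lemma fd_trans_inverse:
  assumes "c \<in> A" "d \<in> A" "p \<in> cdom c" "p \<in> cdom d"
  shows "fd (trans d c) (cmap d p) (fd (trans c d) (cmap c p) u) = u"
  using fd_trans_trans[of c d c p u] fd_trans_refl[of c p u] assms by simp

lemma charts_at_iff: "c \<in> charts_at A p \<longleftrightarrow> c \<in> A \<and> p \<in> cdom c"
  by (simp add: charts_at_def)

lemma chart_at_in: "chart_at A p \<in> A" "p \<in> cdom (chart_at A p)"
proof -
  have "p \<in> (\<Union>c\<in>A. cdom c)" using smooth_atlas unfolding smooth_atlas_def by simp
  then have "\<exists>c. c \<in> charts_at A p" unfolding charts_at_def by blast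
  then have "chart_at A p \<in> charts_at A p" unfolding chart_at_def by (rule someI_ex)
  then show "chart_at A p \<in> A" "p \<in> cdom (chart_at A p)" by (auto simp: charts_at_def)
qed

lemma tangent_space_iff: "v \<in> tangent_space A p \<longleftrightarrow>
    (\<forall>c d. c \<in> A \<longrightarrow> p \<in> cdom c \<longrightarrow> d \<in> A \<longrightarrow> p \<in> cdom d \<longrightarrow> v d = fd (trans c d) (cmap c p) (v c)) \<and>
    (\<forall>c. c \<notin> charts_at A p \<longrightarrow> v c = 0)"
  unfolding tangent_space_def trans_eq charts_at_def mem_Collect_eq Ball_def by blast

lemma tangent_change: "v \<in> tangent_space A p \<Longrightarrow> c \<in> A \<Longrightarrow> p \<in> cdom c \<Longrightarrow> d \<in> A \<Longrightarrow> p \<in> cdom d \<Longrightarrow>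
    v d = fd (trans c d) (cmap c p) (v c)"
  unfolding tangent_space_iff by blast

lemma tangent_zero: "v \<in> tangent_space A p \<Longrightarrow> c \<notin> charts_at A p \<Longrightarrow> v c = 0"
  unfolding tangent_space_iff by blast

lemma tvec_of_at: "c \<in> A \<Longrightarrow> p \<in> cdom c \<Longrightarrow> tvec_of A c p u c = u"
  by (simp add: tvec_of_def trans_eq charts_at_iff fd_trans_refl)

lemma tvec_of_other: "d \<in> A \<Longrightarrow> p \<in> cdom d \<Longrightarrow> tvec_of A c p u d = fd (trans c d) (cmap c p) u"
  by (simp add: tvec_of_def trans_eq charts_at_iff)

lemma tvec_of_in: "c \<in> A \<Longrightarrow> p \<in> cdom c \<Longrightarrow> tvec_of A c p u \<in> tangent_space A p"
proof -
  assume c: "c \<in> A" "p \<in> cdom c"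
  have "tvec_of A c p u e = fd (trans d e) (cmap d p) (tvec_of A c p u d)"
    if "d \<in> A" "p \<in> cdom d" "e \<in> A" "p \<in> cdom e" for d e
    unfolding tvec_of_other[OF that(1,2)] tvec_of_other[OF that(3,4)]
    by (rule fd_trans_trans[OF c(1) that(1,3) c(2) that(2,4)])
  moreover have "tvec_of A c p u d = 0" if "d \<notin> charts_at A p" for d using that by (simp add: tvec_of_def)
  ultimately show ?thesis unfolding tangent_space_iff by blast
qed

lemma tvec_of_eq:
  assumes v: "v \<in> tangent_space A p" and c: "c \<in> A" "p \<in> cdom c"
  shows "tvec_of A c p (v c) = v"
proof
  fix d show "tvec_of A c p (v c) d = v d"
  proof (cases "d \<in> charts_at A p")
    case True then show ?thesis
      using tangent_change[OF v c, of d] by (simp add: tvec_of_other charts_at_iff)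
  next
    case False then show ?thesis using tangent_zero[OF v] by (simp add: tvec_of_def)
  qed
qed

lemma tangent_eqI:
  "v \<in> tangent_space A p \<Longrightarrow> w \<in> tangent_space A p \<Longrightarrow> c \<in> A \<Longrightarrow> p \<in> cdom c \<Longrightarrow> v c = w c \<Longrightarrow> v = w"
  by (metis tvec_of_eq)

lemma zero_in_tangent_space: "(\<lambda>_. 0) \<in> tangent_space A p"
  unfolding tangent_space_iff by (metis linear_0 linear_fd_trans)

lemma minus_in_tangent_space:
  assumes "v \<in> tangent_space A p" shows "(\<lambda>d. - v d) \<in> tangent_space A p"
proof -
  have "- v d = fd (trans c d) (cmap c p) (- v c)" if "c \<in> A" "p \<in> cdom c" "d \<in> A" "p \<in> cdom d" for c d
    unfolding linear_neg[OF linear_fd_trans[OF that(1,3,2,4)]] tangent_change[OF assms that] ..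
  moreover have "- v d = 0" if "d \<notin> charts_at A p" for d using tangent_zero[OF assms that] by simp
  ultimately show ?thesis unfolding tangent_space_iff by blast
qed

lemma tvec_of_change:
  assumes "c \<in> A" "p \<in> cdom c" "d \<in> A" "p \<in> cdom d"
  shows "tvec_of A c p u = tvec_of A d p (fd (trans c d) (cmap c p) u)"
  by (rule tangent_eqI[of _ p _ d]) (use assms in \<open>simp_all add: tvec_of_in tvec_of_at tvec_of_other\<close>)

end

section \<open>The Levi-Civita connection in a chart\<close>

text \<open>The predicate under the description operator in \<open>christoffel\<close>, detached
  from charts so that existence and uniqueness can be proved in a vector space.\<close>

definition levi_civita_at :: "('e::euclidean_space \<Rightarrow> 'e \<Rightarrow> 'e \<Rightarrow> real) \<Rightarrow> 'e \<Rightarrow> ('e \<Rightarrow> 'e \<Rightarrow> 'e) \<Rightarrow> bool" where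
  "levi_civita_at G x \<Gamma> \<longleftrightarrow> bilinear \<Gamma> \<and> (\<forall>u v. \<Gamma> u v = \<Gamma> v u) \<and>
     (\<forall>u v w. fd (\<lambda>y. G y v w) x u = G x (\<Gamma> u v) w + G x v (\<Gamma> u w))"

text \<open>Nondegeneracy replaces any signature condition, so that the ambient Lorentzian metric
  and the induced Riemannian metric are both instances.\<close>

locale metric_chart =
  fixes V :: "'e::euclidean_space set" and G :: "'e \<Rightarrow> 'e \<Rightarrow> 'e \<Rightarrow> real"
  assumes open_V: "open V"
    and G_bilinear: "y \<in> V \<Longrightarrow> bilinear (G y)"
    and G_sym: "y \<in> V \<Longrightarrow> G y u v = G y v u"
    and G_smooth: "smooth_on V (\<lambda>y. G y u v)"
    and nondegenerate: "y \<in> V \<Longrightarrow> (\<And>v. G y u v = 0) \<Longrightarrow> u = 0"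
begin

lemma G_eqI: "y \<in> V \<Longrightarrow> (\<And>w. G y u w = G y v w) \<Longrightarrow> u = v"
  using nondegenerate[of y "u - v"] by (simp add: bilinear_lsub[OF G_bilinear])

text \<open>The Koszul formula for the inner product of \<open>\<Gamma> u v\<close> with
  \<open>w\<close>. Coordinate fields commute, so the three bracket terms are absent.\<close>

definition koszul :: "'e \<Rightarrow> 'e \<Rightarrow> 'e \<Rightarrow> 'e \<Rightarrow> real" where
  "koszul y u v w = (fd (\<lambda>y. G y v w) y u + fd (\<lambda>y. G y u w) y v - fd (\<lambda>y. G y u v) y w) / 2"

lemma fd_G_sym: "y \<in> V \<Longrightarrow> fd (\<lambda>y. G y u v) y = fd (\<lambda>y. G y v u) y"
  by (rule fd_cong[OF open_V]) (auto simp: G_sym intro: smooth_on_differentiable[OF G_smooth])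

lemma levi_civita_koszul:
  assumes "y \<in> V" "levi_civita_at G y \<Gamma>"
  shows "G y (\<Gamma> u v) w = koszul y u v w"
proof -
  have c: "fd (\<lambda>y. G y v w) y u = G y (\<Gamma> u v) w + G y v (\<Gamma> u w)" for u v w
    using assms(2) by (simp add: levi_civita_at_def)
  have s: "\<Gamma> u v = \<Gamma> v u" for u v using assms(2) by (simp add: levi_civita_at_def)
  show ?thesis
    unfolding koszul_def c using s[of v u] s[of w u] s[of w v] G_sym[OF assms(1), of u] G_sym[OF assms(1), of v] by simp
qed

lemma G_fd_linear:
  assumes "y \<in> V"
  shows "linear (fd (\<lambda>y. G y u v) y)" "linear (\<lambda>u. fd (\<lambda>y. G y u v) y w)" "linear (\<lambda>v. fd (\<lambda>y. G y u v) y w)"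
  using linear_fd[OF smooth_on_differentiable[OF G_smooth assms]]
    linear_fd_field[OF open_V assms, of "\<lambda>y u. G y u v"] linear_fd_field[OF open_V assms, of "\<lambda>y. G y u"]
    smooth_on_differentiable[OF G_smooth assms] G_bilinear
  by (auto simp: bilinear_def)

lemma koszul_linear:
  assumes "y \<in> V"
  shows "linear (koszul y u v)" "linear (\<lambda>u. koszul y u v w)" "linear (\<lambda>v. koszul y u v w)"
  unfolding koszul_def[abs_def]
  by (auto intro!: linearI simp: linear_add[OF G_fd_linear(1)] linear_add[OF G_fd_linear(2)] linear_add[OF G_fd_linear(3)]
       linear_scale[OF G_fd_linear(1)] linear_scale[OF G_fd_linear(2)] linear_scale[OF G_fd_linear(3)] assms field_simps)

text \<open>The musical isomorphism, with a covector stored as the vector of its values on the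
  basis. This makes the Koszul formula a linear system for the Christoffel symbols.\<close>

definition flat :: "'e \<Rightarrow> 'e \<Rightarrow> 'e" where
  "flat y z = (\<Sum>b\<in>Basis. G y z b *\<^sub>R b)"

lemma flat_inner: "b \<in> Basis \<Longrightarrow> flat y z \<bullet> b = G y z b"
  by (simp add: flat_def)

lemma linear_flat: "y \<in> V \<Longrightarrow> linear (flat y)"
  unfolding flat_def
  by (rule linearI) (simp_all add: bilinear_ladd[OF G_bilinear] bilinear_lmul[OF G_bilinear] scaleR_add_left sum.distrib scaleR_sum_right)

lemma inj_flat:
  assumes "y \<in> V" shows "inj (flat y)"
proof (rule injI)
  fix z z' assume "flat y z = flat y z'"
  then have "G y z b = G y z' b" if "b \<in> Basis" for b using that flat_inner by metis
  moreover have "linear (G y z)" for z using G_bilinear[OF assms] by (simp add: bilinear_def)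
  ultimately have "G y z w = G y z' w" for w
    using linear_field_expand[of "G y z" w] linear_field_expand[of "G y z'" w] by simp
  then show "z = z'" using G_eqI[OF assms] by blast
qed

text \<open>Besides the existence of the Christoffel symbols it later provides the drift vector
  \<open>b\<close> that represents \<open>christoffel_trace\<close>.\<close>

lemma riesz:
  assumes y: "y \<in> V" and \<phi>: "linear \<phi>"
  shows "\<exists>b. \<forall>v. G y b v = \<phi> v"
proof -
  have "surj (flat y)" by (rule linear_injective_imp_surjective[OF linear_flat[OF y] inj_flat[OF y] refl])
  then obtain b where b: "flat y b = (\<Sum>i\<in>Basis. \<phi> i *\<^sub>R i)" by (metis surjD)
  have "G y b i = \<phi> i" if "i \<in> Basis" for i
    using flat_inner[OF that, of y b] that by (simp add: b)
  moreover have "linear (G y b)" using G_bilinear[OF y] by (simp add: bilinear_def)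
  ultimately have "G y b v = \<phi> v" for v
    using linear_field_expand[of "G y b" v] linear_field_expand[OF \<phi>, of v] by simp
  then show ?thesis by blast
qed

lemma levi_civita_unique:
  "y \<in> V \<Longrightarrow> levi_civita_at G y \<Gamma> \<Longrightarrow> levi_civita_at G y \<Gamma>' \<Longrightarrow> \<Gamma> = \<Gamma>'"
  by (intro ext G_eqI[of y]) (simp_all add: levi_civita_koszul)

lemma levi_civita_exists:
  assumes y: "y \<in> V" shows "\<exists>\<Gamma>. levi_civita_at G y \<Gamma>"
proof -
  have "\<exists>z. \<forall>w. G y z w = koszul y u v w" for u v by (rule riesz[OF y koszul_linear(1)[OF y]])
  then obtain \<Gamma> where k: "\<And>u v w. G y (\<Gamma> u v) w = koszul y u v w" by metis
  have "bilinear \<Gamma>"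
    unfolding bilinear_def
    by (intro conjI allI linearI; rule G_eqI[OF y])
       (simp_all add: bilinear_ladd[OF G_bilinear[OF y]] bilinear_lmul[OF G_bilinear[OF y]] k
        linear_add[OF koszul_linear(2)[OF y]] linear_add[OF koszul_linear(3)[OF y]]
        linear_scale[OF koszul_linear(2)[OF y]] linear_scale[OF koszul_linear(3)[OF y]])
  moreover have "\<Gamma> u v = \<Gamma> v u" for u v
    by (rule G_eqI[OF y]) (simp add: k koszul_def fd_G_sym[OF y, of u v])
  moreover have "fd (\<lambda>y. G y v w) y u = G y (\<Gamma> u v) w + G y v (\<Gamma> u w)" for u v w
    unfolding G_sym[OF y, of v] k koszul_def by (simp add: fd_G_sym[OF y, of w v] field_simps)
  ultimately show ?thesis unfolding levi_civita_at_def by blast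
qed

definition chr :: "'e \<Rightarrow> 'e \<Rightarrow> 'e \<Rightarrow> 'e" where
  "chr y = (THE \<Gamma>. levi_civita_at G y \<Gamma>)"

lemma levi_civita_chr: "y \<in> V \<Longrightarrow> levi_civita_at G y (chr y)"
proof -
  assume y: "y \<in> V"
  have "\<exists>!\<Gamma>. levi_civita_at G y \<Gamma>"
    by (rule ex_ex1I[OF levi_civita_exists[OF y]]) (rule levi_civita_unique[OF y])
  then show ?thesis unfolding chr_def by (rule theI')
qed

lemma chr_smooth: "smooth_on V (\<lambda>y. chr y u v)"
proof (rule smooth_on_solution[OF open_V linear_flat inj_flat])
  show "smooth_on V (\<lambda>y. flat y z)" for z
    unfolding flat_def by (intro smooth_on_sum smooth_on_scaleR open_V G_smooth smooth_on_const)
  have "smooth_on V (\<lambda>y. koszul y u v b)" for b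
    unfolding koszul_def
    by (intro smooth_on_bounded_linear[OF bounded_linear_divide] smooth_on_diff smooth_on_add open_V smooth_on_fd G_smooth)
  then show "smooth_on V (\<lambda>y. \<Sum>b\<in>Basis. koszul y u v b *\<^sub>R b)"
    by (intro smooth_on_sum smooth_on_scaleR open_V smooth_on_const)
  show "flat y (chr y u v) = (\<Sum>b\<in>Basis. koszul y u v b *\<^sub>R b)" if "y \<in> V" for y
    using levi_civita_koszul[OF that levi_civita_chr[OF that]] by (simp add: flat_def)
qed

sublocale metric_connection V G chr
proof
  fix y u v w
  assume "y \<in> V"
  note lc = levi_civita_chr[OF this, unfolded levi_civita_at_def]
  show "bilinear (chr y)" using lc by blast
  show "chr y u v = chr y v u" using lc by blast
  show "fd (\<lambda>y. G y v w) y u = G y (chr y u v) w + G y v (chr y u w)" using lc by blast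
qed (fact open_V G_bilinear G_sym G_smooth chr_smooth)+

end

text \<open>Both sides have the same inner products with all vectors, by the Koszul formula in the two charts.\<close>

lemma christoffel_transform:
  assumes "metric_chart V G" "metric_chart V' G'" and W: "open W" "W \<subseteq> V" and \<Phi>: "smooth_on W \<Phi>" "\<Phi> ` W \<subseteq> V'"
    and iso: "\<And>y u v. y \<in> W \<Longrightarrow> G y u v = G' (\<Phi> y) (fd \<Phi> y u) (fd \<Phi> y v)"
    and x: "x \<in> W" and surj: "surj (fd \<Phi> x)"
  shows "fd \<Phi> x (metric_chart.chr G x u v) = fd (\<lambda>y. fd \<Phi> y v) x u + metric_chart.chr G' (\<Phi> x) (fd \<Phi> x u) (fd \<Phi> x v)"
proof -
  interpret M: metric_chart V G by fact
  interpret M': metric_chart V' G' by fact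
  interpret C: connection_along V' G' M'.chr W \<Phi> by unfold_locales (fact W \<Phi>)+
  have xV: "x \<in> V" "\<Phi> x \<in> V'" using x W \<Phi> by auto
  \<comment> \<open>The pulled back derivative of the pushed forward coordinate field. It satisfies
    the Koszul formula of \<open>G\<close> after pairing with pushed forward vectors, and these are
    all vectors by surjectivity.\<close>
  let ?s = "\<lambda>u v. C.cov u (\<lambda>x. fd \<Phi> x v) x"
  have d: "fd (\<lambda>y. G y v w) x u = G' (\<Phi> x) (?s u v) (fd \<Phi> x w) + G' (\<Phi> x) (fd \<Phi> x v) (?s u w)" for u v w
  proof -
    have "fd (\<lambda>y. G y v w) x = fd (\<lambda>y. G' (\<Phi> y) (fd \<Phi> y v) (fd \<Phi> y w)) x"
      by (rule fd_cong[OF W(1) x, symmetric, THEN sym])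
         (auto simp: iso intro!: smooth_on_differentiable[OF C.smooth_G x] C.smooth_dF)
    then show ?thesis by (simp add: C.fd_G[OF C.smooth_dF C.smooth_dF x])
  qed
  have k: "G' (\<Phi> x) (?s u v) (fd \<Phi> x w) = M.koszul x u v w" for w
    unfolding M.koszul_def d
    using C.torsion_free[OF x, of v u] C.torsion_free[OF x, of w u] C.torsion_free[OF x, of w v]
      M'.G_sym[OF xV(2), of "fd \<Phi> x u" "?s v w"] M'.G_sym[OF xV(2), of "fd \<Phi> x v" "?s u w"] by simp
  have "G' (\<Phi> x) (?s u v) (fd \<Phi> x w) = G' (\<Phi> x) (fd \<Phi> x (M.chr x u v)) (fd \<Phi> x w)" for w
    unfolding k using M.levi_civita_koszul[OF xV(1) M.levi_civita_chr[OF xV(1)], of u v w] iso[OF x] by simp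
  then have "G' (\<Phi> x) (?s u v) w = G' (\<Phi> x) (fd \<Phi> x (M.chr x u v)) w" for w
    using surjD[OF surj, of w] by blast
  then have "?s u v = fd \<Phi> x (M.chr x u v)" by (rule M'.G_eqI[OF xV(2)])
  then show ?thesis by (simp add: C.cov_def)
qed


section \<open>The unit normal of a spacelike hyperplane\<close>

lemma smooth_on_Pair:
  fixes a :: "'x::real_normed_vector \<Rightarrow> 'a::euclidean_space" and b :: "'x \<Rightarrow> 'b::euclidean_space"
  assumes "open S" "smooth_on S a" "smooth_on S b"
  shows "smooth_on S (\<lambda>x. (a x, b x))"
proof -
  have "bounded_linear (\<lambda>z :: 'a. (z, 0 :: 'b))" "bounded_linear (\<lambda>z :: 'b. (0 :: 'a, z))"
    by (intro bounded_linear_Pair bounded_linear_ident bounded_linear_zero)+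
  from smooth_on_add[OF assms(1) smooth_on_bounded_linear[OF this(1) assms(1,2)] smooth_on_bounded_linear[OF this(2) assms(1,3)]]
  show ?thesis by simp
qed

locale spacelike_hyperplane =
  fixes G :: "'e::euclidean_space \<Rightarrow> 'e \<Rightarrow> real" and D :: "'d::euclidean_space \<Rightarrow> 'e" and \<xi> :: 'e
  assumes bil: "bilinear G" and sym: "G u v = G v u" and nondeg: "(\<And>v. G u v = 0) \<Longrightarrow> u = 0"
    and timelike: "\<exists>t. G t t < 0"
    and lin: "linear D" and pos: "a \<noteq> 0 \<Longrightarrow> G (D a) (D a) > 0" and codim: "DIM('e) = DIM('d) + 1"
    and null: "G \<xi> \<xi> = 0" and \<xi>_nz: "\<xi> \<noteq> 0"
begin

lemma lin_G: "linear (G z)" "linear (\<lambda>u. G u z)"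
  using bil by (auto simp: bilinear_def)

text \<open>The image of \<open>D\<close> has codimension one, so adjoining one transversal vector
  fills the space. It is applied with \<xi> and with the normal direction as that vector.\<close>

lemma surj_sum:
  assumes "\<And>u s. D u + s *\<^sub>R z = 0 \<Longrightarrow> u = 0 \<and> s = 0"
  shows "\<exists>u s. y = D u + s *\<^sub>R z"
proof -
  let ?M = "\<lambda>(u, s). D u + s *\<^sub>R z"
  have l: "linear ?M"
    by (rule linearI) (auto simp: linear_add[OF lin] linear_scale[OF lin] algebra_simps)
  have "inj ?M"
    unfolding linear_injective_0[OF l] using assms by (auto simp: zero_prod_def)
  then have "surj ?M"
    by (rule linear_injective_imp_surjective[OF l]) (simp add: codim)
  then obtain w where "y = ?M w" by (metis surjD)
  then show ?thesis by (cases w) auto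
qed

text \<open>The normal direction is the solution of the linear system \<open>G z (D u) = 0\<close>, \<open>G z \<xi> = 1\<close>; this is
  why the unit normal depends smoothly on the point.\<close>

definition pairing :: "'e \<Rightarrow> 'd \<times> real" where
  "pairing z = (\<Sum>b\<in>Basis. G z (D b) *\<^sub>R b, G z \<xi>)"

lemma linear_pairing: "linear pairing"
  unfolding pairing_def
  by (rule linearI) (simp_all add: bilinear_ladd[OF bil] bilinear_lmul[OF bil] scaleR_add_left sum.distrib scaleR_sum_right)

lemma pairing_eqD:
  assumes "pairing z = (0, s)"
  shows "G z (D u) = 0" "G z \<xi> = s"
proof -
  have "(\<Sum>b\<in>Basis. G z (D b) *\<^sub>R b) = 0" using assms by (simp add: pairing_def)
  then have "G z (D b) = 0" if "b \<in> Basis" for b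
    using that inner_sum_left_Basis[OF that, of "\<lambda>b. G z (D b)"] by simp
  then show "G z (D u) = 0"
    using linear_field_expand[OF linear_compose[OF lin lin_G(1)], of z u] by simp
  show "G z \<xi> = s" using assms by (simp add: pairing_def)
qed

lemma pairing_eqI: "(\<And>u. G z (D u) = 0) \<Longrightarrow> G z \<xi> = s \<Longrightarrow> pairing z = (0, s)"
  by (simp add: pairing_def)

text \<open>A null vector cannot lie in a spacelike hyperplane, so \<xi> is transversal and together
  with the hyperplane spans everything. A vector orthogonal to both is then zero by
  nondegeneracy.\<close>

lemma inj_pairing: "inj pairing"
  unfolding linear_injective_0[OF linear_pairing]
proof (intro allI impI)
  fix z assume "pairing z = 0"
  then have z: "G z (D u) = 0" "G z \<xi> = 0" for u
    using pairing_eqD[of z 0] by (auto simp: zero_prod_def)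
  show "z = 0"
  proof (rule nondeg)
    fix y
    have "\<exists>u s. y = D u + s *\<^sub>R \<xi>"
    proof (rule surj_sum)
      fix u s assume us: "D u + s *\<^sub>R \<xi> = 0"
      then have "D u = - (s *\<^sub>R \<xi>)" by (simp add: eq_neg_iff_add_eq_0)
      then have "G (D u) (D u) = 0"
        by (simp add: bilinear_lneg[OF bil] bilinear_rneg[OF bil] bilinear_lmul[OF bil] bilinear_rmul[OF bil] null)
      then have "u = 0" using pos[of u] by force
      then show "u = 0 \<and> s = 0" using us \<xi>_nz by (simp add: linear_0[OF lin])
    qed
    then show "G z y = 0" using z by (auto simp: bilinear_radd[OF bil] bilinear_rmul[OF bil])
  qed
qed

definition nu :: 'e where "nu = (SOME z. pairing z = (0, 1))"

lemma nu: "pairing nu = (0, 1)"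
proof -
  have "surj pairing"
    by (rule linear_injective_imp_surjective[OF linear_pairing inj_pairing]) (simp add: codim)
  then have "\<exists>z. pairing z = (0, 1)" by (metis surjD)
  then show ?thesis unfolding nu_def by (rule someI_ex)
qed

lemma decompose_nu: "\<exists>u s. y = D u + s *\<^sub>R nu"
proof (rule surj_sum)
  fix u s assume us: "D u + s *\<^sub>R nu = 0"
  have "G (D u + s *\<^sub>R nu) (D u) = G (D u) (D u)"
    using pairing_eqD(1)[OF nu] by (simp add: bilinear_ladd[OF bil] bilinear_lmul[OF bil])
  then have "G (D u) (D u) = 0" using us by (simp add: bilinear_lzero[OF bil])
  then have "u = 0" using pos[of u] by force
  moreover have "nu \<noteq> 0" using pairing_eqD(2)[OF nu] by (auto simp: bilinear_lzero[OF bil])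
  ultimately show "u = 0 \<and> s = 0" using us by (simp add: linear_0[OF lin])
qed

text \<open>Every vector is a sum of orthogonal components along the hyperplane and along
  \<open>nu\<close>. If \<open>nu\<close> were not timelike, no vector could be, contrary to the
  signature.\<close>

lemma nu_timelike: "G nu nu < 0"
proof (rule ccontr)
  assume "\<not> G nu nu < 0"
  then have n: "G nu nu \<ge> 0" by simp
  obtain t where t: "G t t < 0" using timelike by blast
  obtain u s where us: "t = D u + s *\<^sub>R nu" using decompose_nu by blast
  have "G t t = G (D u) (D u) + s * s * G nu nu"
    using pairing_eqD(1)[OF nu, of u] sym[of "D u" nu]
    by (simp add: us bilinear_ladd[OF bil] bilinear_radd[OF bil] bilinear_lmul[OF bil] bilinear_rmul[OF bil])
  moreover have "G (D u) (D u) \<ge> 0" using pos[of u] by (cases "u = 0") (auto simp: linear_0[OF lin] bilinear_lzero[OF bil])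
  moreover have "s * s * G nu nu \<ge> 0" using n by simp
  ultimately show False using t by linarith
qed

definition normal :: 'e where "normal = (1 / sqrt (- G nu nu)) *\<^sub>R nu"

lemma normal: "G normal (D u) = 0" "G normal normal = -1" "G normal \<xi> > 0"
proof -
  show "G normal (D u) = 0" using pairing_eqD(1)[OF nu] by (simp add: normal_def bilinear_lmul[OF bil])
  have "sqrt (- G nu nu) * sqrt (- G nu nu) = - G nu nu" using nu_timelike by simp
  then show "G normal normal = -1"
    using nu_timelike by (simp add: normal_def bilinear_lmul[OF bil] bilinear_rmul[OF bil])
  show "G normal \<xi> > 0"
    using nu_timelike pairing_eqD(2)[OF nu] by (simp add: normal_def bilinear_lmul[OF bil])
qed

text \<open>Division by the positive number \<open>G z \<xi>\<close> brings \<open>z\<close> to the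
  normalisation of \<open>nu\<close>. The condition \<open>G z z = -1\<close> then determines this
  number up to sign, and positivity fixes the sign.\<close>

lemma normal_unique:
  assumes "\<And>u. G z (D u) = 0" "G z z = -1" "G z \<xi> > 0"
  shows "z = normal"
proof -
  let ?a = "G z \<xi>"
  have "pairing ((1 / ?a) *\<^sub>R z) = (0, 1)"
    using assms by (intro pairing_eqI) (simp_all add: bilinear_lmul[OF bil])
  then have "(1 / ?a) *\<^sub>R z = nu" using inj_pairing nu by (metis injD)
  then have z: "z = ?a *\<^sub>R nu" using assms(3) by (metis divide_self_if less_irrefl scaleR_one scaleR_scaleR times_divide_eq_right mult.right_neutral)
  then have "?a * ?a * G nu nu = -1"
    using assms(2) by (metis bilinear_lmul[OF bil] bilinear_rmul[OF bil] mult.assoc real_scaleR_def)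
  then have "- G nu nu = (1 / ?a)\<^sup>2" using assms(3) by (simp add: field_simps power2_eq_square)
  then have "sqrt (- G nu nu) = 1 / ?a" using assms(3) by (simp add: real_sqrt_unique)
  then show ?thesis using z by (simp add: normal_def)
qed

lemma normal_complement:
  assumes "G z normal = 0"
  shows "\<exists>u. z = D u"
proof -
  obtain u s where us: "z = D u + s *\<^sub>R nu" using decompose_nu by blast
  have "G z nu = 0" using assms nu_timelike by (simp add: normal_def bilinear_rmul[OF bil])
  then have "s * G nu nu = 0"
    using pairing_eqD(1)[OF nu, of u] sym[of "D u" nu] by (simp add: us bilinear_ladd[OF bil] bilinear_lmul[OF bil])
  then show ?thesis using us nu_timelike by auto
qed

end

section \<open>Lorentzian manifolds\<close>

locale lorentzian = atlas A
  for A :: "('m::{t2_space, second_countable_topology}, 'e::euclidean_space) chart set" +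
  fixes g :: "('m, 'e) metric"
  assumes lorentz: "lorentzian_metric A g"
begin

abbreviation mc :: "('m, 'e) chart \<Rightarrow> 'e \<Rightarrow> 'e \<Rightarrow> 'e \<Rightarrow> real" where
  "mc \<equiv> metric_coord A g"

lemma tensor: "smooth_symmetric_2_tensor A g"
  using lorentz by (simp add: lorentzian_metric_def)

lemma g_coord:
  "c \<in> A \<Longrightarrow> p \<in> cdom c \<Longrightarrow> v \<in> tangent_space A p \<Longrightarrow> w \<in> tangent_space A p \<Longrightarrow>
     g p v w = mc c (cmap c p) (v c) (w c)"
  by (simp add: metric_coord_def cinv_cmap tvec_of_eq)

lemma mc_bilinear: "c \<in> A \<Longrightarrow> x \<in> crange c \<Longrightarrow> bilinear (mc c x)"
  using tensor unfolding smooth_symmetric_2_tensor_def crange_def by blast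

lemma mc_sym: "c \<in> A \<Longrightarrow> x \<in> crange c \<Longrightarrow> mc c x u v = mc c x v u"
  using tensor unfolding smooth_symmetric_2_tensor_def metric_coord_def Let_def
  by (meson cinv_in tvec_of_in)

lemma mc_smooth: "c \<in> A \<Longrightarrow> smooth_on (crange c) (\<lambda>x. mc c x u v)"
  using tensor unfolding smooth_symmetric_2_tensor_def crange_def by blast

lemma mc_frame:
  assumes c: "c \<in> A" "x \<in> crange c"
  obtains e :: "nat \<Rightarrow> 'e" where "\<And>i j. i < DIM('e) \<Longrightarrow> j < DIM('e) \<Longrightarrow>
     mc c x (e i) (e j) = (if i \<noteq> j then 0 else if i = 0 then -1 else 1)"
proof -
  let ?p = "cinv c x"
  have p: "?p \<in> cdom c" by (rule cinv_in[OF c])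
  obtain e :: "nat \<Rightarrow> ('m, 'e) tvec" where e: "\<forall>i<DIM('e). e i \<in> tangent_space A ?p"
    "\<forall>i<DIM('e). \<forall>j<DIM('e). g ?p (e i) (e j) = (if i \<noteq> j then 0 else if i = 0 then -1 else 1)"
    using lorentz[unfolded lorentzian_metric_def, THEN conjunct2, THEN spec, of ?p] by (elim exE conjE)
  show ?thesis
    by (rule that[of "\<lambda>i. e i c"]) (use e g_coord[OF c(1) p] in \<open>simp add: cmap_cinv c\<close>)
qed

lemma mc_nondegenerate:
  assumes c: "c \<in> A" "x \<in> crange c" and u: "\<And>v. mc c x u v = 0"
  shows "u = 0"
proof -
  obtain e :: "nat \<Rightarrow> 'e" where e: "\<And>i j. i < DIM('e) \<Longrightarrow> j < DIM('e) \<Longrightarrow>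
     mc c x (e i) (e j) = (if i \<noteq> j then 0 else if i = 0 then -1 else 1)"
    using mc_frame[OF c] by blast
  \<comment> \<open>The sign at index 0 compensates for the timelike member, so that these
    functionals are dual to the frame.\<close>
  let ?\<phi> = "\<lambda>i z. (if i = 0 then -1 else 1) * mc c x (e i) z"
  have "(\<Sum>i<DIM('e). ?\<phi> i u *\<^sub>R e i) = u"
  proof (rule dual_family_expand)
    show "linear (?\<phi> i)" for i
      using mc_bilinear[OF c] by (auto simp: bilinear_radd bilinear_rmul intro!: linearI)
  qed (auto simp: e)
  moreover have "mc c x (e i) u = 0" for i using u[of "e i"] mc_sym[OF c, of u] by simp
  ultimately show ?thesis by simp
qed

lemma mc_timelike: "c \<in> A \<Longrightarrow> x \<in> crange c \<Longrightarrow> \<exists>t. mc c x t t < 0"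
proof -
  assume c: "c \<in> A" "x \<in> crange c"
  obtain e :: "nat \<Rightarrow> 'e" where e: "\<And>i j. i < DIM('e) \<Longrightarrow> j < DIM('e) \<Longrightarrow>
     mc c x (e i) (e j) = (if i \<noteq> j then 0 else if i = 0 then -1 else 1)"
    using mc_frame[OF c] by blast
  then have "mc c x (e 0) (e 0) < 0" by simp
  then show ?thesis by blast
qed

lemma metric_chart: "c \<in> A \<Longrightarrow> metric_chart (crange c) (mc c)"
  by unfold_locales (auto intro: open_crange mc_bilinear mc_sym mc_smooth mc_nondegenerate)

abbreviation chrs :: "('m, 'e) chart \<Rightarrow> 'e \<Rightarrow> 'e \<Rightarrow> 'e \<Rightarrow> 'e" where
  "chrs c \<equiv> metric_chart.chr (mc c)"

lemma christoffel_eq: "c \<in> A \<Longrightarrow> christoffel A g c = chrs c"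
  by (intro ext) (simp add: metric_chart.chr_def[OF metric_chart] christoffel_def levi_civita_at_def)

lemma metric_connection: "c \<in> A \<Longrightarrow> metric_connection (crange c) (mc c) (chrs c)"
proof -
  assume "c \<in> A"
  then interpret metric_chart "crange c" "mc c" by (rule metric_chart)
  show ?thesis by unfold_locales
qed

lemma mc_change:
  assumes "c \<in> A" "d \<in> A" "y \<in> overlap c d"
  shows "mc c y u v = mc d (trans c d y) (fd (trans c d) y u) (fd (trans c d) y v)"
proof -
  obtain p where p: "p \<in> cdom c" "p \<in> cdom d" "y = cmap c p" using assms(3) by (auto simp: overlap_def)
  show ?thesis
    using tvec_of_change[OF assms(1) p(1) assms(2) p(2)]
    by (simp add: metric_coord_def p(3) trans_cmap cinv_cmap assms p(1,2))
qed

lemma chrs_change: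
  assumes c: "c \<in> A" "d \<in> A" and p: "p \<in> cdom c" "p \<in> cdom d"
  shows "fd (trans c d) (cmap c p) (chrs c (cmap c p) u v) =
     fd (\<lambda>y. fd (trans c d) y v) (cmap c p) u +
     chrs d (cmap d p) (fd (trans c d) (cmap c p) u) (fd (trans c d) (cmap c p) v)"
proof -
  have "surj (fd (trans c d) (cmap c p))"
    using fd_trans_inverse[OF c(2,1) p(2,1)] by (metis surjI)
  moreover have "overlap c d \<subseteq> crange c" "trans c d ` overlap c d \<subseteq> crange d"
    using c by (auto simp: overlap_def crange_def trans_cmap)
  ultimately show ?thesis
    using christoffel_transform[OF metric_chart[OF c(1)] metric_chart[OF c(2)] open_overlap[OF c] _
        trans_smooth[OF c] _ mc_change[OF c] overlap_in[OF p], of u v]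
    by (simp add: trans_cmap c p)
qed

text \<open>\<open>ricci\<close> takes its trace in the chart \<open>chart_at A p\<close>; stating
  the formula for this chart avoids a proof that the trace does not depend on the chart.\<close>

lemma ricci_coord:
  assumes "Z \<in> tangent_space A p" "d = chart_at A p"
  shows "ricci A g p Z Z = (\<Sum>b\<in>Basis. metric_connection.curv (chrs d) (cmap d p) b (Z d) (Z d) \<bullet> b)"
proof -
  have d: "d \<in> A" "p \<in> cdom d" using chart_at_in assms(2) by auto
  have "riemann A g p (tvec_of A d p b) Z Z d = metric_connection.curv (chrs d) (cmap d p) b (Z d) (Z d)" for b
    using d by (simp add: riemann_def charts_at_iff christoffel_eq tvec_of_at
        metric_connection.curv_def[OF metric_connection] Let_def)
  then show ?thesis by (simp add: ricci_def tangent_trace_def assms(2)[symmetric] Let_def)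
qed

end


section \<open>Spacelike hypersurfaces in local coordinates\<close>

locale hypersurface = lorentzian A g + B: atlas B
  for A :: "('m::{t2_space, second_countable_topology}, 'e::euclidean_space) chart set"
    and g :: "('m, 'e) metric"
    and B :: "('p::{t2_space, second_countable_topology}, 'd::euclidean_space) chart set" +
  fixes f :: "'p \<Rightarrow> 'm" and \<xi> :: "'m \<Rightarrow> ('m, 'e) tvec"
  assumes hyper: "spacelike_hypersurface B A g f"
    and \<xi>_field: "smooth_vector_field A \<xi>" and \<xi>_lightlike: "lightlike_field g \<xi>" and \<xi>_par: "parallel_field A g \<xi>"
begin

definition rep :: "('p, 'd) chart \<Rightarrow> ('m, 'e) chart \<Rightarrow> 'd \<Rightarrow> 'e" where
  "rep c d x = cmap d (f (cinv c x))"

definition rdom :: "('p, 'd) chart \<Rightarrow> ('m, 'e) chart \<Rightarrow> 'd set" where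
  "rdom c d = cmap c ` (cdom c \<inter> f -` cdom d)"

definition fits :: "'p \<Rightarrow> ('p, 'd) chart \<Rightarrow> ('m, 'e) chart \<Rightarrow> bool" where
  "fits p c d \<longleftrightarrow> c \<in> B \<and> d \<in> A \<and> p \<in> cdom c \<and> f p \<in> cdom d"

abbreviation df :: "'p \<Rightarrow> ('p, 'd) tvec \<Rightarrow> ('m, 'e) tvec" where
  "df \<equiv> differential B A f"

abbreviation gI :: "('p, 'd) chart \<Rightarrow> 'd \<Rightarrow> 'd \<Rightarrow> 'd \<Rightarrow> real" where
  "gI \<equiv> metric_coord B (induced_metric B A g f)"

lemma fitsD: "fits p c d \<Longrightarrow> c \<in> B" "fits p c d \<Longrightarrow> d \<in> A" "fits p c d \<Longrightarrow> p \<in> cdom c" "fits p c d \<Longrightarrow> f p \<in> cdom d"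
  by (auto simp: fits_def)

lemma rdom_cases:
  assumes "x \<in> rdom c d" "c \<in> B" "d \<in> A"
  obtains p where "fits p c d" "x = cmap c p" "p = cinv c x"
proof -
  obtain p where p: "p \<in> cdom c" "f p \<in> cdom d" "x = cmap c p" using assms(1) by (auto simp: rdom_def)
  have "p = cinv c x" unfolding p(3) by (rule B.cinv_cmap[OF assms(2) p(1), symmetric])
  with p(3) show ?thesis by (rule that[rotated]) (simp add: fits_def assms p(1,2))
qed

lemma rdom_Int_cases:
  assumes "x \<in> rdom c d \<inter> rdom c d'" "c \<in> B" "d \<in> A" "d' \<in> A"
  obtains p where "fits p c d" "fits p c d'" "x = cmap c p" "p = cinv c x"
proof -
  obtain p where p: "fits p c d" "x = cmap c p" "p = cinv c x"
    using rdom_cases[OF IntD1[OF assms(1)] assms(2,3)] .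
  obtain q where q: "fits q c d'" "x = cmap c q" "q = cinv c x"
    using rdom_cases[OF IntD2[OF assms(1)] assms(2,4)] .
  have "q = p" using p(3) q(3) by simp
  show ?thesis by (rule that[OF p(1) q(1)[unfolded \<open>q = p\<close>] p(2,3)])
qed

lemma in_rdom: "fits p c d \<Longrightarrow> cmap c p \<in> rdom c d"
  by (auto simp: fits_def rdom_def)

lemma codim: "DIM('e) = DIM('d) + 1"
  using hyper by (simp add: spacelike_hypersurface_def)

lemma f_continuous: "continuous_on UNIV f"
  using hyper by (simp add: spacelike_hypersurface_def immersion_def smooth_map_def)

lemma open_rdom: "c \<in> B \<Longrightarrow> d \<in> A \<Longrightarrow> open (rdom c d)"
  unfolding rdom_def
  using B.open_chart_image[of c "f -` cdom d"] open_vimage[OF open_cdom f_continuous] by blast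

lemma rdom_subset: "rdom c d \<subseteq> crange c"
  by (auto simp: rdom_def crange_def)

lemma rep_smooth: "c \<in> B \<Longrightarrow> d \<in> A \<Longrightarrow> smooth_on (rdom c d) (rep c d)"
proof -
  have e: "rep c d = cmap d \<circ> f \<circ> cinv c" by (auto simp: rep_def)
  show "c \<in> B \<Longrightarrow> d \<in> A \<Longrightarrow> smooth_on (rdom c d) (rep c d)"
    using hyper unfolding e rdom_def spacelike_hypersurface_def immersion_def smooth_map_def by blast
qed

lemma rep_cmap: "fits p c d \<Longrightarrow> rep c d (cmap c p) = cmap d (f p)"
  by (simp add: rep_def B.cinv_cmap fits_def)

lemma rep_maps: "c \<in> B \<Longrightarrow> d \<in> A \<Longrightarrow> rep c d ` rdom c d \<subseteq> crange d"
  by (auto simp: rdom_def rep_def crange_def B.cinv_cmap)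

lemma rep_differentiable: "fits p c d \<Longrightarrow> rep c d differentiable (at (cmap c p))"
  by (rule smooth_on_differentiable[OF rep_smooth in_rdom]) (auto simp: fits_def)

lemma linear_drep: "fits p c d \<Longrightarrow> linear (fd (rep c d) (cmap c p))"
  by (rule linear_fd[OF rep_differentiable])

lemma drep_source_change:
  assumes "fits p c d" "fits p c' d"
  shows "fd (rep c d) (cmap c p) u = fd (rep c' d) (cmap c' p) (fd (B.trans c c') (cmap c p) u)"
  using B.fd_change_chart(1)[of c c' p "\<lambda>p. cmap d (f p)" u] rep_differentiable[OF assms(2)] assms
  by (simp add: rep_def[abs_def] fits_def)

lemma rep_target_change:
  assumes "fits p c d" "fits p c d'"
  shows "fd (rep c d') (cmap c p) u = fd (trans d d') (cmap d (f p)) (fd (rep c d) (cmap c p) u)"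
proof -
  note F = fitsD[OF assms(1)] fitsD[OF assms(2)]
  have o: "open (rdom c d \<inter> rdom c d')" "cmap c p \<in> rdom c d \<inter> rdom c d'"
    using open_Int[OF open_rdom[OF F(1,2)] open_rdom[OF F(5,6)]] in_rdom[OF assms(1)] in_rdom[OF assms(2)] by auto
  have dt: "trans d d' differentiable at (rep c d (cmap c p))"
    unfolding rep_cmap[OF assms(1)] by (rule trans_differentiable) (use F in auto)
  have dif: "(\<lambda>x. trans d d' (rep c d x)) differentiable at (cmap c p)"
    using differentiable_chain_at[OF rep_differentiable[OF assms(1)] dt] by (simp add: o_def)
  have "trans d d' (rep c d x) = rep c d' x" if x: "x \<in> rdom c d \<inter> rdom c d'" for x
  proof -
    obtain q where q: "fits q c d" "fits q c d'" "x = cmap c q" using rdom_Int_cases[OF x F(1,2,6)] .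
    show ?thesis using F fitsD[OF q(1)] by (simp add: q(3) rep_cmap[OF q(1)] rep_cmap[OF q(2)] trans_cmap)
  qed
  from fd_cong[OF o dif this] fd_compose[OF dt rep_differentiable[OF assms(1)]]
  show ?thesis by (simp add: rep_cmap[OF assms(1)])
qed

text \<open>\<open>differential\<close> reads the source in one chosen chart. By the chain rule any
  other chart around the point gives the same vector.\<close>

lemma df_coord:
  assumes "fits p c d" "v \<in> tangent_space B p"
  shows "df p v d = fd (rep c d) (cmap c p) (v c)"
proof -
  let ?c = "chart_at B p"
  have F: "fits p ?c d" using assms(1) B.chart_at_in by (auto simp: fits_def)
  have "df p v d = fd (rep ?c d) (cmap ?c p) (v ?c)"
  proof -
    have e: "rep ?c d = cmap d \<circ> f \<circ> cinv ?c" by (auto simp: rep_def)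
    show ?thesis unfolding e using fitsD[OF assms(1)] by (simp add: differential_def Let_def charts_at_iff)
  qed
  then show ?thesis
    using drep_source_change[OF assms(1) F, of "v c"] B.tangent_change[OF assms(2), of c ?c] F fitsD[OF assms(1)]
    by (simp add: fits_def)
qed

lemma df_in: "v \<in> tangent_space B p \<Longrightarrow> df p v \<in> tangent_space A (f p)"
proof -
  assume v: "v \<in> tangent_space B p"
  let ?c = "chart_at B p"
  have F: "fits p ?c d" if "d \<in> A" "f p \<in> cdom d" for d using that B.chart_at_in by (auto simp: fits_def)
  have "df p v d' = fd (trans d d') (cmap d (f p)) (df p v d)"
    if "d \<in> A" "f p \<in> cdom d" "d' \<in> A" "f p \<in> cdom d'" for d d'
    unfolding df_coord[OF F[OF that(1,2)] v] df_coord[OF F[OF that(3,4)] v]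
    by (rule rep_target_change[OF F[OF that(1,2)] F[OF that(3,4)]])
  moreover have "df p v d = 0" if "d \<notin> charts_at A (f p)" for d
    using that by (simp add: differential_def Let_def)
  ultimately show ?thesis unfolding tangent_space_iff by blast
qed

lemma df_inj: "inj_on (df p) (tangent_space B p)"
  using hyper by (simp add: spacelike_hypersurface_def immersion_def)

lemma riem: "riemannian_metric B (induced_metric B A g f)"
  using hyper by (simp add: spacelike_hypersurface_def)

lemma gI_coord: "fits p c d \<Longrightarrow> gI c (cmap c p) u v =
    mc d (cmap d (f p)) (fd (rep c d) (cmap c p) u) (fd (rep c d) (cmap c p) v)"
  using g_coord[of d "f p" "df p (tvec_of B c p u)" "df p (tvec_of B c p v)"] fitsD[of p c d]
  by (simp add: metric_coord_def[of B] induced_metric_def B.cinv_cmap df_in B.tvec_of_in df_coord B.tvec_of_at)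

lemma gI_bilinear: "c \<in> B \<Longrightarrow> x \<in> crange c \<Longrightarrow> bilinear (gI c x)"
  using riem unfolding riemannian_metric_def smooth_symmetric_2_tensor_def crange_def by blast

lemma gI_smooth: "c \<in> B \<Longrightarrow> smooth_on (crange c) (\<lambda>x. gI c x u v)"
  using riem unfolding riemannian_metric_def smooth_symmetric_2_tensor_def crange_def by blast

lemma gI_pos:
  assumes c: "c \<in> B" "x \<in> crange c" and u: "u \<noteq> 0"
  shows "gI c x u u > 0"
proof -
  let ?p = "cinv c x"
  have p: "?p \<in> cdom c" by (rule B.cinv_in[OF c])
  have "tvec_of B c ?p u \<noteq> (\<lambda>_. 0)" using B.tvec_of_at[OF c(1) p, of u] u by auto
  then show ?thesis
    using riem B.tvec_of_in[OF c(1) p] by (simp add: riemannian_metric_def metric_coord_def Let_def)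
qed

lemma gI_sym: "c \<in> B \<Longrightarrow> x \<in> crange c \<Longrightarrow> gI c x u v = gI c x v u"
  using riem B.tvec_of_in[OF _ B.cinv_in, of c x]
  unfolding riemannian_metric_def smooth_symmetric_2_tensor_def metric_coord_def Let_def by blast

section \<open>The parallel field and the unit normal in coordinates\<close>

definition \<xi>rep :: "('m, 'e) chart \<Rightarrow> 'e \<Rightarrow> 'e" where
  "\<xi>rep d y = \<xi> (cinv d y) d"

lemma \<xi>_in: "\<xi> p \<in> tangent_space A p"
  using \<xi>_field by (simp add: smooth_vector_field_def)

lemma \<xi>rep_smooth: "d \<in> A \<Longrightarrow> smooth_on (crange d) (\<xi>rep d)"
  using \<xi>_field unfolding smooth_vector_field_def crange_def \<xi>rep_def[abs_def] by blast

lemma \<xi>rep_parallel: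
  assumes d: "d \<in> A" "y \<in> crange d"
  shows "fd (\<xi>rep d) y v + chrs d y v (\<xi>rep d y) = 0"
proof -
  let ?q = "cinv d y"
  have q: "?q \<in> cdom d" by (rule cinv_in[OF d])
  have "cov_deriv A g ?q (tvec_of A d ?q v) \<xi> d = 0"
    using \<xi>_par tvec_of_in[OF d(1) q, of v] by (simp add: parallel_field_def)
  then show ?thesis
    using d q by (simp add: cov_deriv_def charts_at_iff christoffel_eq tvec_of_at cmap_cinv \<xi>rep_def[abs_def])
qed

lemma \<xi>rep_null:
  assumes "d \<in> A" "q \<in> cdom d"
  shows "mc d (cmap d q) (\<xi>rep d (cmap d q)) (\<xi>rep d (cmap d q)) = 0" "\<xi>rep d (cmap d q) \<noteq> 0"
proof -
  have e: "\<xi>rep d (cmap d q) = \<xi> q d" using assms by (simp add: \<xi>rep_def cinv_cmap)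
  show "mc d (cmap d q) (\<xi>rep d (cmap d q)) (\<xi>rep d (cmap d q)) = 0"
    unfolding e using g_coord[OF assms \<xi>_in \<xi>_in] \<xi>_lightlike by (simp add: lightlike_field_def)
  show "\<xi>rep d (cmap d q) \<noteq> 0"
  proof
    assume "\<xi>rep d (cmap d q) = 0"
    then have "\<xi> q = (\<lambda>_. 0)" unfolding e
      by (intro tangent_eqI[OF \<xi>_in zero_in_tangent_space assms]) simp
    then show False using \<xi>_lightlike by (simp add: lightlike_field_def)
  qed
qed

lemma hyperplane:
  assumes F: "fits p c d"
  shows "spacelike_hyperplane (mc d (cmap d (f p))) (fd (rep c d) (cmap c p)) (\<xi>rep d (cmap d (f p)))"
proof (rule spacelike_hyperplane.intro)
  note FD = fitsD[OF F]
  have y: "cmap d (f p) \<in> crange d" by (rule cmap_in[OF FD(4)])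
  show "bilinear (mc d (cmap d (f p)))" by (rule mc_bilinear[OF FD(2) y])
  show "mc d (cmap d (f p)) u v = mc d (cmap d (f p)) v u" for u v by (rule mc_sym[OF FD(2) y])
  show "u = 0" if "\<And>v. mc d (cmap d (f p)) u v = 0" for u by (rule mc_nondegenerate[OF FD(2) y that])
  show "\<exists>t. mc d (cmap d (f p)) t t < 0" by (rule mc_timelike[OF FD(2) y])
  show "linear (fd (rep c d) (cmap c p))" by (rule linear_drep[OF F])
  show "0 < mc d (cmap d (f p)) (fd (rep c d) (cmap c p) a) (fd (rep c d) (cmap c p) a)" if "a \<noteq> 0" for a
    using gI_pos[OF FD(1) cmap_in[OF FD(3)] that] by (simp add: gI_coord[OF F])
  show "DIM('e) = DIM('d) + 1" by (rule codim)
qed (rule \<xi>rep_null[OF fitsD(2)[OF F] fitsD(4)[OF F]])+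

abbreviation N :: "'p \<Rightarrow> ('m, 'e) tvec" where
  "N \<equiv> unit_normal B A g \<xi> f"

definition nrm :: "('p, 'd) chart \<Rightarrow> ('m, 'e) chart \<Rightarrow> 'd \<Rightarrow> 'e" where
  "nrm c d x = spacelike_hyperplane.normal (mc d (rep c d x)) (fd (rep c d) x) (\<xi>rep d (rep c d x))"

text \<open>In a pair of charts the conditions in \<open>unit_normal\<close> become those of
  \<open>spacelike_hyperplane\<close>, where existence and uniqueness are known. This resolves the
  description operator in the next lemma.\<close>

lemma N_iff:
  assumes F: "fits p c d" and z: "z \<in> tangent_space A (f p)"
  shows "(\<forall>v\<in>tangent_space B p. g (f p) z (df p v) = 0) \<and> g (f p) z z = -1 \<and> g (f p) z (\<xi> (f p)) > 0
    \<longleftrightarrow> z d = nrm c d (cmap c p)"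
proof -
  interpret H: spacelike_hyperplane "mc d (cmap d (f p))" "fd (rep c d) (cmap c p)" "\<xi>rep d (cmap d (f p))"
    by (rule hyperplane[OF F])
  note FD = fitsD[OF F]
  have \<xi>d: "\<xi>rep d (cmap d (f p)) = \<xi> (f p) d" using FD by (simp add: \<xi>rep_def cinv_cmap)
  have 1: "(\<forall>v\<in>tangent_space B p. g (f p) z (df p v) = 0) \<longleftrightarrow>
     (\<forall>u. mc d (cmap d (f p)) (z d) (fd (rep c d) (cmap c p) u) = 0)"
  proof -
    have "g (f p) z (df p v) = mc d (cmap d (f p)) (z d) (fd (rep c d) (cmap c p) (v c))"
      if "v \<in> tangent_space B p" for v
      using g_coord[OF FD(2,4) z df_in[OF that]] df_coord[OF F that] by simp
    then show ?thesis
      by (metis B.tvec_of_in[OF FD(1,3)] B.tvec_of_at[OF FD(1,3)])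
  qed
  have n: "nrm c d (cmap c p) = H.normal" by (simp add: nrm_def rep_cmap[OF F])
  show ?thesis
    unfolding 1 n g_coord[OF FD(2,4) z z] g_coord[OF FD(2,4) z \<xi>_in] \<xi>d[symmetric]
    using H.normal H.normal_unique by metis
qed

lemma N_props:
  assumes F: "fits p c d"
  shows "N p \<in> tangent_space A (f p)" "N p d = nrm c d (cmap c p)"
proof -
  note FD = fitsD[OF F]
  let ?P = "\<lambda>z. z \<in> tangent_space A (f p) \<and> (\<forall>v\<in>tangent_space B p. g (f p) z (df p v) = 0) \<and>
     g (f p) z z = -1 \<and> g (f p) z (\<xi> (f p)) > 0"
  let ?n = "tvec_of A d (f p) (nrm c d (cmap c p))"
  have n: "?n \<in> tangent_space A (f p)" "?n d = nrm c d (cmap c p)"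
    using FD by (auto simp: tvec_of_in tvec_of_at)
  have P: "?P z \<longleftrightarrow> z = ?n" for z
    using N_iff[OF F, of z] N_iff[OF F n(1)] n tangent_eqI[of z "f p" ?n d] FD by metis
  have "N p = (THE z. ?P z)" by (simp add: unit_normal_def)
  also have "\<dots> = ?n" unfolding P by simp
  finally show "N p \<in> tangent_space A (f p)" "N p d = nrm c d (cmap c p)" using n by auto
qed

lemma nrm_hyperplane:
  assumes F: "fits p c d"
  shows "mc d (cmap d (f p)) (nrm c d (cmap c p)) (fd (rep c d) (cmap c p) u) = 0"
    "mc d (cmap d (f p)) (nrm c d (cmap c p)) (nrm c d (cmap c p)) = -1"
    "mc d (cmap d (f p)) (nrm c d (cmap c p)) (\<xi>rep d (cmap d (f p))) > 0"
    "mc d (cmap d (f p)) z (nrm c d (cmap c p)) = 0 \<Longrightarrow> \<exists>u. z = fd (rep c d) (cmap c p) u"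
  using spacelike_hyperplane.normal[OF hyperplane[OF F]] spacelike_hyperplane.normal_complement[OF hyperplane[OF F]]
  by (simp_all add: nrm_def rep_cmap[OF F])

lemma conn: "c \<in> B \<Longrightarrow> d \<in> A \<Longrightarrow> connection_along (crange d) (mc d) (chrs d) (rdom c d) (rep c d)"
  by (intro connection_along.intro connection_along_axioms.intro metric_connection open_rdom rep_smooth rep_maps)

text \<open>The unnormalised direction \<open>nu\<close> solves a smooth injective linear system. It
  is timelike, so the square root that normalises it is taken of a positive function.\<close>

lemma nrm_smooth:
  assumes cd: "c \<in> B" "d \<in> A"
  shows "smooth_on (rdom c d) (nrm c d)"
proof -
  interpret C: connection_along "crange d" "mc d" "chrs d" "rdom c d" "rep c d" by (rule conn[OF cd])
  note op = open_rdom[OF cd]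
  let ?\<nu> = "\<lambda>x. spacelike_hyperplane.nu (mc d (rep c d x)) (fd (rep c d) x) (\<xi>rep d (rep c d x))"
  let ?L = "\<lambda>x. spacelike_hyperplane.pairing (mc d (rep c d x)) (fd (rep c d) x) (\<xi>rep d (rep c d x))"
  have H: "spacelike_hyperplane (mc d (rep c d x)) (fd (rep c d) x) (\<xi>rep d (rep c d x))" if x: "x \<in> rdom c d" for x
  proof -
    obtain p where p: "fits p c d" "x = cmap c p" "p = cinv c x" using rdom_cases[OF x cd] .
    show ?thesis using hyperplane[OF p(1)] by (simp add: p(2) rep_cmap[OF p(1)])
  qed
  have s\<xi>: "smooth_on (rdom c d) (\<lambda>x. \<xi>rep d (rep c d x))"
    by (rule smooth_on_compose[OF op open_crange[OF cd(2)] rep_maps[OF cd] rep_smooth[OF cd] \<xi>rep_smooth[OF cd(2)]])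
  have s\<nu>: "smooth_on (rdom c d) ?\<nu>"
  proof (rule smooth_on_solution[OF op, where L="?L"])
    show "linear (?L x)" "inj (?L x)" "?L x (?\<nu> x) = (0, 1)" if "x \<in> rdom c d" for x
      using spacelike_hyperplane.linear_pairing[OF H[OF that]] spacelike_hyperplane.inj_pairing[OF H[OF that]]
        spacelike_hyperplane.nu[OF H[OF that]] by auto
    show "smooth_on (rdom c d) (\<lambda>x. (0, 1))" by (rule smooth_on_const)
    show "smooth_on (rdom c d) (\<lambda>x. ?L x z)" for z
    proof (rule smooth_on_cong[OF op])
      show "(\<Sum>b\<in>Basis. mc d (rep c d x) z (fd (rep c d) x b) *\<^sub>R b, mc d (rep c d x) z (\<xi>rep d (rep c d x))) = ?L x z"
        if "x \<in> rdom c d" for x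
        using spacelike_hyperplane.pairing_def[OF H[OF that]] by simp
      show "smooth_on (rdom c d) (\<lambda>x. (\<Sum>b\<in>Basis. mc d (rep c d x) z (fd (rep c d) x b) *\<^sub>R b,
          mc d (rep c d x) z (\<xi>rep d (rep c d x))))"
        by (intro smooth_on_Pair smooth_on_sum smooth_on_scaleR op C.smooth_G smooth_on_const C.smooth_dF s\<xi>)
    qed
  qed
  show ?thesis
  proof (rule smooth_on_cong[OF op])
    show "inverse (sqrt (- mc d (rep c d x) (?\<nu> x) (?\<nu> x))) *\<^sub>R ?\<nu> x = nrm c d x" if "x \<in> rdom c d" for x
      using spacelike_hyperplane.normal_def[OF H[OF that]] by (simp add: nrm_def inverse_eq_divide)
    have tl: "0 < - mc d (rep c d x) (?\<nu> x) (?\<nu> x)" if "x \<in> rdom c d" for x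
      using spacelike_hyperplane.nu_timelike[OF H[OF that]] by simp
    have snz: "sqrt (- mc d (rep c d x) (?\<nu> x) (?\<nu> x)) \<noteq> 0" if "x \<in> rdom c d" for x
      using tl[OF that] by simp
    show "smooth_on (rdom c d) (\<lambda>x. inverse (sqrt (- mc d (rep c d x) (?\<nu> x) (?\<nu> x))) *\<^sub>R ?\<nu> x)"
      by (intro smooth_on_scaleR smooth_on_inverse_real smooth_on_sqrt smooth_on_minus op C.smooth_G s\<nu> tl snz)
  qed
qed

lemma N_rep: "c \<in> B \<Longrightarrow> d \<in> A \<Longrightarrow> x \<in> rdom c d \<Longrightarrow> N (cinv c x) d = nrm c d x"
proof -
  assume c: "c \<in> B" "d \<in> A" "x \<in> rdom c d"
  obtain p where p: "fits p c d" "x = cmap c p" "p = cinv c x" using rdom_cases[OF c(3,1,2)] .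
  from N_props(2)[OF p(1)] show ?thesis unfolding p(2)[symmetric] p(3)[symmetric] .
qed

section \<open>The covariant derivative of the unit normal along the immersion\<close>

definition ncov :: "('p, 'd) chart \<Rightarrow> ('m, 'e) chart \<Rightarrow> 'd \<Rightarrow> 'd \<Rightarrow> 'e" where
  "ncov c d u x = fd (nrm c d) x u + chrs d (rep c d x) (fd (rep c d) x u) (nrm c d x)"

abbreviation covN :: "'p \<Rightarrow> ('p, 'd) tvec \<Rightarrow> ('m, 'e) tvec" where
  "covN p X \<equiv> cov_deriv_along B A g f p X N"

lemma fd_N:
  assumes F: "fits p c d"
  shows "(\<lambda>x. N (cinv c x) d) differentiable (at (cmap c p))" "fd (\<lambda>x. N (cinv c x) d) (cmap c p) = fd (nrm c d) (cmap c p)"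
proof -
  note FD = fitsD[OF F]
  note a = open_rdom[OF FD(1,2)] in_rdom[OF F] smooth_on_differentiable[OF nrm_smooth[OF FD(1,2)] in_rdom[OF F]]
    N_rep[OF FD(1,2), symmetric]
  show "(\<lambda>x. N (cinv c x) d) differentiable (at (cmap c p))" by (rule differentiable_cong[OF a])
  show "fd (\<lambda>x. N (cinv c x) d) (cmap c p) = fd (nrm c d) (cmap c p)" by (rule fd_cong[OF a])
qed

lemma covN_coord:
  assumes F: "fits p c d" and X: "X \<in> tangent_space B p"
  shows "covN p X d = ncov c d (X c) (cmap c p)"
proof -
  let ?c = "chart_at B p"
  note FD = fitsD[OF F]
  have F': "fits p ?c d" using F B.chart_at_in by (auto simp: fits_def)
  have "fd (\<lambda>x. N (cinv ?c x) d) (cmap ?c p) (X ?c) = fd (nrm c d) (cmap c p) (X c)"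
    using B.fd_change_chart(1)[of c ?c p "\<lambda>p. N p d" "X c"] fd_N(1)[OF F'] fd_N(2)[OF F] B.tangent_change[OF X FD(1,3), of ?c]
      fitsD[OF F'] FD by simp
  then show ?thesis
    using FD by (simp add: cov_deriv_along_def Let_def charts_at_iff christoffel_eq ncov_def rep_cmap[OF F]
        df_coord[OF F X] N_props(2)[OF F])
qed

text \<open>That \<open>\<nabla>\<^sub>X N\<close> obeys the transformation law of vectors is needed even for the existence of the
  vector described in \<open>shape_operator\<close>.\<close>

lemma ncov_target_change:
  assumes F: "fits p c d" and F': "fits p c d'"
  shows "ncov c d' u (cmap c p) = fd (trans d d') (cmap d (f p)) (ncov c d u (cmap c p))"
proof -
  note FD = fitsD[OF F] fitsD[OF F']
  let ?x = "cmap c p" and ?y = "cmap d (f p)" and ?\<Phi> = "trans d d'"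
  let ?U = "rdom c d \<inter> rdom c d'"
  have o: "open ?U" "?x \<in> ?U" 
    using open_Int[OF open_rdom[OF FD(1,2)] open_rdom[OF FD(5,6)]] in_rdom[OF F] in_rdom[OF F'] by auto
  have m: "rep c d ` ?U \<subseteq> overlap d d'"
  proof (rule image_subsetI)
    fix x assume "x \<in> ?U"
    then obtain q where q: "fits q c d" "fits q c d'" "x = cmap c q" using rdom_Int_cases[OF _ FD(1,2,6)] by metis
    show "rep c d x \<in> overlap d d'"
      using overlap_in fitsD[OF q(1)] fitsD[OF q(2)] by (simp add: q(3) rep_cmap[OF q(1)])
  qed
  have dif: "?\<Phi> differentiable (at y)" if "y \<in> overlap d d'" for y
    by (rule smooth_on_differentiable[OF trans_smooth that]) (use FD in auto)
  have sF: "smooth_on ?U (rep c d)" "smooth_on ?U (nrm c d)"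
    using smooth_on_subset[OF rep_smooth[OF FD(1,2)]] smooth_on_subset[OF nrm_smooth[OF FD(1,2)]] by auto
  have l: "linear (fd ?\<Phi> (rep c d x))" if "x \<in> ?U" for x
    using linear_fd[OF dif] m that by blast
  have s: "smooth_on ?U (\<lambda>x. fd ?\<Phi> (rep c d x) w)" for w
    by (rule smooth_on_compose[OF o(1) open_overlap m sF(1) smooth_on_fd[OF trans_smooth]]) (use FD in auto)
  have n: "nrm c d' x = fd ?\<Phi> (rep c d x) (nrm c d x)" if x: "x \<in> ?U" for x
  proof -
    obtain q where q: "fits q c d" and q': "fits q c d'" and xq: "x = cmap c q" using rdom_Int_cases[OF x FD(1,2,6)] .
    show ?thesis
      using tangent_change[OF N_props(1)[OF q], of d d'] N_props(2)[OF q] N_props(2)[OF q'] fitsD[OF q] fitsD[OF q']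
      by (simp add: xq rep_cmap[OF q])
  qed
  have "fd (nrm c d') ?x u = fd (\<lambda>x. fd ?\<Phi> (rep c d x) (nrm c d x)) ?x u"
  proof -
    have "smooth_on ?U (\<lambda>x. fd ?\<Phi> (rep c d x) (nrm c d x))"
      by (rule smooth_on_linear_field[where L="\<lambda>x w. fd ?\<Phi> (rep c d x) w", OF o(1) l s sF(2)])
    from fd_cong[OF o smooth_on_differentiable[OF this o(2)] n[symmetric]] show ?thesis by simp
  qed
  also have "\<dots> = fd (\<lambda>x. fd ?\<Phi> (rep c d x) (nrm c d ?x)) ?x u + fd ?\<Phi> (rep c d ?x) (fd (nrm c d) ?x u)"
    by (rule fd_linear_field[where L="\<lambda>x w. fd ?\<Phi> (rep c d x) w", OF o l s sF(2)])
  also have "fd (\<lambda>x. fd ?\<Phi> (rep c d x) (nrm c d ?x)) ?x u = fd (\<lambda>y. fd ?\<Phi> y (nrm c d ?x)) ?y (fd (rep c d) ?x u)"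
  proof -
    have "(\<lambda>y. fd ?\<Phi> y (nrm c d ?x)) differentiable (at (rep c d ?x))"
      by (rule smooth_on_differentiable[OF smooth_on_fd[OF trans_smooth]]) (use FD m o(2) in auto)
    from fd_compose[OF this rep_differentiable[OF F]] show ?thesis by (simp add: rep_cmap[OF F])
  qed
  finally have "fd (nrm c d') ?x u = fd (\<lambda>y. fd ?\<Phi> y (nrm c d ?x)) ?y (fd (rep c d) ?x u) + fd ?\<Phi> ?y (fd (nrm c d) ?x u)"
    by (simp add: rep_cmap[OF F])
  moreover have "linear (fd ?\<Phi> ?y)" by (rule linear_fd_trans) (use FD in auto)
  \<comment> \<open>The second derivative of the transition map, produced by the product rule, is
    exactly the inhomogeneous term in the transformation law of the Christoffel symbols, and the two
    cancel.\<close>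
  ultimately show ?thesis
    using chrs_change[of d d' "f p" "fd (rep c d) ?x u" "nrm c d ?x"] FD n[OF o(2)] rep_target_change[OF F F', of u]
    by (simp add: ncov_def rep_cmap[OF F] rep_cmap[OF F'] linear_add)
qed

lemma covN_in:
  assumes X: "X \<in> tangent_space B p"
  shows "covN p X \<in> tangent_space A (f p)"
proof -
  let ?c = "chart_at B p"
  have F: "fits p ?c d" if "d \<in> A" "f p \<in> cdom d" for d using that B.chart_at_in by (auto simp: fits_def)
  have "covN p X d' = fd (trans d d') (cmap d (f p)) (covN p X d)"
    if "d \<in> A" "f p \<in> cdom d" "d' \<in> A" "f p \<in> cdom d'" for d d'
    unfolding covN_coord[OF F[OF that(1,2)] X] covN_coord[OF F[OF that(3,4)] X]
    by (rule ncov_target_change[OF F[OF that(1,2)] F[OF that(3,4)]])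
  moreover have "covN p X d = 0" if "d \<notin> charts_at A (f p)" for d
    using that by (simp add: cov_deriv_along_def Let_def)
  ultimately show ?thesis unfolding tangent_space_iff by blast
qed



section \<open>The shape operator in coordinates\<close>

abbreviation Sh :: "'p \<Rightarrow> ('p, 'd) tvec \<Rightarrow> ('p, 'd) tvec" where
  "Sh \<equiv> shape_operator B A g \<xi> f"

lemma cov_nrm: "c \<in> B \<Longrightarrow> d \<in> A \<Longrightarrow> connection_along.cov (chrs d) (rep c d) u (nrm c d) x = ncov c d u x"
  using connection_along.cov_def[OF conn] by (simp add: ncov_def)

lemma ncov_normal:
  assumes F: "fits p c d"
  shows "mc d (cmap d (f p)) (ncov c d u (cmap c p)) (nrm c d (cmap c p)) = 0"
proof -
  note FD = fitsD[OF F]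
  interpret C: connection_along "crange d" "mc d" "chrs d" "rdom c d" "rep c d" by (rule conn[OF FD(1,2)])
  note x = in_rdom[OF F]
  note sn = nrm_smooth[OF FD(1,2)]
  have "-1 = mc d (rep c d y) (nrm c d y) (nrm c d y)" if y: "y \<in> rdom c d" for y
  proof -
    obtain q where q: "fits q c d" "y = cmap c q" "q = cinv c y" using rdom_cases[OF y FD(1,2)] .
    show ?thesis using nrm_hyperplane(2)[OF q(1)] by (simp add: q(2) rep_cmap[OF q(1)])
  qed
  then have "fd (\<lambda>y. mc d (rep c d y) (nrm c d y) (nrm c d y)) (cmap c p) = fd (\<lambda>_. -1) (cmap c p)"
    by (intro fd_cong[OF C.open_U x]) auto
  then show ?thesis
    using C.fd_G[OF sn sn x, of u] C.G_sym[OF C.F_in[OF x], of "nrm c d (cmap c p)"]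
    by (simp add: cov_nrm[OF FD(1,2)] rep_cmap[OF F])
qed

lemma inj_drep:
  assumes F: "fits p c d" shows "inj (fd (rep c d) (cmap c p))"
  unfolding linear_injective_0[OF linear_drep[OF F]]
proof (intro allI impI)
  fix a assume a: "fd (rep c d) (cmap c p) a = 0"
  have "gI c (cmap c p) a a = 0"
    unfolding gI_coord[OF F] a using mc_bilinear[OF fitsD(2)[OF F] cmap_in[OF fitsD(4)[OF F]]] by (rule bilinear_lzero)
  then show "a = 0" using gI_pos[OF fitsD(1)[OF F] cmap_in[OF fitsD(3)[OF F]], of a] by force
qed

text \<open>Differentiating <N,N> = -1 shows that the derivative of N is orthogonal to N, hence in
  the image of the differential. Injectivity of the differential makes the preimage unique.\<close>

lemma shape:
  assumes X: "X \<in> tangent_space B p"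
  shows "Sh p X \<in> tangent_space B p" "df p (Sh p X) = (\<lambda>d. - covN p X d)"
proof -
  let ?c = "chart_at B p" and ?d = "chart_at A (f p)"
  have F: "fits p ?c ?d" using chart_at_in B.chart_at_in by (simp add: fits_def)
  note FD = fitsD[OF F]
  let ?W = "\<lambda>d. - covN p X d"
  obtain u where u: "ncov ?c ?d (X ?c) (cmap ?c p) = fd (rep ?c ?d) (cmap ?c p) u"
    using nrm_hyperplane(4)[OF F ncov_normal[OF F]] by blast
  let ?Y = "tvec_of B ?c p (- u)"
  have Y: "?Y \<in> tangent_space B p" by (rule B.tvec_of_in[OF FD(1,3)])
  have dY: "df p ?Y = ?W"
    by (rule tangent_eqI[OF df_in[OF Y] minus_in_tangent_space[OF covN_in[OF X]] FD(2,4)])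
       (simp add: df_coord[OF F Y] covN_coord[OF F X] B.tvec_of_at[OF FD(1,3)] u linear_neg[OF linear_drep[OF F]])
  have "Sh p X = ?Y"
    unfolding shape_operator_def
  proof (rule the_equality)
    show "?Y \<in> tangent_space B p \<and> df p ?Y = ?W" using Y dY by blast
    show "Z = ?Y" if "Z \<in> tangent_space B p \<and> df p Z = ?W" for Z
      using that Y dY df_inj by (metis inj_onD)
  qed
  then show "Sh p X \<in> tangent_space B p" "df p (Sh p X) = ?W" using Y dY by simp_all
qed

definition scoord :: "('p, 'd) chart \<Rightarrow> 'd \<Rightarrow> 'd \<Rightarrow> 'd" where
  "scoord c x u = Sh (cinv c x) (tvec_of B c (cinv c x) u) c"

lemma scoord_cmap: "c \<in> B \<Longrightarrow> p \<in> cdom c \<Longrightarrow> scoord c (cmap c p) u = Sh p (tvec_of B c p u) c"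
  by (simp add: scoord_def B.cinv_cmap)

lemma Sh_coord: "c \<in> B \<Longrightarrow> p \<in> cdom c \<Longrightarrow> X \<in> tangent_space B p \<Longrightarrow> Sh p X c = scoord c (cmap c p) (X c)"
  by (simp add: scoord_cmap B.tvec_of_eq)

lemma scoord_eq:
  assumes F: "fits p c d"
  shows "fd (rep c d) (cmap c p) (scoord c (cmap c p) u) = - ncov c d u (cmap c p)"
proof -
  note FD = fitsD[OF F]
  note X = B.tvec_of_in[OF FD(1,3), of u]
  have "df p (Sh p (tvec_of B c p u)) d = - covN p (tvec_of B c p u) d" using shape(2)[OF X] by simp
  then show ?thesis
    by (simp add: df_coord[OF F shape(1)[OF X]] covN_coord[OF F X] scoord_cmap FD B.tvec_of_at)
qed

lemma linear_ncov:
  assumes F: "fits p c d" shows "linear (\<lambda>u. ncov c d u (cmap c p))"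
proof -
  note FD = fitsD[OF F]
  interpret C: connection_along "crange d" "mc d" "chrs d" "rdom c d" "rep c d" by (rule conn[OF FD(1,2)])
  note l = linear_fd[OF smooth_on_differentiable[OF nrm_smooth[OF FD(1,2)] in_rdom[OF F]]]
    linear_drep[OF F] C.linear_\<Gamma>(2)[OF C.F_in[OF in_rdom[OF F]]]
  show ?thesis
    unfolding ncov_def
    by (rule linearI) (simp_all add: linear_add[OF l(1)] linear_add[OF l(2)] linear_add[OF l(3)]
        linear_scale[OF l(1)] linear_scale[OF l(2)] linear_scale[OF l(3)] scaleR_add_right)
qed

lemma linear_scoord:
  assumes "c \<in> B" "p \<in> cdom c" shows "linear (scoord c (cmap c p))"
proof -
  have F: "fits p c (chart_at A (f p))" using assms chart_at_in by (simp add: fits_def)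
  let ?D = "fd (rep c (chart_at A (f p))) (cmap c p)"
  have "?D (scoord c (cmap c p) (u + v)) = ?D (scoord c (cmap c p) u + scoord c (cmap c p) v)" for u v
    by (simp add: linear_add[OF linear_drep[OF F]] scoord_eq[OF F] linear_add[OF linear_ncov[OF F]])
  moreover have "?D (scoord c (cmap c p) (s *\<^sub>R u)) = ?D (s *\<^sub>R scoord c (cmap c p) u)" for u s
    by (simp add: linear_scale[OF linear_drep[OF F]] scoord_eq[OF F] linear_scale[OF linear_ncov[OF F]])
  ultimately show ?thesis using injD[OF inj_drep[OF F]] by (intro linearI) blast+
qed

text \<open>The system has one equation more than unknowns, the differential being injective but not
  onto. This is why \<open>smooth_on_solution\<close> is formulated with injective maps between
  different spaces.\<close>

lemma scoord_smooth:
  assumes cd: "c \<in> B" "d \<in> A"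
  shows "smooth_on (rdom c d) (\<lambda>x. scoord c x u)"
proof (rule smooth_on_solution[OF open_rdom[OF cd], where L="fd (rep c d)"])
  interpret C: connection_along "crange d" "mc d" "chrs d" "rdom c d" "rep c d" by (rule conn[OF cd])
  fix x assume x: "x \<in> rdom c d"
  obtain p where p: "fits p c d" "x = cmap c p" "p = cinv c x" using rdom_cases[OF x cd] .
  show "linear (fd (rep c d) x)" "inj (fd (rep c d) x)"
    unfolding p(2) by (rule linear_drep[OF p(1)], rule inj_drep[OF p(1)])
  show "fd (rep c d) x (scoord c x u) = - ncov c d u x"
    unfolding p(2) by (rule scoord_eq[OF p(1)])
next
  interpret C: connection_along "crange d" "mc d" "chrs d" "rdom c d" "rep c d" by (rule conn[OF cd])
  show "smooth_on (rdom c d) (\<lambda>x. fd (rep c d) x v)" for v by (rule C.smooth_dF)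
  have "C.cov u (nrm c d) = ncov c d u" by (rule ext) (rule cov_nrm[OF cd])
  then show "smooth_on (rdom c d) (\<lambda>x. - ncov c d u x)"
    using C.smooth_cov[OF nrm_smooth[OF cd], of u] by (intro smooth_on_minus C.open_U) simp
qed

text \<open>The shape operators read in two charts are conjugate by the derivative of the transition
  map, so their traces agree. Constancy of the mean curvature is thus available in every
  chart.\<close>

lemma trace_scoord:
  assumes c: "c \<in> B" "p \<in> cdom c"
  shows "tangent_trace B p (Sh p) = (\<Sum>b\<in>Basis. scoord c (cmap c p) b \<bullet> b)"
proof -
  let ?c = "chart_at B p"
  note c0 = B.chart_at_in[of p]
  let ?M = "fd (B.trans ?c c) (cmap ?c p)" and ?M' = "fd (B.trans c ?c) (cmap c p)"
  have "Sh p (tvec_of B ?c p b) ?c = ?M' (scoord c (cmap c p) (?M b))" for b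
    using B.tangent_change[OF shape(1)[OF B.tvec_of_in[OF c0, of b]] c c0]
      Sh_coord[OF c B.tvec_of_in[OF c0, of b]] B.tvec_of_other[OF c, of ?c b] by simp
  then have "tangent_trace B p (Sh p) = (\<Sum>b\<in>Basis. ?M' (scoord c (cmap c p) (?M b)) \<bullet> b)"
    by (simp add: tangent_trace_def Let_def)
  also have "\<dots> = (\<Sum>b\<in>Basis. scoord c (cmap c p) b \<bullet> b)"
    by (rule trace_similar[OF linear_scoord[OF c] B.linear_fd_trans[OF c(1) c0(1) c(2) c0(2)]
          B.fd_trans_inverse[OF c0(1) c(1) c0(2) c(2)]])
  finally show ?thesis .
qed

section \<open>The height function on the hypersurface and its Laplacian\<close>

definition hgt :: "'p \<Rightarrow> real" where
  "hgt p = g (f p) (N p) (\<xi> (f p))"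

lemma hgt_coord:
  assumes F: "fits p c d"
  shows "hgt p = mc d (cmap d (f p)) (nrm c d (cmap c p)) (\<xi>rep d (cmap d (f p)))"
  using g_coord[OF fitsD(2)[OF F] fitsD(4)[OF F] N_props(1)[OF F] \<xi>_in] N_props(2)[OF F] fitsD[OF F]
  by (simp add: hgt_def \<xi>rep_def cinv_cmap)

lemma default_fits: "fits p (chart_at B p) (chart_at A (f p))"
  using chart_at_in B.chart_at_in by (simp add: fits_def)

lemma hgt_pos: "hgt p > 0"
  using hgt_coord[OF default_fits] nrm_hyperplane(3)[OF default_fits] by simp

text \<open>The mean curvature is the trace of the shape operator times -1/n, so the constant trace
  is \<open>- (real DIM('d) * h)\<close>.\<close>

lemma patch:
  assumes H: "\<And>p. mean_curvature B A g \<xi> f p = h" and cd: "c \<in> B" "d \<in> A"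
  shows "spacelike_patch (crange d) (mc d) (chrs d) (rdom c d) (rep c d) (\<xi>rep d) (nrm c d) (scoord c) (- (real DIM('d) * h))"
proof (intro spacelike_patch.intro spacelike_patch_axioms.intro conn[OF cd] codim \<xi>rep_smooth[OF cd(2)] \<xi>rep_parallel[OF cd(2)]
    nrm_smooth[OF cd] scoord_smooth[OF cd])
  fix x assume x: "x \<in> rdom c d"
  obtain p where p: "fits p c d" "x = cmap c p" "p = cinv c x" using rdom_cases[OF x cd] .
  note FD = fitsD[OF p(1)]
  show "mc d (rep c d x) (nrm c d x) (fd (rep c d) x u) = 0" for u
    unfolding p(2) rep_cmap[OF p(1)] by (rule nrm_hyperplane(1)[OF p(1)])
  show "mc d (rep c d x) (nrm c d x) (nrm c d x) = -1"
    unfolding p(2) rep_cmap[OF p(1)] by (rule nrm_hyperplane(2)[OF p(1)])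
  show "0 < mc d (rep c d x) (fd (rep c d) x u) (fd (rep c d) x u)" if "u \<noteq> 0" for u
    using gI_pos[OF FD(1) cmap_in[OF FD(3)] that] unfolding p(2) rep_cmap[OF p(1)] gI_coord[OF p(1)] .
  show "linear (scoord c x)" unfolding p(2) by (rule linear_scoord[OF FD(1,3)])
  show "connection_along.cov (chrs d) (rep c d) u (nrm c d) x = - fd (rep c d) x (scoord c x u)" for u
    unfolding cov_nrm[OF cd] p(2) scoord_eq[OF p(1)] by simp
  show "(\<Sum>b\<in>Basis. scoord c x b \<bullet> b) = - (real DIM('d) * h)"
    using H[of p] trace_scoord[OF FD(1,3)] by (simp add: mean_curvature_def p(2) field_simps)
qed

context
  fixes h :: real
  assumes H: "\<And>p. mean_curvature B A g \<xi> f p = h"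
begin

lemma hgt_smooth:
  assumes cd: "c \<in> B" "d \<in> A"
  shows "smooth_on (rdom c d) (\<lambda>x. hgt (cinv c x))"
proof -
  interpret P: spacelike_patch "crange d" "mc d" "chrs d" "rdom c d" "rep c d" "\<xi>rep d" "nrm c d" "scoord c" "- (real DIM('d) * h)"
    by (rule patch[OF H cd])
  show ?thesis
  proof (rule smooth_on_cong[OF P.open_U _ P.height_smooth])
    fix x assume x: "x \<in> rdom c d"
    obtain p where p: "fits p c d" "x = cmap c p" "p = cinv c x" using rdom_cases[OF x cd] .
    show "P.height x = hgt (cinv c x)"
      unfolding p(3)[symmetric] hgt_coord[OF p(1)] P.height_def by (simp add: p(2) rep_cmap[OF p(1)])
  qed
qed

text \<open>The patch formula rewritten with \<open>gI\<close>, \<open>hgt\<close> and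
  \<open>ricci\<close>. The functions agree on the open set \<open>rdom c d\<close>, hence so do
  their derivatives; the target chart is fixed to the one in which \<open>ricci\<close> takes its
  trace.\<close>

lemma laplacian_hgt:
  fixes e :: "'d \<Rightarrow> 'd"
  assumes F: "fits p c d" and d: "d = chart_at A (f p)"
    and e: "\<And>i j. i \<in> Basis \<Longrightarrow> j \<in> Basis \<Longrightarrow> gI c (cmap c p) (e i) (e j) = (if i = j then 1 else 0)"
    and b: "\<And>v. gI c (cmap c p) b v = christoffel_trace (gI c) (cmap c p) e v"
  defines "u \<equiv> \<lambda>x. hgt (cinv c x)"
  shows "frame_laplacian e b u (cmap c p) =
     hgt p * ((\<Sum>k\<in>Basis. gI c (cmap c p) (scoord c (cmap c p) (e k)) (scoord c (cmap c p) (e k)))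
       + ricci A g (f p) (N p) (N p))"
proof -
  note cd = fitsD(1,2)[OF F]
  interpret P: spacelike_patch "crange d" "mc d" "chrs d" "rdom c d" "rep c d" "\<xi>rep d" "nrm c d" "scoord c" "- (real DIM('d) * h)"
    by (rule patch[OF H cd])
  let ?x = "cmap c p"
  note x = in_rdom[OF F] and op = P.open_U
  have m: "P.metr y u v = gI c y u v" if y: "y \<in> rdom c d" for y u v
  proof -
    obtain q where q: "fits q c d" "y = cmap c q" "q = cinv c y" using rdom_cases[OF y cd] .
    show ?thesis by (simp add: P.metr_def q(2) gI_coord[OF q(1)] rep_cmap[OF q(1)])
  qed
  have dm: "fd (\<lambda>y. P.metr y u v) ?x = fd (\<lambda>y. gI c y u v) ?x" for u v
    by (rule fd_cong[OF op x smooth_on_differentiable[OF P.metr_smooth x] m, symmetric])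
  have hu: "P.height y = u y" if y: "y \<in> rdom c d" for y
  proof -
    obtain q where q: "fits q c d" "y = cmap c q" "q = cinv c y" using rdom_cases[OF y cd] .
    show ?thesis
      unfolding u_def q(3)[symmetric] hgt_coord[OF q(1)] P.height_def by (simp add: q(2) rep_cmap[OF q(1)])
  qed
  have d1: "fd u y = fd P.height y" if "y \<in> rdom c d" for y
    by (rule fd_cong[OF op that smooth_on_differentiable[OF P.height_smooth that] hu])
  have d2: "fd (\<lambda>x. fd u x v) ?x = fd (\<lambda>x. fd P.height x v) ?x" for v
    by (rule fd_cong[OF op x smooth_on_differentiable[OF smooth_on_fd[OF P.height_smooth] x]]) (simp add: d1)
  have e': "P.metr ?x (e i) (e j) = (if i = j then 1 else 0)" if "i \<in> Basis" "j \<in> Basis" for i j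
    using e[OF that] by (simp add: m[OF x])
  have b': "P.metr ?x b v = christoffel_trace P.metr ?x e v" for v
    using b[of v] by (simp add: christoffel_trace_def m[OF x] dm)
  have cc: "mc d (rep c d ?x) (P.cov v (nrm c d) ?x) (P.cov v (nrm c d) ?x) = gI c ?x (scoord c ?x v) (scoord c ?x v)" for v
    using bilinear_lneg[OF P.G_bilinear[OF P.F_in[OF x]]] bilinear_rneg[OF P.G_bilinear[OF P.F_in[OF x]]]
    by (simp add: P.S_eq[OF x] m[OF x, symmetric] P.metr_def)
  have ric: "ricci A g (f p) (N p) (N p) = (\<Sum>b\<in>Basis. P.curv (rep c d ?x) b (nrm c d ?x) (nrm c d ?x) \<bullet> b)"
    using ricci_coord[OF N_props(1)[OF F] d] by (simp add: N_props(2)[OF F] rep_cmap[OF F])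
  have ux: "u ?x = hgt p" by (simp add: u_def B.cinv_cmap[OF fitsD(1)[OF F] fitsD(3)[OF F]])
  have "frame_laplacian e b u ?x = frame_laplacian e b P.height ?x"
    unfolding frame_laplacian_def d1[OF x] d2 ..
  then show ?thesis
    unfolding ric cc[symmetric] ux[symmetric] hu[OF x, symmetric]
    by (simp only: P.laplacian_height[OF x e' b'])
qed

section \<open>Consequences of the curvature condition on timelike vectors\<close>

context
  assumes Ric: "\<And>q Z. Z \<in> tangent_space A q \<Longrightarrow> g q Z Z < 0 \<Longrightarrow> ricci A g q Z Z \<ge> 0"
begin

lemma ricci_N: "ricci A g (f p) (N p) (N p) \<ge> 0"
proof (rule Ric[OF N_props(1)[OF default_fits]])
  show "g (f p) (N p) (N p) < 0"
    using N_iff[OF default_fits N_props(1)[OF default_fits], of p] N_props(2)[OF default_fits, of p] by simp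
qed

lemma gI_chart: "c \<in> B \<Longrightarrow> metric_chart (crange c) (gI c)"
proof
  assume c: "c \<in> B"
  show "open (crange c)" by (rule B.open_crange[OF c])
  show "bilinear (gI c y)" if "y \<in> crange c" for y by (rule gI_bilinear[OF c that])
  show "gI c y u v = gI c y v u" if "y \<in> crange c" for y u v by (rule gI_sym[OF c that])
  show "smooth_on (crange c) (\<lambda>y. gI c y u v)" for u v by (rule gI_smooth[OF c])
  show "u = 0" if "y \<in> crange c" "\<And>v. gI c y u v = 0" for y u
    using gI_pos[OF c that(1), of u] that(2)[of u] by force
qed

lemma frame_exists:
  assumes c: "c \<in> B" "y \<in> crange c"
  obtains e :: "'d \<Rightarrow> 'd" and b where
    "\<And>i j. i \<in> Basis \<Longrightarrow> j \<in> Basis \<Longrightarrow> gI c y (e i) (e j) = (if i = j then 1 else 0)"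
    "\<And>v. gI c y b v = christoffel_trace (gI c) y e v"
proof -
  interpret M: metric_chart "crange c" "gI c" by (rule gI_chart[OF c(1)])
  obtain e :: "'d \<Rightarrow> 'd" where e: "\<forall>i\<in>Basis. \<forall>j\<in>Basis. gI c y (e i) (e j) = (if i = j then 1 else 0)"
    using orthonormal_family_exists[OF M.G_bilinear[OF c(2)] M.G_sym[OF c(2)] gI_pos[OF c]] by blast
  have "linear (christoffel_trace (gI c) y e)"
    unfolding christoffel_trace_def[abs_def]
    by (rule linearI)
       (simp_all add: linear_add[OF M.G_fd_linear(1)[OF c(2)]] linear_scale[OF M.G_fd_linear(1)[OF c(2)]]
        linear_add[OF M.G_fd_linear(3)[OF c(2)]] linear_scale[OF M.G_fd_linear(3)[OF c(2)]]
        sum.distrib sum_subtractf sum_distrib_left algebra_simps add_divide_distrib)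
  from M.riesz[OF c(2) this] show ?thesis using that e by blast
qed

text \<open>The Laplacian of the height is the product of the positive height with a sum of squares
  plus a nonnegative Ricci term. So the strong maximum principle applies in every chart.\<close>

lemma hgt_locally_constant:
  assumes F: "fits p c d" and S: "open S" "S \<subseteq> rdom c d" and le: "\<And>x. x \<in> S \<Longrightarrow> hgt (cinv c x) \<le> m"
  shows "open {x \<in> S. hgt (cinv c x) = m}"
proof (rule strong_maximum_principle[OF S(1) smooth_on_subset[OF hgt_smooth S(2)] le])
  show "c \<in> B" "d \<in> A" using fitsD[OF F] by auto
  fix K assume K: "compact K" "K \<subseteq> S"
  have KR: "K \<subseteq> crange c" using K(2) S(2) rdom_subset by blast
  note c = fitsD(1)[OF F]
  obtain \<kappa> \<Lambda> where \<kappa>: "\<kappa> > 0" and op: "\<forall>y\<in>K. \<forall>(e :: 'd \<Rightarrow> 'd) b.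
     (\<forall>i\<in>Basis. \<forall>j\<in>Basis. gI c y (e i) (e j) = (if i = j then 1 else 0)) \<longrightarrow>
     (\<forall>v. gI c y b v = christoffel_trace (gI c) y e v) \<longrightarrow>
     elliptic_bounds \<kappa> \<Lambda> e b"
    using metric_laplacian_elliptic[OF B.open_crange[OF c] gI_bilinear[OF c] gI_pos[OF c] gI_smooth[OF c] K(1) KR] by blast
  have "\<exists>e b. elliptic_bounds \<kappa> \<Lambda> e b \<and> 0 \<le> frame_laplacian e b (\<lambda>x. hgt (cinv c x)) y"
    if y: "y \<in> K" for y
  proof -
    have yR: "y \<in> crange c" using y KR by blast
    obtain e :: "'d \<Rightarrow> 'd" and b where
      e: "\<And>i j. i \<in> Basis \<Longrightarrow> j \<in> Basis \<Longrightarrow> gI c y (e i) (e j) = (if i = j then 1 else 0)" and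
      b: "\<And>v. gI c y b v = christoffel_trace (gI c) y e v"
      using frame_exists[OF c yR] by blast
    let ?q = "cinv c y"
    have q: "?q \<in> cdom c" "cmap c ?q = y" using B.cinv_in[OF c yR] B.cmap_cinv[OF c yR] by auto
    \<comment> \<open>The Ricci term requires the chosen chart at \<open>f ?q\<close>, possibly
      different from \<open>d\<close> and varying with \<open>y\<close>. This is harmless, as the
      Laplacian on the left depends on the source chart \<open>c\<close> only.\<close>
    have Fq: "fits ?q c (chart_at A (f ?q))" using c q chart_at_in by (simp add: fits_def)
    have nn: "gI c y v v \<ge> 0" for v
      using gI_pos[OF c yR, of v] bilinear_lzero[OF gI_bilinear[OF c yR], of 0] by (cases "v = 0") auto
    have "0 \<le> hgt ?q * ((\<Sum>k\<in>Basis. gI c y (scoord c y (e k)) (scoord c y (e k))) + ricci A g (f ?q) (N ?q) (N ?q))"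
      using hgt_pos[of ?q] ricci_N[of ?q] by (intro mult_nonneg_nonneg add_nonneg_nonneg sum_nonneg nn) auto
    also have "\<dots> = frame_laplacian e b (\<lambda>x. hgt (cinv c x)) y"
      using laplacian_hgt[OF Fq refl, unfolded q(2), OF e b] by simp
    finally show ?thesis using op y e b by blast
  qed
  then show "\<exists>\<kappa>>0. \<exists>\<Lambda>. \<forall>y\<in>K. \<exists>e b.
       elliptic_bounds \<kappa> \<Lambda> e b \<and> 0 \<le> frame_laplacian e b (\<lambda>x. hgt (cinv c x)) y"
    using \<kappa> by blast
qed

text \<open>Where the height is locally constant its Laplacian is 0. The height being positive, the
  two nonnegative summands |A|^2 and Ric(N,N) both vanish, and definiteness of the induced metric
  kills A on the frame.\<close>

lemma shape_zero_if_locally_constant: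
  assumes F: "fits p c d" and S: "open S" "cmap c p \<in> S" and const: "\<And>x. x \<in> S \<Longrightarrow> hgt (cinv c x) = m"
    and X: "X \<in> tangent_space B p"
  shows "Sh p X = (\<lambda>_. 0)"
proof -
  note FD = fitsD[OF F]
  let ?x = "cmap c p"
  have xR: "?x \<in> crange c" by (rule cmap_in[OF FD(3)])
  obtain e :: "'d \<Rightarrow> 'd" and b where
    e: "\<And>i j. i \<in> Basis \<Longrightarrow> j \<in> Basis \<Longrightarrow> gI c ?x (e i) (e j) = (if i = j then 1 else 0)" and
    b: "\<And>v. gI c ?x b v = christoffel_trace (gI c) ?x e v"
    using frame_exists[OF FD(1) xR] by blast
  have Fp: "fits p c (chart_at A (f p))" using FD chart_at_in by (simp add: fits_def)
  let ?u = "\<lambda>x. hgt (cinv c x)"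
  have d1: "fd ?u y = (\<lambda>_. 0)" if "y \<in> S" for y
    using fd_cong[OF S(1) that, of "\<lambda>_. m" ?u] const by simp
  have d2: "fd (\<lambda>x. fd ?u x v) ?x = (\<lambda>_. 0)" for v
    using fd_cong[OF S, of "\<lambda>_. 0" "\<lambda>x. fd ?u x v"] d1 by simp
  have nn: "gI c ?x v v \<ge> 0" for v
    using gI_pos[OF FD(1) xR, of v] bilinear_lzero[OF gI_bilinear[OF FD(1) xR], of 0] by (cases "v = 0") auto
  have "(\<Sum>k\<in>Basis. gI c ?x (scoord c ?x (e k)) (scoord c ?x (e k))) + ricci A g (f p) (N p) (N p) = 0"
    using laplacian_hgt[OF Fp refl e b] hgt_pos[of p] by (simp add: frame_laplacian_def d1[OF S(2)] d2)
  then have "(\<Sum>k\<in>Basis. gI c ?x (scoord c ?x (e k)) (scoord c ?x (e k))) = 0"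
    using ricci_N[of p] sum_nonneg[of "Basis :: 'd set" "\<lambda>k. gI c ?x (scoord c ?x (e k)) (scoord c ?x (e k))"] nn by fastforce
  then have "gI c ?x (scoord c ?x (e k)) (scoord c ?x (e k)) = 0" if "k \<in> Basis" for k
    using that nn by (subst (asm) sum_nonneg_eq_0_iff) auto
  then have Se: "scoord c ?x (e k) = 0" if "k \<in> Basis" for k
    using gI_pos[OF FD(1) xR, of "scoord c ?x (e k)"] that by force
  note lS = linear_scoord[OF FD(1,3)]
  have "scoord c ?x v = scoord c ?x (\<Sum>k\<in>Basis. gI c ?x (e k) v *\<^sub>R e k)" for v
    using orthonormal_family_expand(1)[OF gI_bilinear[OF FD(1) xR] e, of v] by simp
  then have "scoord c ?x v = 0" for v
    by (simp add: linear_sum[OF lS] linear_scale[OF lS] Se)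
  then show ?thesis
    by (intro B.tangent_eqI[OF shape(1)[OF X] B.zero_in_tangent_space FD(1,3)]) (simp add: Sh_coord[OF FD(1,3) X])
qed

section \<open>From charts to the whole compact hypersurface\<close>

lemma hgt_continuous: "continuous_on UNIV hgt"
proof -
  have "isCont hgt p" for p
  proof -
    let ?c = "chart_at B p" and ?d = "chart_at A (f p)"
    note F = default_fits[of p]
    note FD = fitsD[OF F]
    let ?W = "cinv ?c ` rdom ?c ?d"
    have W: "?W = cdom ?c \<inter> cmap ?c -` rdom ?c ?d" by (rule B.chart_preimage_eq[OF FD(1) rdom_subset])
    have "continuous_on ?W (\<lambda>q. hgt (cinv ?c (cmap ?c q)))"
      using smooth_on_continuous_on[OF hgt_smooth[OF FD(1,2)]] B.chart_homeo[OF FD(1)] unfolding W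
      by (intro continuous_on_compose2[where g="\<lambda>x. hgt (cinv ?c x)" and f="cmap ?c"])
         (auto simp: homeomorphism_def intro: continuous_on_subset)
    then have "continuous_on ?W hgt"
      by (rule continuous_on_eq) (simp add: W B.cinv_cmap[OF FD(1)])
    moreover have "open ?W" by (rule B.open_chart_preimage[OF FD(1) open_rdom[OF FD(1,2)] rdom_subset])
    moreover have "p \<in> ?W" using in_rdom[OF F] FD(3) W by simp
    ultimately show ?thesis using continuous_on_eq_continuous_at by blast
  qed
  then show ?thesis by (simp add: continuous_on_eq_continuous_at)
qed

text \<open>The hypersurface may be disconnected, so the maximum is taken on the component of the
  given point. The component is closed and hence compact, and the set where the maximum is attained
  is open, closed and nonempty in it.\<close>

lemma totally_geodesic:
  assumes cpt: "compact (UNIV :: 'p set)"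
  shows "totally_geodesic B A g \<xi> f"
  unfolding totally_geodesic_def
proof (intro allI ballI)
  fix p0 X assume X: "X \<in> tangent_space B p0"
  let ?K = "connected_component_set (UNIV :: 'p set) p0"
  have Kclosed: "closed ?K" by (rule closed_connected_component) simp
  have Kcpt: "compact ?K" using compact_Int_closed[OF cpt Kclosed] by simp
  have p0K: "p0 \<in> ?K" by simp
  obtain q where q: "q \<in> ?K" "\<And>p. p \<in> ?K \<Longrightarrow> hgt p \<le> hgt q"
    using continuous_attains_sup[OF Kcpt, of hgt] p0K continuous_on_subset[OF hgt_continuous] by blast
  define m where "m = hgt q"
  \<comment> \<open>The coordinate domain is cut down to a ball because balls are connected: its
    image then stays in the component, where the height is known not to exceed
    \<open>m\<close>.\<close>
  have nbhd: "\<exists>c d S. fits p c d \<and> open S \<and> S \<subseteq> rdom c d \<and> cmap c p \<in> S \<and> cinv c ` S \<subseteq> ?K" if p: "p \<in> ?K" for p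
  proof -
    let ?c = "chart_at B p" and ?d = "chart_at A (f p)"
    note F = default_fits[of p]
    note FD = fitsD[OF F]
    obtain r where r: "r > 0" "ball (cmap ?c p) r \<subseteq> rdom ?c ?d"
      using open_rdom[OF FD(1,2)] in_rdom[OF F] open_contains_ball by blast
    let ?S = "ball (cmap ?c p) r"
    have "connected (cinv ?c ` ?S)"
      by (intro connected_continuous_image continuous_on_subset[OF homeomorphism_cont2[OF B.chart_homeo[OF FD(1)]]]
          order_trans[OF r(2) rdom_subset] connected_ball)
    moreover have "p \<in> cinv ?c ` ?S"
      using r(1) B.cinv_cmap[OF FD(1,3)] by (intro image_eqI[of _ _ "cmap ?c p"]) auto
    ultimately have "cinv ?c ` ?S \<subseteq> connected_component_set UNIV p"
      by (intro connected_component_maximal) auto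
    also have "\<dots> = ?K" using p connected_component_eq by blast
    finally show ?thesis using F r by (intro exI[of _ ?c] exI[of _ ?d] exI[of _ ?S]) auto
  qed
  let ?C = "{p \<in> ?K. hgt p = m}"
  have "open ?C"
  proof (subst open_subopen, rule ballI)
    fix p assume p: "p \<in> ?C"
    then obtain c d S where S: "fits p c d" "open S" "S \<subseteq> rdom c d" "cmap c p \<in> S" "cinv c ` S \<subseteq> ?K"
      using nbhd[of p] by auto
    note FD = fitsD[OF S(1)]
    let ?T = "{x \<in> S. hgt (cinv c x) = m}"
    have "open ?T"
      by (rule hgt_locally_constant[OF S(1-3)]) (use q(2) S(5) in \<open>auto simp: m_def\<close>)
    then have "open (cinv c ` ?T)"
      using order_trans[OF S(3) rdom_subset] by (intro B.open_chart_preimage[OF FD(1)]) auto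
    moreover have "p \<in> cinv c ` ?T"
      using p S(4) B.cinv_cmap[OF FD(1,3)] by (intro image_eqI[of _ _ "cmap c p"]) auto
    moreover have "cinv c ` ?T \<subseteq> ?C" using S(5) by auto
    ultimately show "\<exists>T. open T \<and> p \<in> T \<and> T \<subseteq> ?C" by blast
  qed
  moreover have "closed ?C"
  proof -
    have "?C = ?K \<inter> hgt -` {m}" by auto
    then show ?thesis using continuous_closed_vimage[of "{m}" hgt] hgt_continuous Kclosed
      by (auto simp: continuous_on_eq_continuous_at intro: closed_Int)
  qed
  moreover have "connected ?K" by simp
  ultimately have "?C = {} \<or> ?C = ?K"
    unfolding connected_clopen by (metis (no_types, lifting) closed_subset mem_Collect_eq open_subset subsetI)
  then have CK: "?C = ?K" using q(1) by (auto simp: m_def)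
  obtain c d S where S: "fits p0 c d" "open S" "S \<subseteq> rdom c d" "cmap c p0 \<in> S" "cinv c ` S \<subseteq> ?K"
    using nbhd[OF p0K] by auto
  show "Sh p0 X = (\<lambda>_. 0)"
    by (rule shape_zero_if_locally_constant[OF S(1,2,4) _ X]) (use S(5) CK in blast)
qed

end

end

end

theorem theorem1:
  fixes A :: "('m::{t2_space, second_countable_topology}, 'e::euclidean_space) chart set"
    and g :: "('m, 'e) metric"
    and \<xi> :: "'m \<Rightarrow> ('m, 'e) tvec"
    and n :: nat
  assumes "n \<ge> 2"
    and "DIM('e) = n + 1"
    and "DIM('d::euclidean_space) = n"
    and "smooth_atlas A"
    and "lorentzian_metric A g"
    and "smooth_vector_field A \<xi>"
    and "lightlike_field g \<xi>"
    and "parallel_field A g \<xi>"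
    and "\<And>p Z. Z \<in> tangent_space A p \<Longrightarrow> g p Z Z < 0 \<Longrightarrow> ricci A g p Z Z \<ge> 0"
  shows "(\<forall>(B :: ('p::{t2_space, second_countable_topology}, 'd) chart set) x.
            compact (UNIV :: 'p set) \<and> spacelike_hypersurface B A g x \<and>
            (\<exists>h. \<forall>p. mean_curvature B A g \<xi> x p = h)
            \<longrightarrow> totally_geodesic B A g \<xi> x) \<and>
         \<not> (\<exists>(B :: ('p, 'd) chart set) x h.
            compact (UNIV :: 'p set) \<and> spacelike_hypersurface B A g x \<and>
            h \<noteq> 0 \<and> (\<forall>p. mean_curvature B A g \<xi> x p = h))"
proof -
  have hs: "hypersurface A g B x \<xi>" if "spacelike_hypersurface B A g x"
    for B :: "('p, 'd) chart set" and x
    using that assms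
    by (intro hypersurface.intro hypersurface_axioms.intro lorentzian.intro lorentzian_axioms.intro atlas.intro)
       (auto simp: spacelike_hypersurface_def)
  have tg: "totally_geodesic B A g \<xi> x"
    if "compact (UNIV :: 'p set)" "spacelike_hypersurface B A g x" "\<And>p. mean_curvature B A g \<xi> x p = h"
    for B :: "('p, 'd) chart set" and x h
    by (rule hypersurface.totally_geodesic[OF hs[OF that(2)] that(3) assms(9) that(1)])
  \<comment> \<open>Nonexistence follows from the first claim: a totally geodesic hypersurface has a
    shape operator of trace 0, so its mean curvature vanishes.\<close>
  have "h = 0"
    if that: "compact (UNIV :: 'p set)" "spacelike_hypersurface B A g x" "\<And>p. mean_curvature B A g \<xi> x p = h"
    for B :: "('p, 'd) chart set" and x h
  proof -
    interpret hypersurface A g B x \<xi> by (rule hs[OF that(2)])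
    \<comment> \<open>The hypersurface is a whole type and therefore nonempty, so there is a point
      at which to compare \<open>h\<close> with 0.\<close>
    fix p :: 'p
    have "shape_operator B A g \<xi> x p (tvec_of B (chart_at B p) p b) = (\<lambda>_. 0)" for b
      using tg[OF that] B.tvec_of_in[OF B.chart_at_in] by (simp add: totally_geodesic_def)
    then have "mean_curvature B A g \<xi> x p = 0" by (simp add: mean_curvature_def tangent_trace_def Let_def)
    then show "h = 0" using that(3) by simp
  qed
  then show ?thesis using tg by blast
qed

end
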